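(* Let $B,C,D$ be dg-categories over a field $k$, with dg-functors $G:B\to D$ and $L:C\to D$, and let $A=B\times^h_DC$ be their homotopy fiber product. Let $\tilde D$ and $Q=(B\times^h_DC,\tilde D)$ be the $A$-bimodules $$\tilde D\big((M_1,N_1,\phi_1),(M_2,N_2,\phi_2)\big)=D(G(M_1),L(N_2))[-1],$$ $$Q\big((M_1,N_1,\phi_1),(M_2,N_2,\phi_2)\big)=B(M_1,M_2)\oplus C(N_1,N_2),$$ which fit into the short exact sequence of $A$-bimodules $0\to\tilde D\to A\to Q\to0$. Then there is a long exact sequence of $H^0(A)$-bimodules $$\cdots\to H^{-1}(Q)\to H^0(\tilde D)\to H^0(A)\to H^0(Q)\to H^1(\tilde D)\to\cdots.$$ There is also a short exact sequence of Hochschild cochain complexes of the dg-category $A$ with coefficients in the three bimodules $\tilde D$, $A$, $Q$. It leads to a long exact sequence in Hochschild cohomology $$0\to HH^{0}(A,\tilde D)\to HH^0(A,A)\to HH^0(A,Q)\to HH^{1}(A,\tilde D)\to\cdots.$$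
   Context: Dg-categories are enriched over $\mathbb{Z}$-graded complexes of $k$-vector spaces with differentials of degree $+1$. The dg-category $B\times^h_DC$ has objects $(M,N,\phi)$ with $M\in B$, $N\in C$ and $\phi\in D^0(G(M),L(N))$ closed and invertible in $H^0(D)$; the degree $i$ morphisms from $(M_1,N_1,\phi_1)$ to $(M_2,N_2,\phi_2)$ are $B^i(M_1,M_2)\oplus C^i(N_1,N_2)\oplus D^{i-1}(G(M_1),L(N_2))$; the composition is $(\mu',\nu',\gamma')(\mu,\nu,\gamma)=(\mu'\mu,\nu'\nu,(-1)^{|\mu|}\gamma'G(\mu)+L(\nu')\gamma)$, where $|\mu|$ is the degree of the morphism $(\mu,\nu,\gamma)$; the differential on degree $i$ is $d(\mu,\nu,\gamma)=(d\mu,d\nu,d\gamma+(-1)^i(\phi_2G(\mu)-L(\nu)\phi_1))$. The bimodule $\tilde D$ is the sub-bimodule of $A$ (viewed as a bimodule over itself) consisting of the elements $(0,0,\gamma)$, so its degree $i$ part is $D^{i-1}(G(M_1),L(N_2))$, with differential and actions inherited from $A$; $Q$ is the quotient bimodule, with differential and actions given componentwise. $H^i$ of a bimodule means the cohomology of its value on each pair of objects, a bimodule over the category $H^0(A)$. $HH^\bullet(A,M)$ denotes the cohomology of the Hochschild cochain complex of the dg-category $A$ with coefficients in a dg $A$-bimodule $M$.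
   Formalization: The leading 0 before HH^0(A,D̃) is false in general; the long exact sequence is instead given over all integer degrees, with the left zero when HH^{-1}(A,Q)=0, or when the Hochschild complexes are cut off to start in degree 0. *)

theory Defs
  imports "HOL-Algebra.Module" "HOL-Library.Product_Plus" "HOL-Library.Function_Algebras"
begin

section \<open>Vector spaces over a field given as a type\<close>

text \<open>
  The base field is a type of class \<open>field\<close>. Vector spaces over it are modules in the sense of
  HOL-Algebra; their ring fields \<open>mult\<close> and \<open>one\<close> are irrelevant.
\<close>

definition scalars :: "'k::field ring" where
  "scalars = \<lparr>carrier = UNIV, mult = (*), one = 1, zero = 0, add = (+)\<rparr>"

definition lin_map :: "('k::field, 'v) module \<Rightarrow> ('k, 'w) module \<Rightarrow> ('v \<Rightarrow> 'w) \<Rightarrow> bool" where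
  "lin_map V W f \<longleftrightarrow>
     (\<forall>x \<in> carrier V. f x \<in> carrier W) \<and>
     (\<forall>x \<in> carrier V. \<forall>y \<in> carrier V. f (x \<oplus>\<^bsub>V\<^esub> y) = f x \<oplus>\<^bsub>W\<^esub> f y) \<and>
     (\<forall>c. \<forall>x \<in> carrier V. f (c \<odot>\<^bsub>V\<^esub> x) = c \<odot>\<^bsub>W\<^esub> f x)"

definition bilin_map ::
  "('k::field, 'u) module \<Rightarrow> ('k, 'v) module \<Rightarrow> ('k, 'w) module \<Rightarrow> ('u \<Rightarrow> 'v \<Rightarrow> 'w) \<Rightarrow> bool" where
  "bilin_map U V W f \<longleftrightarrow>
     (\<forall>x \<in> carrier U. lin_map V W (f x)) \<and> (\<forall>y \<in> carrier V. lin_map U W (\<lambda>x. f x y))"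

definition exact_at ::
  "('k::field, 'u) module \<Rightarrow> ('k, 'v) module \<Rightarrow> ('k, 'w) module \<Rightarrow> ('u \<Rightarrow> 'v) \<Rightarrow> ('v \<Rightarrow> 'w) \<Rightarrow> bool" where
  "exact_at U V W f g \<longleftrightarrow> f ` carrier U = {v \<in> carrier V. g v = \<zero>\<^bsub>W\<^esub>}"

definition long_exact ::
  "(int \<Rightarrow> ('k::field, 'u) module) \<Rightarrow> (int \<Rightarrow> ('k, 'v) module) \<Rightarrow> (int \<Rightarrow> ('k, 'w) module) \<Rightarrow>
   (int \<Rightarrow> 'u \<Rightarrow> 'v) \<Rightarrow> (int \<Rightarrow> 'v \<Rightarrow> 'w) \<Rightarrow> (int \<Rightarrow> 'w \<Rightarrow> 'u) \<Rightarrow> bool" where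
  "long_exact U V W f g \<delta> \<longleftrightarrow>
     (\<forall>n. module scalars (U n) \<and> module scalars (V n) \<and> module scalars (W n) \<and>
          lin_map (U n) (V n) (f n) \<and> lin_map (V n) (W n) (g n) \<and> lin_map (W n) (U (n + 1)) (\<delta> n) \<and>
          exact_at (U n) (V n) (W n) (f n) (g n) \<and>
          exact_at (V n) (W n) (U (n + 1)) (g n) (\<delta> n) \<and>
          exact_at (W n) (U (n + 1)) (V (n + 1)) (\<delta> n) (f (n + 1)))"


section \<open>Cochain complexes and their cohomology\<close>

text \<open>
  The homogeneous components are carriers inside one additive group. They need not be independent
  of each other, so degrees are always passed explicitly. A family of complexes given abstractly is
  represented inside the direct sum of all its components.
\<close>

record ('k, 'm) cplx =
  csmul :: "'k \<Rightarrow> 'm \<Rightarrow> 'm"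
  cgr :: "int \<Rightarrow> 'm set"
  cdif :: "int \<Rightarrow> 'm \<Rightarrow> 'm"

definition component :: "('k::field, 'm::ab_group_add) cplx \<Rightarrow> int \<Rightarrow> ('k, 'm) module" where
  "component K n = \<lparr>carrier = cgr K n, mult = undefined, one = undefined,
                    zero = 0, add = (+), smult = csmul K\<rparr>"

definition is_complex :: "('k::field, 'm::ab_group_add) cplx \<Rightarrow> bool" where
  "is_complex K \<longleftrightarrow>
     (\<forall>n. module scalars (component K n) \<and>
          lin_map (component K n) (component K (n + 1)) (cdif K n) \<and>
          (\<forall>x \<in> cgr K n. cdif K (n + 1) (cdif K n x) = 0))"

definition cocycles :: "('k, 'm::ab_group_add) cplx \<Rightarrow> int \<Rightarrow> 'm set" where
  "cocycles K n = {x \<in> cgr K n. cdif K n x = 0}"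

definition coboundaries :: "('k, 'm::ab_group_add) cplx \<Rightarrow> int \<Rightarrow> 'm set" where
  "coboundaries K n = cdif K (n - 1) ` cgr K (n - 1)"

definition cls :: "('k, 'm::ab_group_add) cplx \<Rightarrow> int \<Rightarrow> 'm \<Rightarrow> 'm set" where
  "cls K n x = {x + b | b. b \<in> coboundaries K n}"

text \<open>The cohomology is the space of cosets of the coboundaries in the cocycles.\<close>

definition cohomology :: "('k::field, 'm::ab_group_add) cplx \<Rightarrow> int \<Rightarrow> ('k, 'm set) module" where
  "cohomology K n = \<lparr>carrier = cls K n ` cocycles K n, mult = undefined, one = undefined,
     zero = cls K n 0, add = (\<lambda>S T. \<Union>s\<in>S. \<Union>t\<in>T. cls K n (s + t)),
     smult = (\<lambda>c S. \<Union>s\<in>S. cls K n (csmul K c s))\<rparr>"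

definition chain_map ::
  "('k::field, 'm::ab_group_add) cplx \<Rightarrow> ('k, 'n::ab_group_add) cplx \<Rightarrow> (int \<Rightarrow> 'm \<Rightarrow> 'n) \<Rightarrow> bool" where
  "chain_map K L f \<longleftrightarrow>
     (\<forall>n. lin_map (component K n) (component L n) (f n) \<and>
          (\<forall>x \<in> cgr K n. f (n + 1) (cdif K n x) = cdif L n (f n x)))"

text \<open>The map induced by \<open>f\<close> on cohomology; only the target complex is needed.\<close>

definition coh_map ::
  "('k, 'n::ab_group_add) cplx \<Rightarrow> (int \<Rightarrow> 'm \<Rightarrow> 'n) \<Rightarrow> int \<Rightarrow> 'm set \<Rightarrow> 'n set" where
  "coh_map L f n S = (\<Union>x\<in>S. cls L n (f n x))"

definition short_exact ::
  "('k::field, 'm::ab_group_add) cplx \<Rightarrow> ('k, 'n::ab_group_add) cplx \<Rightarrow> ('k, 'p::ab_group_add) cplx \<Rightarrow>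
   (int \<Rightarrow> 'm \<Rightarrow> 'n) \<Rightarrow> (int \<Rightarrow> 'n \<Rightarrow> 'p) \<Rightarrow> bool" where
  "short_exact K L P f g \<longleftrightarrow>
     is_complex K \<and> is_complex L \<and> is_complex P \<and> chain_map K L f \<and> chain_map L P g \<and>
     (\<forall>n. inj_on (f n) (cgr K n) \<and>
          f n ` cgr K n = {y \<in> cgr L n. g n y = 0} \<and>
          g n ` cgr L n = cgr P n)"

text \<open>
  The connecting map of the snake lemma: lift a representative along \<open>g\<close>, apply the differential,
  and pull back along \<open>f\<close>.
\<close>

definition connecting ::
  "('k, 'm::ab_group_add) cplx \<Rightarrow> ('k, 'n::ab_group_add) cplx \<Rightarrow>
   (int \<Rightarrow> 'm \<Rightarrow> 'n) \<Rightarrow> (int \<Rightarrow> 'n \<Rightarrow> 'p) \<Rightarrow> int \<Rightarrow> 'p set \<Rightarrow> 'm set" where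
  "connecting K L f g n S =
     (\<Union>y \<in> {y \<in> cgr L n. g n y \<in> S}. \<Union>x \<in> {x \<in> cgr K (n + 1). f (n + 1) x = cdif L n y}.
        cls K (n + 1) x)"

text \<open>The brutal truncation: degrees below \<open>0\<close> are discarded, so the cohomology in degree \<open>0\<close> is the
  kernel of the differential there, and the cohomology in positive degrees is unchanged.\<close>

definition nonneg_part :: "('k, 'm::ab_group_add) cplx \<Rightarrow> ('k, 'm) cplx" where
  "nonneg_part K = K\<lparr>cgr := (\<lambda>n. if n < 0 then {0} else cgr K n)\<rparr>"


section \<open>Linear categories and bimodules\<close>

record ('k, 'o, 'v) lincat =
  lobj :: "'o set"
  lhom :: "'o \<Rightarrow> 'o \<Rightarrow> ('k, 'v) module"
  lcomp :: "'o \<Rightarrow> 'o \<Rightarrow> 'o \<Rightarrow> 'v \<Rightarrow> 'v \<Rightarrow> 'v"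
  lid :: "'o \<Rightarrow> 'v"

text \<open>In \<open>lcomp C x y z g f\<close> we have \<open>f : x \<rightarrow> y\<close> and \<open>g : y \<rightarrow> z\<close>; likewise for all compositions
  and actions below.\<close>

definition lin_category :: "('k::field, 'o, 'v) lincat \<Rightarrow> bool" where
  "lin_category C \<longleftrightarrow>
     (\<forall>x \<in> lobj C. \<forall>y \<in> lobj C. module scalars (lhom C x y)) \<and>
     (\<forall>x \<in> lobj C. \<forall>y \<in> lobj C. \<forall>z \<in> lobj C.
        bilin_map (lhom C y z) (lhom C x y) (lhom C x z) (lcomp C x y z)) \<and>
     (\<forall>w \<in> lobj C. \<forall>x \<in> lobj C. \<forall>y \<in> lobj C. \<forall>z \<in> lobj C.
        \<forall>h \<in> carrier (lhom C y z). \<forall>g \<in> carrier (lhom C x y). \<forall>f \<in> carrier (lhom C w x).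
          lcomp C w y z h (lcomp C w x y g f) = lcomp C w x z (lcomp C x y z h g) f) \<and>
     (\<forall>x \<in> lobj C. lid C x \<in> carrier (lhom C x x)) \<and>
     (\<forall>x \<in> lobj C. \<forall>y \<in> lobj C. \<forall>f \<in> carrier (lhom C x y).
        lcomp C x y y (lid C y) f = f \<and> lcomp C x x y f (lid C x) = f)"

definition lin_iso :: "('k, 'o, 'v) lincat \<Rightarrow> 'o \<Rightarrow> 'o \<Rightarrow> 'v \<Rightarrow> bool" where
  "lin_iso C x y f \<longleftrightarrow>
     f \<in> carrier (lhom C x y) \<and>
     (\<exists>g \<in> carrier (lhom C y x). lcomp C x y x g f = lid C x \<and> lcomp C y x y f g = lid C y)"

record ('k, 'o, 'v, 'a) linbimod =
  lval :: "'o \<Rightarrow> 'o \<Rightarrow> ('k, 'v) module"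
  llact :: "'o \<Rightarrow> 'o \<Rightarrow> 'o \<Rightarrow> 'a \<Rightarrow> 'v \<Rightarrow> 'v"
  lract :: "'o \<Rightarrow> 'o \<Rightarrow> 'o \<Rightarrow> 'v \<Rightarrow> 'a \<Rightarrow> 'v"

definition lin_bimodule :: "('k::field, 'o, 'a) lincat \<Rightarrow> ('k, 'o, 'v, 'a) linbimod \<Rightarrow> bool" where
  "lin_bimodule C M \<longleftrightarrow>
     (\<forall>x \<in> lobj C. \<forall>y \<in> lobj C. module scalars (lval M x y)) \<and>
     (\<forall>x \<in> lobj C. \<forall>y \<in> lobj C. \<forall>z \<in> lobj C.
        bilin_map (lhom C y z) (lval M x y) (lval M x z) (llact M x y z) \<and>
        bilin_map (lval M y z) (lhom C x y) (lval M x z) (lract M x y z)) \<and>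
     (\<forall>w \<in> lobj C. \<forall>x \<in> lobj C. \<forall>y \<in> lobj C. \<forall>z \<in> lobj C.
        (\<forall>b \<in> carrier (lhom C y z). \<forall>a \<in> carrier (lhom C x y). \<forall>m \<in> carrier (lval M w x).
          llact M w y z b (llact M w x y a m) = llact M w x z (lcomp C x y z b a) m) \<and>
        (\<forall>m \<in> carrier (lval M y z). \<forall>b \<in> carrier (lhom C x y). \<forall>a \<in> carrier (lhom C w x).
          lract M w x z (lract M x y z m b) a = lract M w y z m (lcomp C w x y b a)) \<and>
        (\<forall>b \<in> carrier (lhom C y z). \<forall>m \<in> carrier (lval M x y). \<forall>a \<in> carrier (lhom C w x).
          llact M w y z b (lract M w x y m a) = lract M w x z (llact M x y z b m) a)) \<and>
     (\<forall>x \<in> lobj C. \<forall>y \<in> lobj C. \<forall>m \<in> carrier (lval M x y).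
        llact M x y y (lid C y) m = m \<and> lract M x x y m (lid C x) = m)"

definition lin_bimod_hom ::
  "('k::field, 'o, 'a) lincat \<Rightarrow> ('k, 'o, 'v, 'a) linbimod \<Rightarrow> ('k, 'o, 'w, 'a) linbimod \<Rightarrow>
   ('o \<Rightarrow> 'o \<Rightarrow> 'v \<Rightarrow> 'w) \<Rightarrow> bool" where
  "lin_bimod_hom C M N \<theta> \<longleftrightarrow>
     (\<forall>x \<in> lobj C. \<forall>y \<in> lobj C. lin_map (lval M x y) (lval N x y) (\<theta> x y)) \<and>
     (\<forall>x \<in> lobj C. \<forall>y \<in> lobj C. \<forall>z \<in> lobj C.
        (\<forall>a \<in> carrier (lhom C y z). \<forall>m \<in> carrier (lval M x y).
          \<theta> x z (llact M x y z a m) = llact N x y z a (\<theta> x y m)) \<and>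
        (\<forall>m \<in> carrier (lval M y z). \<forall>a \<in> carrier (lhom C x y).
          \<theta> x z (lract M x y z m a) = lract N x y z (\<theta> y z m) a))"

definition long_exact_bimodules ::
  "('k::field, 'o, 'a) lincat \<Rightarrow> (int \<Rightarrow> ('k, 'o, 'u, 'a) linbimod) \<Rightarrow>
   (int \<Rightarrow> ('k, 'o, 'v, 'a) linbimod) \<Rightarrow> (int \<Rightarrow> ('k, 'o, 'w, 'a) linbimod) \<Rightarrow>
   (int \<Rightarrow> 'o \<Rightarrow> 'o \<Rightarrow> 'u \<Rightarrow> 'v) \<Rightarrow> (int \<Rightarrow> 'o \<Rightarrow> 'o \<Rightarrow> 'v \<Rightarrow> 'w) \<Rightarrow> (int \<Rightarrow> 'o \<Rightarrow> 'o \<Rightarrow> 'w \<Rightarrow> 'u) \<Rightarrow> bool" where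
  "long_exact_bimodules C U V W f g \<delta> \<longleftrightarrow>
     (\<forall>n. lin_bimodule C (U n) \<and> lin_bimodule C (V n) \<and> lin_bimodule C (W n) \<and>
          lin_bimod_hom C (U n) (V n) (f n) \<and> lin_bimod_hom C (V n) (W n) (g n) \<and>
          lin_bimod_hom C (W n) (U (n + 1)) (\<delta> n)) \<and>
     (\<forall>x \<in> lobj C. \<forall>y \<in> lobj C.
        long_exact (\<lambda>n. lval (U n) x y) (\<lambda>n. lval (V n) x y) (\<lambda>n. lval (W n) x y)
          (\<lambda>n. f n x y) (\<lambda>n. g n x y) (\<lambda>n. \<delta> n x y))"


section \<open>Dg-categories, dg-functors and dg-bimodules\<close>

text \<open>\<open>sg e v\<close> is $(-1)^e v$.\<close>

definition sg :: "int \<Rightarrow> 'm::ab_group_add \<Rightarrow> 'm" where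
  "sg e v = (if even e then v else - v)"

text \<open>The part of the data that dg-categories and dg-bimodules have in common: a complex for every
  pair of objects.\<close>

record ('k, 'o, 'm) dgdata =
  smul :: "'k \<Rightarrow> 'm \<Rightarrow> 'm"
  gr :: "'o \<Rightarrow> 'o \<Rightarrow> int \<Rightarrow> 'm set"
  dif :: "'o \<Rightarrow> 'o \<Rightarrow> int \<Rightarrow> 'm \<Rightarrow> 'm"

definition cx :: "('k, 'o, 'm, 'z) dgdata_scheme \<Rightarrow> 'o \<Rightarrow> 'o \<Rightarrow> ('k, 'm) cplx" where
  "cx X x y = \<lparr>csmul = smul X, cgr = gr X x y, cdif = dif X x y\<rparr>"

text \<open>In \<open>cmp A x y z j i g f\<close> the degrees are \<open>j = |g|\<close> and \<open>i = |f|\<close>; likewise for the actions on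
  a bimodule.\<close>

record ('k, 'o, 'm) dgcat = "('k, 'o, 'm) dgdata" +
  Ob :: "'o set"
  cmp :: "'o \<Rightarrow> 'o \<Rightarrow> 'o \<Rightarrow> int \<Rightarrow> int \<Rightarrow> 'm \<Rightarrow> 'm \<Rightarrow> 'm"
  idm :: "'o \<Rightarrow> 'm"

abbreviation grm :: "('k::field, 'o, 'm::ab_group_add, 'z) dgdata_scheme \<Rightarrow> 'o \<Rightarrow> 'o \<Rightarrow> int \<Rightarrow> ('k, 'm) module" where
  "grm X x y i \<equiv> component (cx X x y) i"

definition dg_category :: "('k::field, 'o, 'm::ab_group_add) dgcat \<Rightarrow> bool" where
  "dg_category A \<longleftrightarrow>
     (\<forall>x \<in> Ob A. \<forall>y \<in> Ob A. is_complex (cx A x y)) \<and>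
     (\<forall>x \<in> Ob A. \<forall>y \<in> Ob A. \<forall>z \<in> Ob A. \<forall>j i.
        bilin_map (grm A y z j) (grm A x y i) (grm A x z (j + i)) (cmp A x y z j i) \<and>
        (\<forall>g \<in> gr A y z j. \<forall>f \<in> gr A x y i.
          dif A x z (j + i) (cmp A x y z j i g f) =
            cmp A x y z (j + 1) i (dif A y z j g) f + sg j (cmp A x y z j (i + 1) g (dif A x y i f)))) \<and>
     (\<forall>w \<in> Ob A. \<forall>x \<in> Ob A. \<forall>y \<in> Ob A. \<forall>z \<in> Ob A. \<forall>l j i.
        \<forall>h \<in> gr A y z l. \<forall>g \<in> gr A x y j. \<forall>f \<in> gr A w x i.
          cmp A w y z l (j + i) h (cmp A w x y j i g f) =
          cmp A w x z (l + j) i (cmp A x y z l j h g) f) \<and>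
     (\<forall>x \<in> Ob A. idm A x \<in> gr A x x 0 \<and> dif A x x 0 (idm A x) = 0) \<and>
     (\<forall>x \<in> Ob A. \<forall>y \<in> Ob A. \<forall>i. \<forall>f \<in> gr A x y i.
        cmp A x y y 0 i (idm A y) f = f \<and> cmp A x x y i 0 f (idm A x) = f)"

record ('o, 'm, 'p, 'n) dgfun =
  fob :: "'o \<Rightarrow> 'p"
  fmor :: "'o \<Rightarrow> 'o \<Rightarrow> int \<Rightarrow> 'm \<Rightarrow> 'n"

definition dg_functor ::
  "('k::field, 'o, 'm::ab_group_add) dgcat \<Rightarrow> ('k, 'p, 'n::ab_group_add) dgcat \<Rightarrow> ('o, 'm, 'p, 'n) dgfun \<Rightarrow> bool" where
  "dg_functor A B F \<longleftrightarrow>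
     (\<forall>x \<in> Ob A. fob F x \<in> Ob B) \<and>
     (\<forall>x \<in> Ob A. \<forall>y \<in> Ob A. chain_map (cx A x y) (cx B (fob F x) (fob F y)) (fmor F x y)) \<and>
     (\<forall>x \<in> Ob A. \<forall>y \<in> Ob A. \<forall>z \<in> Ob A. \<forall>j i. \<forall>g \<in> gr A y z j. \<forall>f \<in> gr A x y i.
        fmor F x z (j + i) (cmp A x y z j i g f) =
        cmp B (fob F x) (fob F y) (fob F z) j i (fmor F y z j g) (fmor F x y i f)) \<and>
     (\<forall>x \<in> Ob A. fmor F x x 0 (idm A x) = idm B (fob F x))"

text \<open>The value of a bimodule \<open>M\<close> at \<open>(x, y)\<close> is contravariant in \<open>x\<close> (right action) and covariant
  in \<open>y\<close> (left action), as for the morphism complexes of the category itself.\<close>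

record ('k, 'o, 'm, 'a) dgbimod = "('k, 'o, 'm) dgdata" +
  lact :: "'o \<Rightarrow> 'o \<Rightarrow> 'o \<Rightarrow> int \<Rightarrow> int \<Rightarrow> 'a \<Rightarrow> 'm \<Rightarrow> 'm"
  ract :: "'o \<Rightarrow> 'o \<Rightarrow> 'o \<Rightarrow> int \<Rightarrow> int \<Rightarrow> 'm \<Rightarrow> 'a \<Rightarrow> 'm"

definition dg_bimodule ::
  "('k::field, 'o, 'a::ab_group_add) dgcat \<Rightarrow> ('k, 'o, 'm::ab_group_add, 'a) dgbimod \<Rightarrow> bool" where
  "dg_bimodule A M \<longleftrightarrow>
     (\<forall>x \<in> Ob A. \<forall>y \<in> Ob A. is_complex (cx M x y)) \<and>
     (\<forall>x \<in> Ob A. \<forall>y \<in> Ob A. \<forall>z \<in> Ob A. \<forall>j i.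
        bilin_map (grm A y z j) (grm M x y i) (grm M x z (j + i)) (lact M x y z j i) \<and>
        bilin_map (grm M y z j) (grm A x y i) (grm M x z (j + i)) (ract M x y z j i) \<and>
        (\<forall>a \<in> gr A y z j. \<forall>m \<in> gr M x y i.
          dif M x z (j + i) (lact M x y z j i a m) =
            lact M x y z (j + 1) i (dif A y z j a) m + sg j (lact M x y z j (i + 1) a (dif M x y i m))) \<and>
        (\<forall>m \<in> gr M y z j. \<forall>a \<in> gr A x y i.
          dif M x z (j + i) (ract M x y z j i m a) =
            ract M x y z (j + 1) i (dif M y z j m) a + sg j (ract M x y z j (i + 1) m (dif A x y i a)))) \<and>
     (\<forall>w \<in> Ob A. \<forall>x \<in> Ob A. \<forall>y \<in> Ob A. \<forall>z \<in> Ob A. \<forall>l j i.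
        (\<forall>b \<in> gr A y z l. \<forall>a \<in> gr A x y j. \<forall>m \<in> gr M w x i.
          lact M w y z l (j + i) b (lact M w x y j i a m) =
          lact M w x z (l + j) i (cmp A x y z l j b a) m) \<and>
        (\<forall>m \<in> gr M y z l. \<forall>b \<in> gr A x y j. \<forall>a \<in> gr A w x i.
          ract M w x z (l + j) i (ract M x y z l j m b) a =
          ract M w y z l (j + i) m (cmp A w x y j i b a)) \<and>
        (\<forall>b \<in> gr A y z l. \<forall>m \<in> gr M x y j. \<forall>a \<in> gr A w x i.
          lact M w y z l (j + i) b (ract M w x y j i m a) =
          ract M w x z (l + j) i (lact M x y z l j b m) a)) \<and>
     (\<forall>x \<in> Ob A. \<forall>y \<in> Ob A. \<forall>i. \<forall>m \<in> gr M x y i.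
        lact M x y y 0 i (idm A y) m = m \<and> ract M x x y i 0 m (idm A x) = m)"

definition dg_bimod_hom ::
  "('k::field, 'o, 'a::ab_group_add) dgcat \<Rightarrow> ('k, 'o, 'm::ab_group_add, 'a) dgbimod \<Rightarrow>
   ('k, 'o, 'n::ab_group_add, 'a) dgbimod \<Rightarrow> ('o \<Rightarrow> 'o \<Rightarrow> int \<Rightarrow> 'm \<Rightarrow> 'n) \<Rightarrow> bool" where
  "dg_bimod_hom A M N \<theta> \<longleftrightarrow>
     (\<forall>x \<in> Ob A. \<forall>y \<in> Ob A. chain_map (cx M x y) (cx N x y) (\<theta> x y)) \<and>
     (\<forall>x \<in> Ob A. \<forall>y \<in> Ob A. \<forall>z \<in> Ob A. \<forall>j i.
        (\<forall>a \<in> gr A y z j. \<forall>m \<in> gr M x y i.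
          \<theta> x z (j + i) (lact M x y z j i a m) = lact N x y z j i a (\<theta> x y i m)) \<and>
        (\<forall>m \<in> gr M y z j. \<forall>a \<in> gr A x y i.
          \<theta> x z (j + i) (ract M x y z j i m a) = ract N x y z j i (\<theta> y z j m) a))"

definition short_exact_bimodules ::
  "('k::field, 'o, 'a::ab_group_add) dgcat \<Rightarrow> ('k, 'o, 'm::ab_group_add, 'a) dgbimod \<Rightarrow>
   ('k, 'o, 'n::ab_group_add, 'a) dgbimod \<Rightarrow> ('k, 'o, 'p::ab_group_add, 'a) dgbimod \<Rightarrow>
   ('o \<Rightarrow> 'o \<Rightarrow> int \<Rightarrow> 'm \<Rightarrow> 'n) \<Rightarrow> ('o \<Rightarrow> 'o \<Rightarrow> int \<Rightarrow> 'n \<Rightarrow> 'p) \<Rightarrow> bool" where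
  "short_exact_bimodules A M N P f g \<longleftrightarrow>
     dg_bimodule A M \<and> dg_bimodule A N \<and> dg_bimodule A P \<and>
     dg_bimod_hom A M N f \<and> dg_bimod_hom A N P g \<and>
     (\<forall>x \<in> Ob A. \<forall>y \<in> Ob A. short_exact (cx M x y) (cx N x y) (cx P x y) (f x y) (g x y))"

definition diagonal :: "('k, 'o, 'm) dgcat \<Rightarrow> ('k, 'o, 'm, 'm) dgbimod" where
  "diagonal A = \<lparr>smul = smul A, gr = gr A, dif = dif A, lact = cmp A, ract = cmp A\<rparr>"


section \<open>The homotopy category and cohomology bimodules\<close>

definition H0 :: "('k::field, 'o, 'm::ab_group_add) dgcat \<Rightarrow> ('k, 'o, 'm set) lincat" where
  "H0 A = \<lparr>lobj = Ob A, lhom = (\<lambda>x y. cohomology (cx A x y) 0),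
     lcomp = (\<lambda>x y z S T. \<Union>g\<in>S. \<Union>f\<in>T. cls (cx A x z) 0 (cmp A x y z 0 0 g f)),
     lid = (\<lambda>x. cls (cx A x x) 0 (idm A x))\<rparr>"

definition Hbimod ::
  "('k::field, 'o, 'm::ab_group_add, 'a) dgbimod \<Rightarrow> int \<Rightarrow> ('k, 'o, 'm set, 'a set) linbimod" where
  "Hbimod M n = \<lparr>lval = (\<lambda>x y. cohomology (cx M x y) n),
     llact = (\<lambda>x y z S T. \<Union>a\<in>S. \<Union>m\<in>T. cls (cx M x z) n (lact M x y z 0 n a m)),
     lract = (\<lambda>x y z T S. \<Union>m\<in>T. \<Union>a\<in>S. cls (cx M x z) n (ract M x y z n 0 m a))\<rparr>"


section \<open>The homotopy fiber product and its bimodules\<close>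

fun fp_smul :: "('k \<Rightarrow> 'b \<Rightarrow> 'b) \<Rightarrow> ('k \<Rightarrow> 'c \<Rightarrow> 'c) \<Rightarrow> ('k \<Rightarrow> 'd \<Rightarrow> 'd) \<Rightarrow> 'k \<Rightarrow> 'b \<times> 'c \<times> 'd \<Rightarrow> 'b \<times> 'c \<times> 'd" where
  "fp_smul s t u c (\<mu>, \<nu>, \<gamma>) = (s c \<mu>, t c \<nu>, u c \<gamma>)"

definition fiber_product ::
  "('k::field, 'ob, 'b::ab_group_add) dgcat \<Rightarrow> ('k, 'oc, 'c::ab_group_add) dgcat \<Rightarrow>
   ('k, 'od, 'd::ab_group_add) dgcat \<Rightarrow> ('ob, 'b, 'od, 'd) dgfun \<Rightarrow> ('oc, 'c, 'od, 'd) dgfun \<Rightarrow>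
   ('k, 'ob \<times> 'oc \<times> 'd, 'b \<times> 'c \<times> 'd) dgcat" where
  "fiber_product B C D G L =
    \<lparr>smul = fp_smul (smul B) (smul C) (smul D),
     gr = (\<lambda>(M\<^sub>1, N\<^sub>1, \<phi>\<^sub>1) (M\<^sub>2, N\<^sub>2, \<phi>\<^sub>2) i.
       gr B M\<^sub>1 M\<^sub>2 i \<times> gr C N\<^sub>1 N\<^sub>2 i \<times> gr D (fob G M\<^sub>1) (fob L N\<^sub>2) (i - 1)),
     dif = (\<lambda>(M\<^sub>1, N\<^sub>1, \<phi>\<^sub>1) (M\<^sub>2, N\<^sub>2, \<phi>\<^sub>2) i (\<mu>, \<nu>, \<gamma>).
       (dif B M\<^sub>1 M\<^sub>2 i \<mu>,
        dif C N\<^sub>1 N\<^sub>2 i \<nu>,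
        dif D (fob G M\<^sub>1) (fob L N\<^sub>2) (i - 1) \<gamma> +
        sg i (cmp D (fob G M\<^sub>1) (fob G M\<^sub>2) (fob L N\<^sub>2) 0 i \<phi>\<^sub>2 (fmor G M\<^sub>1 M\<^sub>2 i \<mu>) -
              cmp D (fob G M\<^sub>1) (fob L N\<^sub>1) (fob L N\<^sub>2) i 0 (fmor L N\<^sub>1 N\<^sub>2 i \<nu>) \<phi>\<^sub>1))),
     Ob = {(M, N, \<phi>). M \<in> Ob B \<and> N \<in> Ob C \<and> \<phi> \<in> cocycles (cx D (fob G M) (fob L N)) 0 \<and>
       lin_iso (H0 D) (fob G M) (fob L N) (cls (cx D (fob G M) (fob L N)) 0 \<phi>)},
     cmp = (\<lambda>(M\<^sub>1, N\<^sub>1, \<phi>\<^sub>1) (M\<^sub>2, N\<^sub>2, \<phi>\<^sub>2) (M\<^sub>3, N\<^sub>3, \<phi>\<^sub>3) j i (\<mu>', \<nu>', \<gamma>') (\<mu>, \<nu>, \<gamma>).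
       (cmp B M\<^sub>1 M\<^sub>2 M\<^sub>3 j i \<mu>' \<mu>,
        cmp C N\<^sub>1 N\<^sub>2 N\<^sub>3 j i \<nu>' \<nu>,
        sg i (cmp D (fob G M\<^sub>1) (fob G M\<^sub>2) (fob L N\<^sub>3) (j - 1) i \<gamma>' (fmor G M\<^sub>1 M\<^sub>2 i \<mu>)) +
        cmp D (fob G M\<^sub>1) (fob L N\<^sub>2) (fob L N\<^sub>3) j (i - 1) (fmor L N\<^sub>2 N\<^sub>3 j \<nu>') \<gamma>)),
     idm = (\<lambda>(M, N, \<phi>). (idm B M, idm C N, 0))\<rparr>"

text \<open>The sub-bimodule of the elements \<open>(0, 0, \<gamma>)\<close>, with everything else inherited.\<close>

definition Dtilde ::
  "('k::field, 'ob, 'b::ab_group_add) dgcat \<Rightarrow> ('k, 'oc, 'c::ab_group_add) dgcat \<Rightarrow>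
   ('k, 'od, 'd::ab_group_add) dgcat \<Rightarrow> ('ob, 'b, 'od, 'd) dgfun \<Rightarrow> ('oc, 'c, 'od, 'd) dgfun \<Rightarrow>
   ('k, 'ob \<times> 'oc \<times> 'd, 'b \<times> 'c \<times> 'd, 'b \<times> 'c \<times> 'd) dgbimod" where
  "Dtilde B C D G L = (diagonal (fiber_product B C D G L))
    \<lparr>gr := (\<lambda>(M\<^sub>1, N\<^sub>1, \<phi>\<^sub>1) (M\<^sub>2, N\<^sub>2, \<phi>\<^sub>2) i.
      {(0, 0, \<gamma>) | \<gamma>. \<gamma> \<in> gr D (fob G M\<^sub>1) (fob L N\<^sub>2) (i - 1)})\<rparr>"

definition Qbimod ::
  "('k::field, 'ob, 'b::ab_group_add) dgcat \<Rightarrow> ('k, 'oc, 'c::ab_group_add) dgcat \<Rightarrow>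
   ('k, 'ob \<times> 'oc \<times> 'd, 'b \<times> 'c, 'b \<times> 'c \<times> 'd) dgbimod" where
  "Qbimod B C =
    \<lparr>smul = (\<lambda>c (\<mu>, \<nu>). (smul B c \<mu>, smul C c \<nu>)),
     gr = (\<lambda>(M\<^sub>1, N\<^sub>1, \<phi>\<^sub>1) (M\<^sub>2, N\<^sub>2, \<phi>\<^sub>2) i. gr B M\<^sub>1 M\<^sub>2 i \<times> gr C N\<^sub>1 N\<^sub>2 i),
     dif = (\<lambda>(M\<^sub>1, N\<^sub>1, \<phi>\<^sub>1) (M\<^sub>2, N\<^sub>2, \<phi>\<^sub>2) i (\<mu>, \<nu>). (dif B M\<^sub>1 M\<^sub>2 i \<mu>, dif C N\<^sub>1 N\<^sub>2 i \<nu>)),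
     lact = (\<lambda>(M\<^sub>1, N\<^sub>1, \<phi>\<^sub>1) (M\<^sub>2, N\<^sub>2, \<phi>\<^sub>2) (M\<^sub>3, N\<^sub>3, \<phi>\<^sub>3) j i (\<mu>', \<nu>', \<gamma>') (\<mu>, \<nu>).
       (cmp B M\<^sub>1 M\<^sub>2 M\<^sub>3 j i \<mu>' \<mu>, cmp C N\<^sub>1 N\<^sub>2 N\<^sub>3 j i \<nu>' \<nu>)),
     ract = (\<lambda>(M\<^sub>1, N\<^sub>1, \<phi>\<^sub>1) (M\<^sub>2, N\<^sub>2, \<phi>\<^sub>2) (M\<^sub>3, N\<^sub>3, \<phi>\<^sub>3) j i (\<mu>', \<nu>') (\<mu>, \<nu>, \<gamma>).
       (cmp B M\<^sub>1 M\<^sub>2 M\<^sub>3 j i \<mu>' \<mu>, cmp C N\<^sub>1 N\<^sub>2 N\<^sub>3 j i \<nu>' \<nu>))\<rparr>"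

definition incl :: "'o \<Rightarrow> 'o \<Rightarrow> int \<Rightarrow> 'b \<times> 'c \<times> 'd \<Rightarrow> 'b \<times> 'c \<times> 'd" where
  "incl x y i m = m"

definition proj :: "'o \<Rightarrow> 'o \<Rightarrow> int \<Rightarrow> 'b \<times> 'c \<times> 'd \<Rightarrow> 'b \<times> 'c" where
  "proj x y i = (\<lambda>(\<mu>, \<nu>, \<gamma>). (\<mu>, \<nu>))"


section \<open>The Hochschild complex\<close>

text \<open>
  A string of composable homogeneous morphisms
  $x_0 \leftarrow x_1 \leftarrow \dots \leftarrow x_p$ with $a_j : x_j \to x_{j-1}$ of degree $i_j$
  is encoded by \<open>x\<^sub>0\<close> and the list of the triples \<open>(x\<^sub>j, i\<^sub>j, a\<^sub>j)\<close>; so $a_1 \cdots a_p$ is a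
  morphism $x_p \to x_0$. The list may be empty.
\<close>

fun composable :: "('k, 'o, 'a) dgcat \<Rightarrow> 'o \<Rightarrow> ('o \<times> int \<times> 'a) list \<Rightarrow> bool" where
  "composable A x [] \<longleftrightarrow> x \<in> Ob A"
| "composable A x ((y, i, a) # w) \<longleftrightarrow> x \<in> Ob A \<and> a \<in> gr A y x i \<and> composable A y w"

definition src :: "'o \<Rightarrow> ('o \<times> int \<times> 'a) list \<Rightarrow> 'o" where
  "src x w = (if w = [] then x else fst (last w))"

text \<open>The degree $\sum_j (i_j - 1)$ of a string in the bar construction.\<close>

definition bdeg :: "('o \<times> int \<times> 'a) list \<Rightarrow> int" where
  "bdeg w = (\<Sum>(y, i, a) \<leftarrow> w. i - 1)"

text \<open>
  The cochains of total degree \<open>n\<close> are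
  $\prod_{p \ge 0} \prod_{x_0, \dots, x_p} \mathrm{Hom}_k^{n-p}
    (A(x_1, x_0) \otimes \dots \otimes A(x_p, x_{p-1}), M(x_p, x_0))$.
  A graded linear map is given by its restrictions to the homogeneous components, that is, by
  multilinear maps for each tuple of degrees. Cochains vanish outside of composable strings,
  so that equality of cochains is equality of functions.
\<close>

definition hoch_cochains ::
  "('k::field, 'o, 'a::ab_group_add) dgcat \<Rightarrow> ('k, 'o, 'm::ab_group_add, 'a) dgbimod \<Rightarrow> int \<Rightarrow>
   ('o \<Rightarrow> ('o \<times> int \<times> 'a) list \<Rightarrow> 'm) set" where
  "hoch_cochains A M n = {f.
     (\<forall>x w. \<not> composable A x w \<longrightarrow> f x w = 0) \<and>
     (\<forall>x w. composable A x w \<longrightarrow> f x w \<in> gr M (src x w) x (n + bdeg w)) \<and>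
     (\<forall>x u y i a b v. composable A x (u @ (y, i, a) # v) \<and> composable A x (u @ (y, i, b) # v) \<longrightarrow>
        f x (u @ (y, i, a + b) # v) = f x (u @ (y, i, a) # v) + f x (u @ (y, i, b) # v)) \<and>
     (\<forall>x u y i a v c. composable A x (u @ (y, i, a) # v) \<longrightarrow>
        f x (u @ (y, i, smul A c a) # v) = smul M c (f x (u @ (y, i, a) # v)))}"

text \<open>
  The differential of the convolution complex of maps from the bar construction of \<open>A\<close> to \<open>M\<close>,
  twisted by the canonical twisting cochain. With $\epsilon_j = \sum_{l \le j} (i_l - 1)$,
  $(\delta f)(a_1, \dots, a_p)$ is
  $$d f(a_1, \dots, a_p)
    + (-1)^n \sum_{j=1}^{p} (-1)^{\epsilon_{j-1}} f(\dots, d a_j, \dots)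
    + (-1)^n \sum_{j=1}^{p-1} (-1)^{\epsilon_j} f(\dots, a_j a_{j+1}, \dots)
    + (-1)^{n (i_1 - 1)} a_1 f(a_2, \dots, a_p)
    - (-1)^{n + \epsilon_{p-1}} f(a_1, \dots, a_{p-1}) a_p,$$
  the last two terms only for $p \ge 1$. For an ordinary algebra this is $(-1)^n$ times the
  classical differential. The indices below start from \<open>0\<close>, so \<open>a j\<close> is $a_{j+1}$.
\<close>

definition hoch_diff ::
  "('k::field, 'o, 'a::ab_group_add) dgcat \<Rightarrow> ('k, 'o, 'm::ab_group_add, 'a) dgbimod \<Rightarrow> int \<Rightarrow>
   ('o \<Rightarrow> ('o \<times> int \<times> 'a) list \<Rightarrow> 'm) \<Rightarrow> 'o \<Rightarrow> ('o \<times> int \<times> 'a) list \<Rightarrow> 'm" where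
  "hoch_diff A M n f x w =
    (if \<not> composable A x w then 0 else
      let p = length w;
          X = (\<lambda>j. (x # map fst w) ! j);
          deg = (\<lambda>j. fst (snd (w ! j)));
          a = (\<lambda>j. snd (snd (w ! j)))
      in
        dif M (src x w) x (n + bdeg w) (f x w)
        + (\<Sum>j<p. sg (n + bdeg (take j w))
             (f x (take j w @ (X (j + 1), deg j + 1, dif A (X (j + 1)) (X j) (deg j) (a j))
                     # drop (j + 1) w)))
        + (\<Sum>j<p - 1. sg (n + bdeg (take (j + 1) w))
             (f x (take j w @ (X (j + 2), deg j + deg (j + 1),
                      cmp A (X (j + 2)) (X (j + 1)) (X j) (deg j) (deg (j + 1)) (a j) (a (j + 1)))
                     # drop (j + 2) w)))
        + (if p = 0 then 0 else
             sg (n * (deg 0 - 1))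
               (lact M (X p) (X 1) x (deg 0) (n + bdeg (tl w)) (a 0) (f (X 1) (tl w)))
             - sg (n + bdeg (butlast w))
               (ract M (X p) (X (p - 1)) x (n + bdeg (butlast w)) (deg (p - 1))
                 (f x (butlast w)) (a (p - 1)))))"

definition hoch ::
  "('k::field, 'o, 'a::ab_group_add) dgcat \<Rightarrow> ('k, 'o, 'm::ab_group_add, 'a) dgbimod \<Rightarrow>
   ('k, 'o \<Rightarrow> ('o \<times> int \<times> 'a) list \<Rightarrow> 'm) cplx" where
  "hoch A M = \<lparr>csmul = (\<lambda>c f x w. if composable A x w then smul M c (f x w) else 0),
     cgr = hoch_cochains A M, cdif = hoch_diff A M\<rparr>"

abbreviation HH ::
  "('k::field, 'o, 'a::ab_group_add) dgcat \<Rightarrow> ('k, 'o, 'm::ab_group_add, 'a) dgbimod \<Rightarrow> int \<Rightarrow>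
   ('k, ('o \<Rightarrow> ('o \<times> int \<times> 'a) list \<Rightarrow> 'm) set) module" where
  "HH A M n \<equiv> cohomology (hoch A M) n"

text \<open>Postcomposition of cochains with a morphism of bimodules.\<close>

definition hoch_map ::
  "('k, 'o, 'a) dgcat \<Rightarrow> ('o \<Rightarrow> 'o \<Rightarrow> int \<Rightarrow> 'm \<Rightarrow> 'n::ab_group_add) \<Rightarrow> int \<Rightarrow>
   ('o \<Rightarrow> ('o \<times> int \<times> 'a) list \<Rightarrow> 'm) \<Rightarrow> 'o \<Rightarrow> ('o \<times> int \<times> 'a) list \<Rightarrow> 'n" where
  "hoch_map A \<theta> n f x w = (if composable A x w then \<theta> (src x w) x (n + bdeg w) (f x w) else 0)"

end

theory Submission
  imports Defs
begin

text \<open>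
  Both long exact sequences come from the snake lemma. For the bimodules, connecting maps are
  linear over $H^0(A)$ because the action of a cocycle of degree \<open>0\<close> commutes with the differential.
  For the Hochschild complexes, exactness survives passing to cochains because
  $(\mu, \nu) \mapsto (\mu, \nu, 0)$ is a $k$-linear section of $A \to Q$ in each degree.

  That the Hochschild differential squares to zero is seen by writing it as
  $d f + (-1)^n f b + \lambda f - \rho f$, where $b$ is the differential of the bar construction and
  $\lambda$, $\rho$ are the terms with the left and the right action: besides $b^2 = 0$, the terms
  with one or two $\lambda$ and no $\rho$ cancel, as do those with one or two $\rho$ and no $\lambda$,
  and the two mixed ones.
\<close>

section \<open>Cohomology of complexes\<close>

text \<open>No tensor product is formed: \<open>bar A F x w\<close> is the value of \<open>F\<close>
  on the formal sum of strings b(w), so b acts through its transpose. Additivity of \<open>F\<close>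
  in a slot enters where relations between tensors do: in b^2 = 0, where the Leibniz rule and d^2 =
  0 are applied inside a slot, and in the multilinearity of the resulting cochains.

  Homogeneous components are subsets of one group and may overlap; maps are additive on a fixed
  component, and their values depend on the degree passed to them. Hence the degrees of the strings
  produced by b are tracked: on these strings the differential, or the action of a fixed element, is
  a single additive map and can be pulled through b.

  The zero on the left is not part of the snake lemma. Morphisms may have any degree, so there are
  Hochschild cochains of negative total degree, and $HH^{-1}(A, Q)$ need not vanish. Injectivity on
  $HH^0$ is derived from the vanishing of $HH^{-1}(A, Q)$, and unconditionally for the complexes cut
  off below degree 0.\<close>

definition vspace_on :: "('k::field \<Rightarrow> 'm::ab_group_add \<Rightarrow> 'm) \<Rightarrow> 'm set \<Rightarrow> bool" where
  "vspace_on s S \<longleftrightarrow> 0 \<in> S \<and> (\<forall>x\<in>S. \<forall>y\<in>S. x + y \<in> S) \<and> (\<forall>c. \<forall>x\<in>S. s c x \<in> S) \<and>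
     (\<forall>c d. \<forall>x\<in>S. s (c + d) x = s c x + s d x) \<and>
     (\<forall>c. \<forall>x\<in>S. \<forall>y\<in>S. s c (x + y) = s c x + s c y) \<and>
     (\<forall>c d. \<forall>x\<in>S. s (c * d) x = s c (s d x)) \<and> (\<forall>x\<in>S. s 1 x = x)"

text \<open>Closure under negation is not demanded in \<open>vspace_on\<close>: negation is
  multiplication by -1.\<close>

lemma vspace_on_uminus:
  assumes "vspace_on s S" "x \<in> S"
  shows "- x \<in> S" "s (- 1) x = - x" "s 0 x = 0"
proof -
  have "s (0 + 0) x = s 0 x + s 0 x"
    using assms unfolding vspace_on_def by blast
  then show 0: "s 0 x = 0" by simp
  have "s (- 1 + 1) x = s (- 1) x + s 1 x"
    using assms unfolding vspace_on_def by blast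
  with 0 assms have "s (- 1) x + x = 0"
    unfolding vspace_on_def by simp
  then show "s (- 1) x = - x" by (simp add: eq_neg_iff_add_eq_0)
  then show "- x \<in> S" using assms unfolding vspace_on_def by metis
qed

lemma cring_scalars: "cring (scalars :: 'k::field ring)"
proof (rule cringI)
  show "abelian_group (scalars :: 'k ring)"
  proof (rule abelian_groupI)
    fix x :: 'k
    show "\<exists>y\<in>carrier scalars. y \<oplus>\<^bsub>scalars\<^esub> x = \<zero>\<^bsub>scalars\<^esub>"
      by (rule bexI[of _ "- x"]) (auto simp: scalars_def)
  qed (auto simp: scalars_def)
  show "comm_monoid (scalars :: 'k ring)"
    by (rule comm_monoidI) (auto simp: scalars_def)
qed (auto simp: scalars_def algebra_simps)

lemma module_scalarsI:
  fixes V :: "('k::field, 'v) module"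
  assumes "abelian_group V"
    and "\<And>c x. x \<in> carrier V \<Longrightarrow> c \<odot>\<^bsub>V\<^esub> x \<in> carrier V"
    and "\<And>c d x. x \<in> carrier V \<Longrightarrow> (c + d) \<odot>\<^bsub>V\<^esub> x = c \<odot>\<^bsub>V\<^esub> x \<oplus>\<^bsub>V\<^esub> d \<odot>\<^bsub>V\<^esub> x"
    and "\<And>c x y. x \<in> carrier V \<Longrightarrow> y \<in> carrier V \<Longrightarrow>
           c \<odot>\<^bsub>V\<^esub> (x \<oplus>\<^bsub>V\<^esub> y) = c \<odot>\<^bsub>V\<^esub> x \<oplus>\<^bsub>V\<^esub> c \<odot>\<^bsub>V\<^esub> y"
    and "\<And>c d x. x \<in> carrier V \<Longrightarrow> (c * d) \<odot>\<^bsub>V\<^esub> x = c \<odot>\<^bsub>V\<^esub> (d \<odot>\<^bsub>V\<^esub> x)"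
    and "\<And>x. x \<in> carrier V \<Longrightarrow> 1 \<odot>\<^bsub>V\<^esub> x = x"
  shows "module scalars V"
  by (rule moduleI[OF cring_scalars assms(1)]) (auto simp: scalars_def assms)

lemma component_simps [simp]:
  "carrier (component K n) = cgr K n" "zero (component K n) = 0"
  "add (component K n) = (+)" "smult (component K n) = csmul K"
  by (auto simp: component_def)

text \<open>The carriers lie in an abelian group given by the type, so the group laws are inherited,
  and a vector space amounts to closure together with the scalar laws.\<close>

lemma module_component_iff:
  "module scalars (component K n) \<longleftrightarrow> vspace_on (csmul K) (cgr K n)" (is "?M \<longleftrightarrow> ?V")
proof
  assume ?M
  then interpret module scalars "component K n" .
  show ?V
    unfolding vspace_on_def
    using M.zero_closed M.add.m_closed smult_closed smult_l_distr smult_r_distr smult_assoc1 smult_one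
    by (auto simp: scalars_def)
next
  assume V: ?V
  show ?M
  proof (rule module_scalarsI)
    show "abelian_group (component K n)"
    proof (rule abelian_groupI)
      fix x assume "x \<in> carrier (component K n)"
      then show "\<exists>y\<in>carrier (component K n). y \<oplus>\<^bsub>component K n\<^esub> x = \<zero>\<^bsub>component K n\<^esub>"
        using V by (intro bexI[of _ "- x"]) (auto intro: vspace_on_uminus)
    qed (use V in \<open>auto simp: vspace_on_def algebra_simps\<close>)
  qed (use V in \<open>auto simp: vspace_on_def\<close>)
qed

lemma lin_map_0:
  assumes "module scalars V" "module scalars W" "lin_map V W f"
  shows "f \<zero>\<^bsub>V\<^esub> = \<zero>\<^bsub>W\<^esub>"
proof -
  interpret V: module scalars V by fact
  interpret W: module scalars W by fact
  have "f (\<zero>\<^bsub>V\<^esub> \<oplus>\<^bsub>V\<^esub> \<zero>\<^bsub>V\<^esub>) = f \<zero>\<^bsub>V\<^esub> \<oplus>\<^bsub>W\<^esub> f \<zero>\<^bsub>V\<^esub>" "f \<zero>\<^bsub>V\<^esub> \<in> carrier W"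
    using assms(3) V.M.zero_closed unfolding lin_map_def by blast+
  then show ?thesis
    by (metis V.M.l_zero V.M.zero_closed W.M.add.r_cancel_one' )
qed

text \<open>Differentials, actions and functors are total functions that are constrained on a
  homogeneous component \<open>S\<close> only. Closure of \<open>S\<close> under negation makes
  \<open>f\<close> respect differences and the signs \<open>sg e\<close>.\<close>

locale additive_on =
  fixes S :: "'a::ab_group_add set" and f :: "'a \<Rightarrow> 'b::ab_group_add"
  assumes zero_mem: "0 \<in> S" and uminus_mem: "x \<in> S \<Longrightarrow> - x \<in> S"
    and add_mem: "x \<in> S \<Longrightarrow> y \<in> S \<Longrightarrow> x + y \<in> S"
    and add: "x \<in> S \<Longrightarrow> y \<in> S \<Longrightarrow> f (x + y) = f x + f y"
begin

lemma zero: "f 0 = 0"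
  using add[OF zero_mem zero_mem] by simp

lemma uminus: "x \<in> S \<Longrightarrow> f (- x) = - f x"
  using add[of x "- x"] uminus_mem zero by (simp add: eq_neg_iff_add_eq_0 add.commute)

lemma diff: "x \<in> S \<Longrightarrow> y \<in> S \<Longrightarrow> f (x - y) = f x - f y"
  using add[of x "- y"] uminus_mem uminus by simp

lemma sg: "x \<in> S \<Longrightarrow> f (sg e x) = sg e (f x)"
  by (simp add: sg_def uminus)

lemma sg_mem: "x \<in> S \<Longrightarrow> sg e x \<in> S"
  by (simp add: sg_def uminus_mem)

end

lemma lin_map_additive_on:
  assumes "module scalars (component K n)" "lin_map (component K n) (component L m) f"
  shows "additive_on (cgr K n) f"
  using assms unfolding module_component_iff
  by unfold_locales (auto simp: vspace_on_def lin_map_def intro: vspace_on_uminus)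

lemma cohomology_carrierE:
  assumes "S \<in> carrier (cohomology K n)"
  obtains x where "x \<in> cocycles K n" "S = cls K n x"
  using assms by (auto simp: cohomology_def)

locale cochain_complex =
  fixes K :: "('k::field, 'm::ab_group_add) cplx"
  assumes is_complex: "is_complex K"
begin

lemma module_component: "module scalars (component K n)"
  using is_complex by (simp add: is_complex_def)

lemma vsp: "vspace_on (csmul K) (cgr K n)"
  using module_component module_component_iff by blast

lemma zero_in [simp]: "0 \<in> cgr K n"
  and add_in: "x \<in> cgr K n \<Longrightarrow> y \<in> cgr K n \<Longrightarrow> x + y \<in> cgr K n"
  and smul_in: "x \<in> cgr K n \<Longrightarrow> csmul K c x \<in> cgr K n"
  and smul_add_left: "x \<in> cgr K n \<Longrightarrow> csmul K (c + d) x = csmul K c x + csmul K d x"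
  and smul_add: "x \<in> cgr K n \<Longrightarrow> y \<in> cgr K n \<Longrightarrow> csmul K c (x + y) = csmul K c x + csmul K c y"
  and smul_mult: "x \<in> cgr K n \<Longrightarrow> csmul K (c * d) x = csmul K c (csmul K d x)"
  and smul_one: "x \<in> cgr K n \<Longrightarrow> csmul K 1 x = x"
  using vsp[of n] unfolding vspace_on_def by blast+

lemma uminus_in: "x \<in> cgr K n \<Longrightarrow> - x \<in> cgr K n"
  using vsp[of n] by (auto intro: vspace_on_uminus)

lemma diff_in: "x \<in> cgr K n \<Longrightarrow> y \<in> cgr K n \<Longrightarrow> x - y \<in> cgr K n"
  using add_in[of x n "- y"] uminus_in by simp

lemma lin_dif: "lin_map (component K n) (component K (n + 1)) (cdif K n)"
  using is_complex by (simp add: is_complex_def)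

lemma additive_on_dif: "additive_on (cgr K n) (cdif K n)"
  using lin_map_additive_on[OF module_component lin_dif] .

sublocale dif: additive_on "cgr K n" "cdif K n" for n
  by (rule additive_on_dif)

lemma dif_in: "x \<in> cgr K n \<Longrightarrow> m = n + 1 \<Longrightarrow> cdif K n x \<in> cgr K m"
  and dif_smul: "x \<in> cgr K n \<Longrightarrow> cdif K n (csmul K c x) = csmul K c (cdif K n x)"
  using lin_dif[of n] unfolding lin_map_def by auto

lemma dif_dif: "x \<in> cgr K n \<Longrightarrow> m = n + 1 \<Longrightarrow> cdif K m (cdif K n x) = 0"
  using is_complex by (auto simp: is_complex_def)

lemma cocycles_subset: "x \<in> cocycles K n \<Longrightarrow> x \<in> cgr K n"
  by (simp add: cocycles_def)

lemma coboundariesI: "y \<in> cgr K m \<Longrightarrow> m + 1 = n \<Longrightarrow> cdif K m y \<in> coboundaries K n"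
  by (force simp: coboundaries_def)

lemma coboundariesE:
  assumes "b \<in> coboundaries K n"
  obtains y where "y \<in> cgr K (n - 1)" "b = cdif K (n - 1) y"
  using assms by (auto simp: coboundaries_def)

lemma coboundaries_cocycles: "b \<in> coboundaries K n \<Longrightarrow> b \<in> cocycles K n"
  by (auto simp: coboundaries_def cocycles_def dif_in dif_dif)

lemma coboundaries_subset: "b \<in> coboundaries K n \<Longrightarrow> b \<in> cgr K n"
  by (rule cocycles_subset[OF coboundaries_cocycles])

lemma vspace_coboundaries: "vspace_on (csmul K) (coboundaries K n)"
proof -
  have zero: "0 \<in> coboundaries K n"
    using coboundariesI[of 0 "n - 1" n] by (simp add: dif.zero)
  have add: "x + y \<in> coboundaries K n" if xy: "x \<in> coboundaries K n" "y \<in> coboundaries K n" for x y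
  proof -
    obtain u v where "u \<in> cgr K (n - 1)" "v \<in> cgr K (n - 1)" "x = cdif K (n - 1) u" "y = cdif K (n - 1) v"
      using xy by (auto elim!: coboundariesE)
    then show ?thesis
      using coboundariesI[of "u + v" "n - 1" n] by (simp add: dif.add add_in)
  qed
  have smul: "csmul K c x \<in> coboundaries K n" if x: "x \<in> coboundaries K n" for x c
  proof -
    obtain u where "u \<in> cgr K (n - 1)" "x = cdif K (n - 1) u"
      using x by (auto elim!: coboundariesE)
    then show ?thesis
      using coboundariesI[of "csmul K c u" "n - 1" n] by (simp add: dif_smul smul_in)
  qed
  note sub = coboundaries_subset
  show ?thesis
    unfolding vspace_on_def
    by (intro conjI ballI allI zero add smul smul_add_left[OF sub] smul_add[OF sub sub]
        smul_mult[OF sub] smul_one[OF sub])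
qed

lemma zero_coboundary [simp]: "0 \<in> coboundaries K n"
  and add_coboundary: "x \<in> coboundaries K n \<Longrightarrow> y \<in> coboundaries K n \<Longrightarrow> x + y \<in> coboundaries K n"
  and smul_coboundary: "x \<in> coboundaries K n \<Longrightarrow> csmul K c x \<in> coboundaries K n"
  using vspace_coboundaries[of n] unfolding vspace_on_def by blast+

lemma uminus_coboundary: "x \<in> coboundaries K n \<Longrightarrow> - x \<in> coboundaries K n"
  using vspace_coboundaries[of n] by (auto intro: vspace_on_uminus)

lemma zero_cocycle [simp]: "0 \<in> cocycles K n"
  by (simp add: cocycles_def dif.zero)

lemma add_cocycle: "x \<in> cocycles K n \<Longrightarrow> y \<in> cocycles K n \<Longrightarrow> x + y \<in> cocycles K n"
  by (simp add: cocycles_def add_in dif.add)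

lemma uminus_cocycle: "x \<in> cocycles K n \<Longrightarrow> - x \<in> cocycles K n"
  by (simp add: cocycles_def uminus_in dif.uminus)

lemma smul_zero [simp]: "csmul K c 0 = 0"
  using smul_add[OF zero_in[of 0] zero_in[of 0], of c] by simp

lemma smul_cocycle: "x \<in> cocycles K n \<Longrightarrow> csmul K c x \<in> cocycles K n"
  by (auto simp: cocycles_def smul_in dif_smul)

lemma cls_memI: "b \<in> coboundaries K n \<Longrightarrow> x + b \<in> cls K n x"
  by (auto simp: cls_def)

lemma cls_self [simp]: "x \<in> cls K n x"
  using cls_memI[OF zero_coboundary] by simp

lemma cls_mem_iff: "y \<in> cls K n x \<longleftrightarrow> y - x \<in> coboundaries K n"
  by (auto simp: cls_def intro: exI[of _ "y - x"])

lemma cls_eq_iff: "cls K n x = cls K n y \<longleftrightarrow> x - y \<in> coboundaries K n"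
proof
  show "x - y \<in> coboundaries K n" if "cls K n x = cls K n y"
    using cls_self[of x n] that unfolding cls_mem_iff[symmetric] by simp
  have *: "cls K n x \<subseteq> cls K n y" if "x - y \<in> coboundaries K n" for x y
  proof
    fix z assume "z \<in> cls K n x"
    then show "z \<in> cls K n y"
      using add_coboundary[OF _ that, of "z - x"] by (simp add: cls_mem_iff)
  qed
  show "cls K n x = cls K n y" if "x - y \<in> coboundaries K n"
    using *[OF that] *[of y x] uminus_coboundary[OF that] by auto
qed

lemma cls_add_coboundary: "b \<in> coboundaries K n \<Longrightarrow> cls K n (x + b) = cls K n x"
  by (simp add: cls_eq_iff)

text \<open>Operations on cosets are defined as unions over all representatives. When
  \<open>F\<close> is constant on the coset, the union of these equal sets is their common value;
  well-definedness of an operation is proved in this form.\<close>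

lemma UN_cls:
  assumes "\<And>b. b \<in> coboundaries K n \<Longrightarrow> F (x + b) = F x"
  shows "(\<Union>s \<in> cls K n x. F s) = F x"
proof -
  have "F s = F x" if "s \<in> cls K n x" for s
    using that assms[of "s - x"] by (simp add: cls_mem_iff)
  then show ?thesis using cls_self[of x n] by blast
qed

lemma coh_add: "add (cohomology K n) (cls K n x) (cls K n y) = cls K n (x + y)"
proof -
  have "(\<Union>t\<in>cls K n y. cls K n (s + t)) = cls K n (s + y)" for s
    by (rule UN_cls) (simp add: cls_eq_iff)
  moreover have "(\<Union>s\<in>cls K n x. cls K n (s + y)) = cls K n (x + y)"
    by (rule UN_cls) (simp add: cls_eq_iff)
  ultimately show ?thesis by (simp add: cohomology_def)
qed

lemma coh_smult:
  assumes "x \<in> cgr K n"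
  shows "smult (cohomology K n) c (cls K n x) = cls K n (csmul K c x)"
proof -
  have "(\<Union>s\<in>cls K n x. cls K n (csmul K c s)) = cls K n (csmul K c x)"
  proof (rule UN_cls)
    fix b assume b: "b \<in> coboundaries K n"
    have "csmul K c (x + b) = csmul K c x + csmul K c b"
      by (rule smul_add[OF assms coboundaries_subset[OF b]])
    then show "cls K n (csmul K c (x + b)) = cls K n (csmul K c x)"
      using b by (simp add: cls_eq_iff smul_coboundary)
  qed
  then show ?thesis by (simp add: cohomology_def)
qed

lemma coh_zero: "zero (cohomology K n) = cls K n 0"
  by (simp add: cohomology_def)

lemma coh_carrierI: "x \<in> cocycles K n \<Longrightarrow> cls K n x \<in> carrier (cohomology K n)"
  by (auto simp: cohomology_def)

lemma coh_zero_iff: "cls K n x = zero (cohomology K n) \<longleftrightarrow> x \<in> coboundaries K n"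
  by (simp add: coh_zero cls_eq_iff)

lemma coh_carrierE':
  assumes "S \<in> carrier (cohomology K n)"
  obtains x where "x \<in> cgr K n" "x \<in> cocycles K n" "S = cls K n x"
  using assms cocycles_subset by (auto simp: cohomology_def)

lemma module_cohomology: "module scalars (cohomology K n)"
proof (rule module_scalarsI)
  show "abelian_group (cohomology K n)"
  proof (rule abelian_groupI)
    fix S assume "S \<in> carrier (cohomology K n)"
    then obtain x where x: "x \<in> cocycles K n" "S = cls K n x"
      by (rule cohomology_carrierE)
    then show "\<exists>T\<in>carrier (cohomology K n). T \<oplus>\<^bsub>cohomology K n\<^esub> S = \<zero>\<^bsub>cohomology K n\<^esub>"
      by (intro bexI[of _ "cls K n (- x)"]) (auto simp: coh_add coh_zero intro: coh_carrierI uminus_cocycle)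
  qed (auto elim!: cohomology_carrierE simp: coh_add coh_zero add_ac intro!: coh_carrierI add_cocycle)
next
  fix c d S assume "S \<in> carrier (cohomology K n)"
  then obtain x where x: "x \<in> cgr K n" "x \<in> cocycles K n" "S = cls K n x"
    by (rule coh_carrierE')
  show "c \<odot>\<^bsub>cohomology K n\<^esub> S \<in> carrier (cohomology K n)"
    unfolding x coh_smult[OF x(1)] by (rule coh_carrierI[OF smul_cocycle[OF x(2)]])
  show "(c + d) \<odot>\<^bsub>cohomology K n\<^esub> S = c \<odot>\<^bsub>cohomology K n\<^esub> S \<oplus>\<^bsub>cohomology K n\<^esub> d \<odot>\<^bsub>cohomology K n\<^esub> S"
    unfolding x coh_smult[OF x(1)] coh_add smul_add_left[OF x(1)] ..
  show "(c * d) \<odot>\<^bsub>cohomology K n\<^esub> S = c \<odot>\<^bsub>cohomology K n\<^esub> (d \<odot>\<^bsub>cohomology K n\<^esub> S)"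
    unfolding x coh_smult[OF x(1)] coh_smult[OF smul_in[OF x(1)]] smul_mult[OF x(1)] ..
  show "1 \<odot>\<^bsub>cohomology K n\<^esub> S = S"
    unfolding x coh_smult[OF x(1)] smul_one[OF x(1)] ..
next
  fix c S T assume "S \<in> carrier (cohomology K n)" "T \<in> carrier (cohomology K n)"
  then obtain x y where x: "x \<in> cgr K n" "S = cls K n x" and y: "y \<in> cgr K n" "T = cls K n y"
    by (metis coh_carrierE')
  show "c \<odot>\<^bsub>cohomology K n\<^esub> (S \<oplus>\<^bsub>cohomology K n\<^esub> T) =
      c \<odot>\<^bsub>cohomology K n\<^esub> S \<oplus>\<^bsub>cohomology K n\<^esub> c \<odot>\<^bsub>cohomology K n\<^esub> T"
    unfolding x y coh_add coh_smult[OF x(1)] coh_smult[OF y(1)] coh_smult[OF add_in[OF x(1) y(1)]]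
      smul_add[OF x(1) y(1)] ..
qed

end

lemma cochain_complexI: "is_complex K \<Longrightarrow> cochain_complex K"
  by (simp add: cochain_complex_def)

lemma lin_map_cohomologyI:
  assumes "cochain_complex K" "cochain_complex L"
    and "\<And>x. x \<in> cocycles K n \<Longrightarrow> \<exists>y \<in> cocycles L m. F (cls K n x) = cls L m y"
    and "\<And>x y. x \<in> cocycles K n \<Longrightarrow> y \<in> cocycles K n \<Longrightarrow>
      F (cls K n (x + y)) = add (cohomology L m) (F (cls K n x)) (F (cls K n y))"
    and "\<And>c x. x \<in> cocycles K n \<Longrightarrow>
      F (cls K n (csmul K c x)) = smult (cohomology L m) c (F (cls K n x))"
  shows "lin_map (cohomology K n) (cohomology L m) F"
proof -
  interpret K: cochain_complex K by fact
  interpret L: cochain_complex L by fact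
  show ?thesis
    unfolding lin_map_def
  proof (intro conjI ballI allI)
    fix S assume "S \<in> carrier (cohomology K n)"
    then obtain x where x: "x \<in> cocycles K n" "S = cls K n x" by (rule cohomology_carrierE)
    then show "F S \<in> carrier (cohomology L m)"
      using assms(3) L.coh_carrierI by metis
    show "F (smult (cohomology K n) c S) = smult (cohomology L m) c (F S)" for c
      using x assms(5) by (simp add: K.coh_smult K.cocycles_subset)
    fix T assume "T \<in> carrier (cohomology K n)"
    then obtain y where "y \<in> cocycles K n" "T = cls K n y" by (rule cohomology_carrierE)
    then show "F (add (cohomology K n) S T) = add (cohomology L m) (F S) (F T)"
      using x assms(4) by (simp add: K.coh_add)
  qed
qed

section \<open>Maps induced on cohomology\<close>

locale cochain_map = K: cochain_complex K + L: cochain_complex L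
  for K :: "('k::field, 'm::ab_group_add) cplx" and L :: "('k, 'n::ab_group_add) cplx" +
  fixes f :: "int \<Rightarrow> 'm \<Rightarrow> 'n"
  assumes chain_map: "chain_map K L f"
begin

lemma lin: "lin_map (component K n) (component L n) (f n)"
  using chain_map by (simp add: chain_map_def)

sublocale map: additive_on "cgr K n" "f n" for n
  using lin_map_additive_on[OF K.module_component lin] .

lemma map_in: "x \<in> cgr K n \<Longrightarrow> f n x \<in> cgr L n"
  and map_smul: "x \<in> cgr K n \<Longrightarrow> f n (csmul K c x) = csmul L c (f n x)"
  using lin[of n] unfolding lin_map_def by auto

lemma map_dif: "x \<in> cgr K n \<Longrightarrow> m = n + 1 \<Longrightarrow> f m (cdif K n x) = cdif L n (f n x)"
  using chain_map by (simp add: chain_map_def)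

lemma map_cocycle: "x \<in> cocycles K n \<Longrightarrow> f n x \<in> cocycles L n"
  using map_dif[of x n "n + 1"] by (auto simp: cocycles_def map_in map.zero)

lemma map_coboundary: "x \<in> coboundaries K n \<Longrightarrow> f n x \<in> coboundaries L n"
  by (auto elim!: K.coboundariesE simp: map_dif intro!: L.coboundariesI map_in)

lemma coh_map_cls:
  assumes "x \<in> cgr K n"
  shows "coh_map L f n (cls K n x) = cls L n (f n x)"
  unfolding coh_map_def
proof (rule K.UN_cls)
  fix b assume b: "b \<in> coboundaries K n"
  then have "b \<in> cgr K n" by (blast dest: K.coboundaries_cocycles K.cocycles_subset)
  then show "cls L n (f n (x + b)) = cls L n (f n x)"
    using b assms by (simp add: map.add L.cls_add_coboundary map_coboundary)
qed

lemma lin_coh_map: "lin_map (cohomology K n) (cohomology L n) (coh_map L f n)"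
  by (rule lin_map_cohomologyI)
    (auto simp: K.cochain_complex_axioms L.cochain_complex_axioms K.cocycles_subset coh_map_cls
       L.coh_add L.coh_smult map.add map_smul K.add_in K.smul_in map_in intro!: map_cocycle)

end

section \<open>The snake lemma\<close>

locale short_exact_cplx =
  fixes K :: "('k::field, 'm::ab_group_add) cplx" and L :: "('k, 'n::ab_group_add) cplx"
    and P :: "('k, 'p::ab_group_add) cplx" and f :: "int \<Rightarrow> 'm \<Rightarrow> 'n" and g :: "int \<Rightarrow> 'n \<Rightarrow> 'p"
  assumes short_exact: "short_exact K L P f g"
begin

sublocale f: cochain_map K L f
  using short_exact by unfold_locales (auto simp: short_exact_def)

sublocale g: cochain_map L P g
  using short_exact by unfold_locales (auto simp: short_exact_def)

lemma inj: "x \<in> cgr K n \<Longrightarrow> x' \<in> cgr K n \<Longrightarrow> f n x = f n x' \<Longrightarrow> x = x'"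
  using short_exact by (auto simp: short_exact_def dest: inj_onD)

lemma image_kernel: "f n ` cgr K n = {y \<in> cgr L n. g n y = 0}"
  and image_g: "g n ` cgr L n = cgr P n"
  using short_exact by (auto simp: short_exact_def)

lemma g_f: "x \<in> cgr K n \<Longrightarrow> g n (f n x) = 0"
  using image_kernel by blast

lemma kernelE:
  assumes "y \<in> cgr L n" "g n y = 0"
  obtains x where "x \<in> cgr K n" "f n x = y"
  using assms image_kernel[of n] by (metis (mono_tags, lifting) imageE mem_Collect_eq)

lemma liftE:
  assumes "p \<in> cgr P n"
  obtains y where "y \<in> cgr L n" "g n y = p"
  using assms image_g[of n] by (metis imageE)

text \<open>The chase behind the connecting map: a lift \<open>y\<close> of the cocycle
  \<open>p\<close> has g(dy) = dp = 0, so dy comes from some \<open>x\<close>; and f(dx) = ddy = 0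
  forces dx = 0, as \<open>f\<close> is injective.\<close>

lemma cocycle_liftE:
  assumes "p \<in> cocycles P n"
  obtains x y where "y \<in> cgr L n" "g n y = p" "x \<in> cocycles K (n + 1)" "f (n + 1) x = cdif L n y"
proof -
  obtain y where y: "y \<in> cgr L n" "g n y = p"
    using assms g.L.cocycles_subset liftE by blast
  have "g (n + 1) (cdif L n y) = 0"
    using g.map_dif[OF y(1), of "n + 1"] y assms by (simp add: cocycles_def)
  then obtain x where x: "x \<in> cgr K (n + 1)" "f (n + 1) x = cdif L n y"
    using kernelE[of "cdif L n y"] y(1) f.L.dif_in by blast
  have "f (n + 1 + 1) (cdif K (n + 1) x) = f (n + 1 + 1) 0"
    using x y by (simp add: f.map_dif f.L.dif_dif f.map.zero)
  then have "cdif K (n + 1) x = 0"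
    by (rule inj[OF f.K.dif_in[OF x(1) refl] f.K.zero_in])
  with x y show ?thesis
    by (intro that) (auto simp: cocycles_def)
qed

text \<open>If f(x) = dy, then d(g y) = g(f x) = 0, so g(y) is a cocycle whose class is sent to that
  of \<open>x\<close> by the connecting map. This serves both exactness at the left term and
  injectivity on the left.\<close>

lemma f_coboundaryD:
  assumes x: "x \<in> cgr K n" and b: "f n x \<in> coboundaries L n"
    obtains y where "y \<in> cgr L (n - 1)" "f n x = cdif L (n - 1) y" "g (n - 1) y \<in> cocycles P (n - 1)"
proof -
  obtain y where y: "y \<in> cgr L (n - 1)" "f n x = cdif L (n - 1) y"
    using b by (rule f.L.coboundariesE)
  have "cdif P (n - 1) (g (n - 1) y) = 0"
    using g.map_dif[OF y(1), of n] y(2)[symmetric] g_f[OF x] by simp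
  then show ?thesis
    using that y by (simp add: cocycles_def g.map_in)
qed

text \<open>Independence of all choices. Two representatives of the class differ by some dq; for a
  lift \<open>z\<close> of q, the element y' - y - dz is killed by \<open>g\<close>, hence equals
  f(u). Applying d gives f(du) = f(x' - x), so x' and x differ by a coboundary.\<close>

lemma connecting_cls:
  assumes p: "p \<in> cgr P n" and y: "y \<in> cgr L n" "g n y = p"
    and x: "x \<in> cgr K (n + 1)" "f (n + 1) x = cdif L n y"
  shows "connecting K L f g n (cls P n p) = cls K (n + 1) x"
proof -
  have "cls K (n + 1) x' = cls K (n + 1) x"
    if y': "y' \<in> cgr L n" "g n y' \<in> cls P n p"
      and x': "x' \<in> cgr K (n + 1)" "f (n + 1) x' = cdif L n y'" for x' y'
  proof -
    obtain q where q: "q \<in> cgr P (n - 1)" "g n y' - p = cdif P (n - 1) q"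
      using y' by (auto simp: g.L.cls_mem_iff elim: g.L.coboundariesE)
    obtain z where z: "z \<in> cgr L (n - 1)" "g (n - 1) z = q"
      using q(1) by (rule liftE)
    let ?dz = "cdif L (n - 1) z"
    have dz: "?dz \<in> cgr L n" using f.L.dif_in[OF z(1), of n] by simp
    have 1: "y' - y - ?dz \<in> cgr L n" using dz y y' by (simp add: f.L.diff_in)
    have "g n ?dz = cdif P (n - 1) q" using g.map_dif[OF z(1), of n] z by simp
    then have "g n (y' - y - ?dz) = 0"
      using dz y y' q by (simp add: f.L.diff_in g.map.diff)
    then obtain u where u: "u \<in> cgr K n" "f n u = y' - y - ?dz"
      using 1 kernelE by blast
    have "cdif L n ?dz = 0" using f.L.dif_dif[OF z(1)] by simp
    then have "cdif L n (f n u) = cdif L n y' - cdif L n y"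
      using dz y y' by (simp add: u f.L.diff_in f.L.dif.diff)
    then have "f (n + 1) (cdif K n u) = f (n + 1) (x' - x)"
      using u(1) x x' by (simp add: f.map_dif f.map.diff)
    then have "cdif K n u = x' - x"
      by (rule inj[OF f.K.dif_in[OF u(1) refl] f.K.diff_in[OF x'(1) x(1)]])
    then show ?thesis
      using f.K.coboundariesI[OF u(1), of "n + 1"] by (simp add: f.K.cls_eq_iff)
  qed
  \<comment> \<open>The given pair (\<open>y\<close>, \<open>x\<close>) is one of the choices, so
    the union is not empty and equals the common class.\<close>
  moreover have "g n y \<in> cls P n p" using y by simp
  ultimately show ?thesis
    unfolding connecting_def using x y by blast
qed

lemma lin_connecting:
  "lin_map (cohomology P n) (cohomology K (n + 1)) (connecting K L f g n)"
proof (rule lin_map_cohomologyI)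
  fix p q assume p: "p \<in> cocycles P n" and q: "q \<in> cocycles P n"
  obtain y x where py: "y \<in> cgr L n" "g n y = p" "x \<in> cocycles K (n + 1)" "f (n + 1) x = cdif L n y"
    using p by (rule cocycle_liftE)
  obtain y' x' where qy: "y' \<in> cgr L n" "g n y' = q" "x' \<in> cocycles K (n + 1)" "f (n + 1) x' = cdif L n y'"
    using q by (rule cocycle_liftE)
  note mem = f.K.cocycles_subset[OF py(3)] f.K.cocycles_subset[OF qy(3)]
    g.L.cocycles_subset[OF p] g.L.cocycles_subset[OF q]
  have "connecting K L f g n (cls P n (p + q)) = cls K (n + 1) (x + x')"
    using py qy mem
    by (intro connecting_cls[where y = "y + y'"])
      (auto simp: f.K.add_in f.L.add_in g.L.add_in f.map.add g.map.add f.L.dif.add)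
  then show "connecting K L f g n (cls P n (p + q)) =
      add (cohomology K (n + 1)) (connecting K L f g n (cls P n p)) (connecting K L f g n (cls P n q))"
    using connecting_cls[of p n y x] connecting_cls[of q n y' x'] py qy mem
    by (simp add: f.K.coh_add)
next
  fix c p assume p: "p \<in> cocycles P n"
  obtain y x where py: "y \<in> cgr L n" "g n y = p" "x \<in> cocycles K (n + 1)" "f (n + 1) x = cdif L n y"
    using p by (rule cocycle_liftE)
  note mem = f.K.cocycles_subset[OF py(3)] g.L.cocycles_subset[OF p]
  have "connecting K L f g n (cls P n (csmul P c p)) = cls K (n + 1) (csmul K c x)"
    using py mem
    by (intro connecting_cls[where y = "csmul L c y"])
      (auto simp: f.K.smul_in f.L.smul_in g.L.smul_in f.map_smul g.map_smul f.L.dif_smul)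
  then show "connecting K L f g n (cls P n (csmul P c p)) =
      smult (cohomology K (n + 1)) c (connecting K L f g n (cls P n p))"
    using connecting_cls[of p n y x] py mem by (simp add: f.K.coh_smult)
next
  fix p assume p: "p \<in> cocycles P n"
  obtain y x where py: "y \<in> cgr L n" "g n y = p" "x \<in> cocycles K (n + 1)" "f (n + 1) x = cdif L n y"
    using p by (rule cocycle_liftE)
  show "\<exists>x\<in>cocycles K (n + 1). connecting K L f g n (cls P n p) = cls K (n + 1) x"
    using connecting_cls[of p n y x] py f.K.cocycles_subset g.L.cocycles_subset p by blast
qed (unfold_locales)

lemma exact_middle:
  "exact_at (cohomology K n) (cohomology L n) (cohomology P n) (coh_map L f n) (coh_map P g n)"
  unfolding exact_at_def
proof (intro equalityI subsetI)
  fix S assume "S \<in> coh_map L f n ` carrier (cohomology K n)"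
  then obtain x where x: "x \<in> cocycles K n" "S = cls L n (f n x)"
    by (auto elim!: cohomology_carrierE simp: f.coh_map_cls f.K.cocycles_subset)
  then have "g n (f n x) = 0" using g_f f.K.cocycles_subset by blast
  then show "S \<in> {v \<in> carrier (cohomology L n). coh_map P g n v = zero (cohomology P n)}"
    using x by (simp add: f.map_cocycle f.L.coh_carrierI g.coh_map_cls f.map_in f.K.cocycles_subset g.L.coh_zero)
next
  fix S assume "S \<in> {v \<in> carrier (cohomology L n). coh_map P g n v = zero (cohomology P n)}"
  then obtain y where y: "y \<in> cocycles L n" "S = cls L n y" "g n y \<in> coboundaries P n"
    by (auto elim!: cohomology_carrierE simp: g.coh_map_cls f.L.cocycles_subset g.L.coh_zero_iff)
  obtain q where q: "q \<in> cgr P (n - 1)" "g n y = cdif P (n - 1) q"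
    using y(3) by (rule g.L.coboundariesE)
  obtain z where z: "z \<in> cgr L (n - 1)" "g (n - 1) z = q"
    using q(1) by (rule liftE)
  \<comment> \<open>Since g(y) is the boundary of g(z), subtracting dz moves \<open>y\<close> into
    the kernel of \<open>g\<close> without changing its class.\<close>
  let ?dz = "cdif L (n - 1) z"
  have dz: "?dz \<in> coboundaries L n" using z f.L.coboundariesI by simp
  then have c: "y - ?dz \<in> cocycles L n"
    using y(1) f.L.add_cocycle[OF y(1) f.L.uminus_cocycle[OF f.L.coboundaries_cocycles[OF dz]]] by simp
  have "g n (y - ?dz) = 0"
    using g.map_dif[OF z(1), of n] z q y(1) dz
    by (simp add: g.map.diff f.L.coboundaries_cocycles f.L.cocycles_subset)
  then obtain x where x: "x \<in> cgr K n" "f n x = y - ?dz"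
    using c f.L.cocycles_subset kernelE by blast
  have "f (n + 1) (cdif K n x) = f (n + 1) 0"
    using x c by (simp add: f.map_dif f.map.zero cocycles_def)
  then have "x \<in> cocycles K n"
    using inj[OF f.K.dif_in[OF x(1)] f.K.zero_in] x(1) by (simp add: cocycles_def)
  moreover have "coh_map L f n (cls K n x) = S"
    using x y(2) dz f.L.uminus_coboundary[OF dz] by (simp add: f.coh_map_cls f.L.cls_eq_iff)
  ultimately show "S \<in> coh_map L f n ` carrier (cohomology K n)"
    using f.K.coh_carrierI by blast
qed

lemma exact_right:
  "exact_at (cohomology L n) (cohomology P n) (cohomology K (n + 1)) (coh_map P g n)
     (connecting K L f g n)"
  unfolding exact_at_def
proof (intro equalityI subsetI)
  fix S assume "S \<in> coh_map P g n ` carrier (cohomology L n)"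
  then obtain y where y: "y \<in> cocycles L n" "S = cls P n (g n y)"
    by (auto elim!: cohomology_carrierE simp: g.coh_map_cls f.L.cocycles_subset)
  have "connecting K L f g n S = cls K (n + 1) 0"
    unfolding y using y(1)
    by (intro connecting_cls[where y = y]) (auto simp: cocycles_def f.map.zero g.map_in)
  then show "S \<in> {v \<in> carrier (cohomology P n). connecting K L f g n v = zero (cohomology K (n + 1))}"
    using y by (simp add: g.map_cocycle g.L.coh_carrierI f.K.coh_zero)
next
  fix S assume S: "S \<in> {v \<in> carrier (cohomology P n). connecting K L f g n v = zero (cohomology K (n + 1))}"
  then obtain p where p: "p \<in> cocycles P n" "S = cls P n p"
    by (auto elim!: cohomology_carrierE)
  obtain y x where y: "y \<in> cgr L n" "g n y = p" "x \<in> cocycles K (n + 1)" "f (n + 1) x = cdif L n y"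
    using p(1) by (rule cocycle_liftE)
  have "x \<in> coboundaries K (n + 1)"
    using S p y connecting_cls[of p n y x]
    by (simp add: f.K.coh_zero_iff f.K.cocycles_subset g.L.cocycles_subset)
  then obtain u where u: "u \<in> cgr K n" "x = cdif K n u"
    by (auto elim: f.K.coboundariesE)
  \<comment> \<open>The connecting class vanishes, so dy = f(x) = f(du) = d(f u). Correcting
    \<open>y\<close> by f(u) makes it a cocycle and leaves g(y) as it is.\<close>
  have "y - f n u \<in> cocycles L n"
    using y u f.map_dif[OF u(1)] by (simp add: cocycles_def f.L.diff_in f.map_in f.L.dif.diff)
  moreover have "coh_map P g n (cls L n (y - f n u)) = S"
    using y u p by (simp add: g.coh_map_cls f.L.diff_in f.map_in g.map.diff g_f)
  ultimately show "S \<in> coh_map P g n ` carrier (cohomology L n)"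
    using f.L.coh_carrierI by blast
qed

lemma exact_left:
  "exact_at (cohomology P n) (cohomology K (n + 1)) (cohomology L (n + 1)) (connecting K L f g n)
     (coh_map L f (n + 1))"
  unfolding exact_at_def
proof (intro equalityI subsetI)
  fix S assume "S \<in> connecting K L f g n ` carrier (cohomology P n)"
  then obtain p where p: "p \<in> cocycles P n" "S = connecting K L f g n (cls P n p)"
    by (auto elim!: cohomology_carrierE)
  obtain y x where y: "y \<in> cgr L n" "g n y = p" "x \<in> cocycles K (n + 1)" "f (n + 1) x = cdif L n y"
    using p(1) by (rule cocycle_liftE)
  have "S = cls K (n + 1) x"
    using p y connecting_cls[of p n y x] by (simp add: f.K.cocycles_subset g.L.cocycles_subset)
  then show "S \<in> {v \<in> carrier (cohomology K (n + 1)).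
      coh_map L f (n + 1) v = zero (cohomology L (n + 1))}"
    using y f.L.coboundariesI[OF y(1)]
    by (simp add: f.K.coh_carrierI f.coh_map_cls f.K.cocycles_subset f.L.coh_zero_iff)
next
  fix S assume "S \<in> {v \<in> carrier (cohomology K (n + 1)).
      coh_map L f (n + 1) v = zero (cohomology L (n + 1))}"
  then obtain x where x: "x \<in> cocycles K (n + 1)" "S = cls K (n + 1) x"
      "f (n + 1) x \<in> coboundaries L (n + 1)"
    by (auto elim!: cohomology_carrierE simp: f.coh_map_cls f.K.cocycles_subset f.L.coh_zero_iff)
  obtain y where y: "y \<in> cgr L n" "f (n + 1) x = cdif L n y" "g n y \<in> cocycles P n"
    using f_coboundaryD[OF f.K.cocycles_subset[OF x(1)] x(3)] by auto
  then have "connecting K L f g n (cls P n (g n y)) = S"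
    using x y by (simp add: connecting_cls f.K.cocycles_subset g.map_in)
  then show "S \<in> connecting K L f g n ` carrier (cohomology P n)"
    using y g.L.coh_carrierI by blast
qed

theorem long_exact_cohomology:
  "long_exact (cohomology K) (cohomology L) (cohomology P) (coh_map L f) (coh_map P g)
     (connecting K L f g)"
  unfolding long_exact_def
  by (simp add: f.K.module_cohomology f.L.module_cohomology g.L.module_cohomology f.lin_coh_map
      g.lin_coh_map lin_connecting exact_left exact_right exact_middle)

text \<open>A class killed by the map that \<open>f\<close> induces is a connecting image from
  degree n - 1, where the cohomology of \<open>P\<close> is zero by assumption.\<close>

lemma inj_on_coh_map:
  assumes "carrier (cohomology P (n - 1)) = {zero (cohomology P (n - 1))}"
  shows "inj_on (coh_map L f n) (carrier (cohomology K n))"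
proof (rule inj_onI)
  fix S S' assume S: "S \<in> carrier (cohomology K n)" "S' \<in> carrier (cohomology K n)"
    and eq: "coh_map L f n S = coh_map L f n S'"
  obtain x x' where x: "x \<in> cocycles K n" "S = cls K n x" "x' \<in> cocycles K n" "S' = cls K n x'"
    using S by (auto elim!: cohomology_carrierE)
  have d: "x - x' \<in> cocycles K n"
    using f.K.add_cocycle[OF x(1) f.K.uminus_cocycle[OF x(3)]] by simp
  have "f n (x - x') \<in> coboundaries L n"
    using eq x by (simp add: f.coh_map_cls f.K.cocycles_subset f.L.cls_eq_iff f.map.diff)
  then obtain y where y: "y \<in> cgr L (n - 1)" "f n (x - x') = cdif L (n - 1) y"
      "g (n - 1) y \<in> cocycles P (n - 1)"
    by (rule f_coboundaryD[OF f.K.cocycles_subset[OF d]])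
  have "cls P (n - 1) (g (n - 1) y) = zero (cohomology P (n - 1))"
    using g.L.coh_carrierI[OF y(3)] assms by simp
  then have "connecting K L f g (n - 1) (cls P (n - 1) (g (n - 1) y)) = zero (cohomology K n)"
    using lin_map_0[OF g.L.module_cohomology f.K.module_cohomology lin_connecting[of "n - 1"]] by simp
  moreover have "connecting K L f g (n - 1) (cls P (n - 1) (g (n - 1) y)) = cls K n (x - x')"
    using connecting_cls[of "g (n - 1) y" "n - 1" y "x - x'"] y d
    by (simp add: f.K.cocycles_subset g.map_in)
  ultimately show "S = S'"
    using x by (simp add: f.K.coh_zero_iff f.K.cls_eq_iff)
qed

end

section \<open>Complexes cut off below degree zero\<close>

lemma nonneg_part_simps [simp]:
  "csmul (nonneg_part K) = csmul K" "cdif (nonneg_part K) = cdif K"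
  "cgr (nonneg_part K) n = (if n < 0 then {0} else cgr K n)"
  by (simp_all add: nonneg_part_def)

lemma is_complex_nonneg_part:
  assumes "is_complex K"
  shows "is_complex (nonneg_part K)"
proof -
  interpret cochain_complex K using assms by unfold_locales
  have "vspace_on (csmul K) (if n < 0 then {0} else cgr K n)" for n
    using vsp by (auto simp: vspace_on_def smul_one[of 0])
  then show ?thesis
    unfolding is_complex_def module_component_iff
    by (auto simp: lin_map_def dif_in dif.add dif_smul dif.zero dif_dif)
qed

lemma chain_map_nonneg_part:
  assumes "is_complex K" "is_complex L" "chain_map K L f"
  shows "chain_map (nonneg_part K) (nonneg_part L) f"
proof -
  interpret cochain_map K L f using assms by unfold_locales
  show ?thesis
    unfolding chain_map_def
    by (auto simp: lin_map_def map_in map.add map_smul map.zero map_dif K.dif.zero L.dif.zero)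
qed

text \<open>Exactness is a condition in each degree separately, and below degree 0 all three
  components become 0.\<close>

lemma short_exact_nonneg_part:
  assumes "short_exact K L P f g"
  shows "short_exact (nonneg_part K) (nonneg_part L) (nonneg_part P) f g"
proof -
  interpret short_exact_cplx K L P f g using assms by unfold_locales
  show ?thesis
    using assms unfolding short_exact_def
    by (auto simp: is_complex_nonneg_part chain_map_nonneg_part f.map.zero g.map.zero split: if_splits)
qed

text \<open>In degree -1 this is the hypothesis of \<open>inj_on_coh_map\<close> that gives the zero
  on the left.\<close>

lemma (in cochain_complex) cohomology_nonneg_part_neg:
  assumes "n < 0"
  shows "carrier (cohomology (nonneg_part K) n) = {zero (cohomology (nonneg_part K) n)}"
  using assms by (auto simp: cohomology_def cocycles_def dif.zero)

section \<open>Dg-bimodules and their cohomology\<close>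

lemma cx_simps [simp]:
  "csmul (cx X x y) = smul X" "cgr (cx X x y) = gr X x y" "cdif (cx X x y) = dif X x y"
  by (simp_all add: cx_def)

text \<open>Composition, left action and right action are three instances of one notion. Their
  bilinearity, their signs and their descent to cohomology are settled here for all three.\<close>

locale dg_pairing = K: cochain_complex K + L: cochain_complex L + P: cochain_complex P
  for K :: "('k::field, 'm::ab_group_add) cplx" and L :: "('k, 'n::ab_group_add) cplx"
    and P :: "('k, 'p::ab_group_add) cplx" +
  fixes m :: "int \<Rightarrow> int \<Rightarrow> 'm \<Rightarrow> 'n \<Rightarrow> 'p"
  assumes bilin: "bilin_map (component K j) (component L i) (component P (j + i)) (m j i)"
    and leibniz: "a \<in> cgr K j \<Longrightarrow> b \<in> cgr L i \<Longrightarrow>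
      cdif P (j + i) (m j i a b) = m (j + 1) i (cdif K j a) b + sg j (m j (i + 1) a (cdif L i b))"
begin

lemma pair_in: "a \<in> cgr K j \<Longrightarrow> b \<in> cgr L i \<Longrightarrow> k = j + i \<Longrightarrow> m j i a b \<in> cgr P k"
  using bilin[of j i] by (simp add: bilin_map_def lin_map_def)

lemma pair_dif: "a \<in> cgr K j \<Longrightarrow> b \<in> cgr L i \<Longrightarrow> k = j + i \<Longrightarrow>
   cdif P k (m j i a b) = m (j + 1) i (cdif K j a) b + sg j (m j (i + 1) a (cdif L i b))"
  using leibniz by simp

lemma smul_left: "a \<in> cgr K j \<Longrightarrow> b \<in> cgr L i \<Longrightarrow> m j i (csmul K c a) b = csmul P c (m j i a b)"
  and smul_right: "a \<in> cgr K j \<Longrightarrow> b \<in> cgr L i \<Longrightarrow> m j i a (csmul L c b) = csmul P c (m j i a b)"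
  using bilin[of j i] by (simp_all add: bilin_map_def lin_map_def)

lemma left: "b \<in> cgr L i \<Longrightarrow> additive_on (cgr K j) (\<lambda>a. m j i a b)"
  by (rule lin_map_additive_on[OF K.module_component, of j P "j + i"])
    (use bilin in \<open>simp add: bilin_map_def\<close>)

lemma right: "a \<in> cgr K j \<Longrightarrow> additive_on (cgr L i) (m j i a)"
  by (rule lin_map_additive_on[OF L.module_component, of i P "j + i"])
    (use bilin in \<open>simp add: bilin_map_def\<close>)

lemma add_left: "a \<in> cgr K j \<Longrightarrow> a' \<in> cgr K j \<Longrightarrow> b \<in> cgr L i \<Longrightarrow> m j i (a + a') b = m j i a b + m j i a' b"
  using additive_on.add[OF left] .

lemma add_right: "a \<in> cgr K j \<Longrightarrow> b \<in> cgr L i \<Longrightarrow> b' \<in> cgr L i \<Longrightarrow> m j i a (b + b') = m j i a b + m j i a b'"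
  using additive_on.add[OF right] .

lemma zero_left [simp]: "b \<in> cgr L i \<Longrightarrow> m j i 0 b = 0"
  using additive_on.zero[OF left] .

lemma zero_right [simp]: "a \<in> cgr K j \<Longrightarrow> m j i a 0 = 0"
  using additive_on.zero[OF right] .

lemma sg_left: "a \<in> cgr K j \<Longrightarrow> b \<in> cgr L i \<Longrightarrow> m j i (sg e a) b = sg e (m j i a b)"
  using additive_on.sg[OF left] .

lemma sg_right: "a \<in> cgr K j \<Longrightarrow> b \<in> cgr L i \<Longrightarrow> m j i a (sg e b) = sg e (m j i a b)"
  using additive_on.sg[OF right] .

lemma pair_cocycle:
  assumes "a \<in> cocycles K j" "b \<in> cocycles L i" "k = j + i"
  shows "m j i a b \<in> cocycles P k"
  using assms by (simp add: cocycles_def pair_in pair_dif sg_def)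

lemma pair_coboundary_left:
  assumes "a \<in> coboundaries K j" "b \<in> cocycles L i" "k = j + i"
  shows "m j i a b \<in> coboundaries P k"
proof -
  obtain u where u: "u \<in> cgr K (j - 1)" "a = cdif K (j - 1) u"
    using assms(1) by (rule K.coboundariesE)
  have b: "b \<in> cgr L i" "cdif L i b = 0"
    using assms(2) by (simp_all add: cocycles_def)
  have "cdif P (j - 1 + i) (m (j - 1) i u b) = m j i a b"
    using pair_dif[OF u(1) b(1) refl] u b by (simp add: sg_def)
  then show ?thesis
    using P.coboundariesI[OF pair_in[OF u(1) b(1) refl], of k] assms(3) by simp
qed

text \<open>For a cocycle \<open>a\<close> of degree j and b = du, the differential of the pairing
  of \<open>a\<close> with u is the pairing with b up to the sign (-1)^j; coboundaries are closed
  under negation, so the sign can be removed.\<close>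

lemma pair_coboundary_right:
  assumes "a \<in> cocycles K j" "b \<in> coboundaries L i" "k = j + i"
  shows "m j i a b \<in> coboundaries P k"
proof -
  obtain u where u: "u \<in> cgr L (i - 1)" "b = cdif L (i - 1) u"
    using assms(2) by (rule L.coboundariesE)
  have a: "a \<in> cgr K j" "cdif K j a = 0"
    using assms(1) by (simp_all add: cocycles_def)
  have "cdif P (j + (i - 1)) (m j (i - 1) a u) = sg j (m j i a b)"
    using pair_dif[OF a(1) u(1) refl] u a by simp
  then have "sg j (m j i a b) \<in> coboundaries P k"
    using P.coboundariesI[OF pair_in[OF a(1) u(1) refl], of k] assms(3) by simp
  then show ?thesis
    using P.uminus_coboundary[of "- m j i a b" k] by (simp add: sg_def split: if_splits)
qed

text \<open>The total degree \<open>k\<close> is an argument of its own, so that an action of degree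
  0 lands in degree \<open>n\<close> as written and not in \<open>0 + n\<close>.\<close>

definition coh_pair :: "int \<Rightarrow> int \<Rightarrow> int \<Rightarrow> 'm set \<Rightarrow> 'n set \<Rightarrow> 'p set" where
  "coh_pair k j i S T = (\<Union>a\<in>S. \<Union>b\<in>T. cls P k (m j i a b))"

lemma coh_pair_cls:
  assumes a: "a \<in> cocycles K j" and b: "b \<in> cocycles L i" and k: "k = j + i"
  shows "coh_pair k j i (cls K j a) (cls L i b) = cls P k (m j i a b)"
proof -
  \<comment> \<open>The inner union is evaluated for every cocycle in place of \<open>a\<close>,
    because the outer one compares its values at \<open>a\<close> and at
    \<open>a + v\<close>.\<close>
  have inner: "(\<Union>b\<in>cls L i b. cls P k (m j i a b)) = cls P k (m j i a b)"
    if a: "a \<in> cocycles K j" for a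
  proof (rule L.UN_cls)
    fix v assume v: "v \<in> coboundaries L i"
    show "cls P k (m j i a (b + v)) = cls P k (m j i a b)"
      using pair_coboundary_right[OF a v k] K.cocycles_subset[OF a] L.cocycles_subset[OF b]
        L.coboundaries_subset[OF v]
      by (simp add: add_right P.cls_add_coboundary)
  qed
  show ?thesis
    unfolding coh_pair_def inner[OF a, symmetric]
  proof (rule K.UN_cls)
    fix v assume v: "v \<in> coboundaries K j"
    have "cls P k (m j i (a + v) b) = cls P k (m j i a b)"
      using pair_coboundary_left[OF v b k] K.cocycles_subset[OF a] L.cocycles_subset[OF b]
        K.coboundaries_subset[OF v]
      by (simp add: add_left P.cls_add_coboundary)
    then show "(\<Union>b\<in>cls L i b. cls P k (m j i (a + v) b)) = (\<Union>b\<in>cls L i b. cls P k (m j i a b))"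
      using inner[OF a] inner[OF K.add_cocycle[OF a K.coboundaries_cocycles[OF v]]] by simp
  qed
qed

lemma bilin_coh_pair:
  assumes k: "k = j + i"
  shows "bilin_map (cohomology K j) (cohomology L i) (cohomology P k) (coh_pair k j i)"
  unfolding bilin_map_def
proof (intro conjI ballI)
  fix S assume "S \<in> carrier (cohomology K j)"
  then obtain a where a: "a \<in> cgr K j" "a \<in> cocycles K j" "S = cls K j a"
    by (rule K.coh_carrierE')
  show "lin_map (cohomology L i) (cohomology P k) (coh_pair k j i S)"
    unfolding a(3)
    by (rule lin_map_cohomologyI[OF L.cochain_complex_axioms P.cochain_complex_axioms])
      (use a(1,2) k L.cocycles_subset in \<open>auto simp: coh_pair_cls L.add_cocycle L.smul_cocycle P.coh_add
          P.coh_smult add_right smul_right pair_in intro: pair_cocycle\<close>)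
next
  fix T assume "T \<in> carrier (cohomology L i)"
  then obtain b where b: "b \<in> cgr L i" "b \<in> cocycles L i" "T = cls L i b"
    by (rule L.coh_carrierE')
  show "lin_map (cohomology K j) (cohomology P k) (\<lambda>S. coh_pair k j i S T)"
    unfolding b(3)
    by (rule lin_map_cohomologyI[OF K.cochain_complex_axioms P.cochain_complex_axioms])
      (use b(1,2) k K.cocycles_subset in \<open>auto simp: coh_pair_cls K.add_cocycle K.smul_cocycle P.coh_add
          P.coh_smult add_left smul_left pair_in intro: pair_cocycle\<close>)
qed

end

section \<open>Dg-categories and dg-bimodules\<close>

locale dg_cat =
  fixes A :: "('k::field, 'o, 'm::ab_group_add) dgcat"
  assumes dg_category: "dg_category A"
begin

lemma complex: "x \<in> Ob A \<Longrightarrow> y \<in> Ob A \<Longrightarrow> cochain_complex (cx A x y)"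
  using dg_category unfolding dg_category_def by (meson cochain_complexI)

lemma pairing:
  assumes "x \<in> Ob A" "y \<in> Ob A" "z \<in> Ob A"
  shows "dg_pairing (cx A y z) (cx A x y) (cx A x z) (cmp A x y z)"
proof (intro dg_pairing.intro dg_pairing_axioms.intro complex assms)
  fix j i a b
  note D = dg_category[unfolded dg_category_def, THEN conjunct2, THEN conjunct1, rule_format, OF assms, of j i]
  show "bilin_map (grm A y z j) (grm A x y i) (grm A x z (j + i)) (cmp A x y z j i)"
    using D by (rule conjunct1)
  assume "a \<in> cgr (cx A y z) j" "b \<in> cgr (cx A x y) i"
  then show "cdif (cx A x z) (j + i) (cmp A x y z j i a b) =
       cmp A x y z (j + 1) i (cdif (cx A y z) j a) b + sg j (cmp A x y z j (i + 1) a (cdif (cx A x y) i b))"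
    using D[THEN conjunct2] by simp
qed

text \<open>The degrees of the composites are variables tied by equations, so the law applies to
  sums of degrees in whatever form they occur.\<close>

lemma assoc:
  assumes "w \<in> Ob A" "x \<in> Ob A" "y \<in> Ob A" "z \<in> Ob A"
    and "h \<in> gr A y z l" "g \<in> gr A x y j" "f \<in> gr A w x i" and "k = j + i" "n = l + j"
  shows "cmp A w x z n i (cmp A x y z l j h g) f = cmp A w y z l k h (cmp A w x y j i g f)"
proof -
  have "cmp A w y z l (j + i) h (cmp A w x y j i g f) = cmp A w x z (l + j) i (cmp A x y z l j h g) f"
    by (rule dg_category[unfolded dg_category_def, THEN conjunct2, THEN conjunct2, THEN conjunct1,
        rule_format, OF assms(1-7)])
  then show ?thesis using assms(8,9) by simp
qed

lemma id_in: "x \<in> Ob A \<Longrightarrow> idm A x \<in> gr A x x 0"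
  and dif_id: "x \<in> Ob A \<Longrightarrow> dif A x x 0 (idm A x) = 0"
  using dg_category unfolding dg_category_def by blast+

lemma id_left: "x \<in> Ob A \<Longrightarrow> y \<in> Ob A \<Longrightarrow> f \<in> gr A x y i \<Longrightarrow> cmp A x y y 0 i (idm A y) f = f"
  and id_right: "x \<in> Ob A \<Longrightarrow> y \<in> Ob A \<Longrightarrow> f \<in> gr A x y i \<Longrightarrow> cmp A x x y i 0 f (idm A x) = f"
  using dg_category unfolding dg_category_def by blast+

lemma id_cocycle: "x \<in> Ob A \<Longrightarrow> idm A x \<in> cocycles (cx A x x) 0"
  by (simp add: cocycles_def id_in dif_id)

end

lemma diagonal_simps [simp]:
  "smul (diagonal A) = smul A" "gr (diagonal A) = gr A" "dif (diagonal A) = dif A"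
  "lact (diagonal A) = cmp A" "ract (diagonal A) = cmp A"
  by (simp_all add: diagonal_def)

lemma cx_diagonal [simp]: "cx (diagonal A) = cx A"
  by (simp add: cx_def fun_eq_iff)

lemma (in dg_cat) dg_bimodule_diagonal: "dg_bimodule A (diagonal A)"
  unfolding dg_bimodule_def diagonal_simps cx_diagonal
  by (intro conjI ballI allI)
    (simp_all add: cochain_complex.is_complex[OF complex] dg_pairing.bilin[OF pairing]
      dg_pairing.leibniz[OF pairing, unfolded cx_simps] assoc id_left id_right)

locale dg_bimod = dg_cat A for A :: "('k::field, 'o, 'a::ab_group_add) dgcat" +
  fixes M :: "('k, 'o, 'm::ab_group_add, 'a) dgbimod"
  assumes dg_bimodule: "dg_bimodule A M"
begin

lemma complex_bimod: "x \<in> Ob A \<Longrightarrow> y \<in> Ob A \<Longrightarrow> cochain_complex (cx M x y)"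
  using dg_bimodule unfolding dg_bimodule_def by (meson cochain_complexI)

lemma pairing_left:
  assumes "x \<in> Ob A" "y \<in> Ob A" "z \<in> Ob A"
  shows "dg_pairing (cx A y z) (cx M x y) (cx M x z) (lact M x y z)"
proof (intro dg_pairing.intro dg_pairing_axioms.intro complex complex_bimod assms)
  fix j i a b
  note D = dg_bimodule[unfolded dg_bimodule_def, THEN conjunct2, THEN conjunct1, rule_format, OF assms, of j i]
  show "bilin_map (grm A y z j) (grm M x y i) (grm M x z (j + i)) (lact M x y z j i)"
    using D by blast
  assume "a \<in> cgr (cx A y z) j" "b \<in> cgr (cx M x y) i"
  then show "cdif (cx M x z) (j + i) (lact M x y z j i a b) =
       lact M x y z (j + 1) i (cdif (cx A y z) j a) b + sg j (lact M x y z j (i + 1) a (cdif (cx M x y) i b))"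
    using D by simp
qed

lemma pairing_right:
  assumes "x \<in> Ob A" "y \<in> Ob A" "z \<in> Ob A"
  shows "dg_pairing (cx M y z) (cx A x y) (cx M x z) (ract M x y z)"
proof (intro dg_pairing.intro dg_pairing_axioms.intro complex complex_bimod assms)
  fix j i a b
  note D = dg_bimodule[unfolded dg_bimodule_def, THEN conjunct2, THEN conjunct1, rule_format, OF assms, of j i]
  show "bilin_map (grm M y z j) (grm A x y i) (grm M x z (j + i)) (ract M x y z j i)"
    using D by blast
  assume "a \<in> cgr (cx M y z) j" "b \<in> cgr (cx A x y) i"
  then show "cdif (cx M x z) (j + i) (ract M x y z j i a b) =
       ract M x y z (j + 1) i (cdif (cx M y z) j a) b + sg j (ract M x y z j (i + 1) a (cdif (cx A x y) i b))"
    using D by simp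
qed

lemma act_assoc:
  assumes "w \<in> Ob A" "x \<in> Ob A" "y \<in> Ob A" "z \<in> Ob A" and "k = j + i" "n = l + j"
  shows lact_lact: "b \<in> gr A y z l \<Longrightarrow> a \<in> gr A x y j \<Longrightarrow> m \<in> gr M w x i \<Longrightarrow>
      lact M w x z n i (cmp A x y z l j b a) m = lact M w y z l k b (lact M w x y j i a m)"
    and ract_ract: "m \<in> gr M y z l \<Longrightarrow> b \<in> gr A x y j \<Longrightarrow> a \<in> gr A w x i \<Longrightarrow>
      ract M w x z n i (ract M x y z l j m b) a = ract M w y z l k m (cmp A w x y j i b a)"
    and lact_ract: "b \<in> gr A y z l \<Longrightarrow> m \<in> gr M x y j \<Longrightarrow> a \<in> gr A w x i \<Longrightarrow>
      ract M w x z n i (lact M x y z l j b m) a = lact M w y z l k b (ract M w x y j i m a)"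
proof -
  note D = dg_bimodule[unfolded dg_bimodule_def, THEN conjunct2, THEN conjunct2, THEN conjunct1,
      rule_format, OF assms(1-4), of l j i]
  show "lact M w x z n i (cmp A x y z l j b a) m = lact M w y z l k b (lact M w x y j i a m)"
    if "b \<in> gr A y z l" "a \<in> gr A x y j" "m \<in> gr M w x i"
    using D[THEN conjunct1] that assms by simp
  show "ract M w x z n i (ract M x y z l j m b) a = ract M w y z l k m (cmp A w x y j i b a)"
    if "m \<in> gr M y z l" "b \<in> gr A x y j" "a \<in> gr A w x i"
    using D[THEN conjunct2, THEN conjunct1] that assms by simp
  show "ract M w x z n i (lact M x y z l j b m) a = lact M w y z l k b (ract M w x y j i m a)"
    if "b \<in> gr A y z l" "m \<in> gr M x y j" "a \<in> gr A w x i"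
    using D[THEN conjunct2, THEN conjunct2] that assms by simp
qed

lemma lact_id: "x \<in> Ob A \<Longrightarrow> y \<in> Ob A \<Longrightarrow> m \<in> gr M x y i \<Longrightarrow> lact M x y y 0 i (idm A y) m = m"
  and ract_id: "x \<in> Ob A \<Longrightarrow> y \<in> Ob A \<Longrightarrow> m \<in> gr M x y i \<Longrightarrow> ract M x x y i 0 m (idm A x) = m"
  using dg_bimodule unfolding dg_bimodule_def by blast+

lemma llact_Hbimod:
  assumes "x \<in> Ob A" "y \<in> Ob A" "z \<in> Ob A"
  shows "llact (Hbimod M n) x y z = dg_pairing.coh_pair (cx M x z) (lact M x y z) n 0 n"
  using dg_pairing.coh_pair_def[OF pairing_left[OF assms]] by (simp add: Hbimod_def fun_eq_iff)

lemma lract_Hbimod: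
  assumes "x \<in> Ob A" "y \<in> Ob A" "z \<in> Ob A"
  shows "lract (Hbimod M n) x y z = dg_pairing.coh_pair (cx M x z) (ract M x y z) n n 0"
  using dg_pairing.coh_pair_def[OF pairing_right[OF assms]] by (simp add: Hbimod_def fun_eq_iff)

lemma llact_cls:
  assumes "x \<in> Ob A" "y \<in> Ob A" "z \<in> Ob A" "a \<in> cocycles (cx A y z) 0" "m \<in> cocycles (cx M x y) n"
  shows "llact (Hbimod M n) x y z (cls (cx A y z) 0 a) (cls (cx M x y) n m) =
    cls (cx M x z) n (lact M x y z 0 n a m)"
  using dg_pairing.coh_pair_cls[OF pairing_left[OF assms(1-3)] assms(4,5), of n] assms by (simp add: llact_Hbimod)

lemma lract_cls:
  assumes "x \<in> Ob A" "y \<in> Ob A" "z \<in> Ob A" "m \<in> cocycles (cx M y z) n" "a \<in> cocycles (cx A x y) 0"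
  shows "lract (Hbimod M n) x y z (cls (cx M y z) n m) (cls (cx A x y) 0 a) =
    cls (cx M x z) n (ract M x y z n 0 m a)"
  using dg_pairing.coh_pair_cls[OF pairing_right[OF assms(1-3)] assms(4,5), of n] assms by (simp add: lract_Hbimod)

lemma lact_cocycle:
  assumes "x \<in> Ob A" "y \<in> Ob A" "z \<in> Ob A" "a \<in> cocycles (cx A y z) 0" "m \<in> cocycles (cx M x y) n"
  shows "lact M x y z 0 n a m \<in> cocycles (cx M x z) n"
  using dg_pairing.pair_cocycle[OF pairing_left[OF assms(1-3)] assms(4,5), of n] by simp

lemma ract_cocycle:
  assumes "x \<in> Ob A" "y \<in> Ob A" "z \<in> Ob A" "m \<in> cocycles (cx M y z) n" "a \<in> cocycles (cx A x y) 0"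
  shows "ract M x y z n 0 m a \<in> cocycles (cx M x z) n"
  using dg_pairing.pair_cocycle[OF pairing_right[OF assms(1-3)] assms(4,5), of n] by simp

end

section \<open>The homotopy category and its bimodules\<close>

lemma H0_simps [simp]:
  "lobj (H0 A) = Ob A" "lhom (H0 A) x y = cohomology (cx A x y) 0"
  "lid (H0 A) x = cls (cx A x x) 0 (idm A x)"
  by (simp_all add: H0_def)

lemma lval_Hbimod [simp]: "lval (Hbimod M n) x y = cohomology (cx M x y) n"
  by (simp add: Hbimod_def)

context dg_cat
begin

sublocale diag: dg_bimod A "diagonal A"
  by unfold_locales (rule dg_bimodule_diagonal)

lemma lcomp_H0_cls:
  assumes "x \<in> Ob A" "y \<in> Ob A" "z \<in> Ob A" "g \<in> cocycles (cx A y z) 0" "f \<in> cocycles (cx A x y) 0"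
  shows "lcomp (H0 A) x y z (cls (cx A y z) 0 g) (cls (cx A x y) 0 f) =
    cls (cx A x z) 0 (cmp A x y z 0 0 g f)"
  using diag.llact_cls[of x y z g f 0] assms by (simp add: H0_def Hbimod_def)

end

context dg_bimod
begin

theorem lin_bimodule_Hbimod: "lin_bimodule (H0 A) (Hbimod M n)"
  unfolding lin_bimodule_def
proof (intro conjI ballI)
  fix x y assume xy: "x \<in> lobj (H0 A)" "y \<in> lobj (H0 A)"
  then show "module scalars (lval (Hbimod M n) x y)"
    by (simp add: cochain_complex.module_cohomology[OF complex_bimod])
  fix m assume "m \<in> carrier (lval (Hbimod M n) x y)"
  then have "m \<in> carrier (cohomology (cx M x y) n)" by simp
  then obtain u where "u \<in> cocycles (cx M x y) n" "m = cls (cx M x y) n u"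
    by (rule cohomology_carrierE)
  moreover from this have "u \<in> gr M x y n" by (simp add: cocycles_def)
  ultimately show "llact (Hbimod M n) x y y (lid (H0 A) y) m = m"
    "lract (Hbimod M n) x x y m (lid (H0 A) x) = m"
    using xy by (simp_all add: llact_cls lract_cls id_cocycle lact_id ract_id)
next
  fix x y z assume xyz: "x \<in> lobj (H0 A)" "y \<in> lobj (H0 A)" "z \<in> lobj (H0 A)"
  then show "bilin_map (lhom (H0 A) y z) (lval (Hbimod M n) x y) (lval (Hbimod M n) x z)
       (llact (Hbimod M n) x y z)"
    using dg_pairing.bilin_coh_pair[OF pairing_left[of x y z], of n 0 n]
    by (simp add: llact_Hbimod)
  show "bilin_map (lval (Hbimod M n) y z) (lhom (H0 A) x y) (lval (Hbimod M n) x z)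
       (lract (Hbimod M n) x y z)"
    using dg_pairing.bilin_coh_pair[OF pairing_right[of x y z], of n n 0] xyz
    by (simp add: lract_Hbimod)
next
  fix w x y z b a m
  assume "w \<in> lobj (H0 A)" "x \<in> lobj (H0 A)" "y \<in> lobj (H0 A)" "z \<in> lobj (H0 A)"
  then have ob: "w \<in> Ob A" "x \<in> Ob A" "y \<in> Ob A" "z \<in> Ob A" by simp_all
  { assume "b \<in> carrier (lhom (H0 A) y z)" "a \<in> carrier (lhom (H0 A) x y)"
      "m \<in> carrier (lval (Hbimod M n) w x)"
    then obtain b' a' m' where r: "b' \<in> cocycles (cx A y z) 0" "b = cls (cx A y z) 0 b'"
        "a' \<in> cocycles (cx A x y) 0" "a = cls (cx A x y) 0 a'"
        "m' \<in> cocycles (cx M w x) n" "m = cls (cx M w x) n m'"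
      unfolding H0_simps lval_Hbimod by (metis cohomology_carrierE)
    have "lact M w x z 0 n (cmp A x y z 0 0 b' a') m' = lact M w y z 0 n b' (lact M w x y 0 n a' m')"
      by (rule lact_lact) (use ob r in \<open>simp_all add: cocycles_def\<close>)
    then show "llact (Hbimod M n) w y z b (llact (Hbimod M n) w x y a m) =
        llact (Hbimod M n) w x z (lcomp (H0 A) x y z b a) m"
      using ob r diag.lact_cocycle[of x y z b' a' 0]
      by (simp add: llact_cls lcomp_H0_cls lact_cocycle) }
  { assume "m \<in> carrier (lval (Hbimod M n) y z)" "b \<in> carrier (lhom (H0 A) x y)"
      "a \<in> carrier (lhom (H0 A) w x)"
    then obtain b' a' m' where r: "b' \<in> cocycles (cx A x y) 0" "b = cls (cx A x y) 0 b'"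
        "a' \<in> cocycles (cx A w x) 0" "a = cls (cx A w x) 0 a'"
        "m' \<in> cocycles (cx M y z) n" "m = cls (cx M y z) n m'"
      unfolding H0_simps lval_Hbimod by (metis cohomology_carrierE)
    have "ract M w x z n 0 (ract M x y z n 0 m' b') a' = ract M w y z n 0 m' (cmp A w x y 0 0 b' a')"
      by (rule ract_ract) (use ob r in \<open>simp_all add: cocycles_def\<close>)
    then show "lract (Hbimod M n) w x z (lract (Hbimod M n) x y z m b) a =
        lract (Hbimod M n) w y z m (lcomp (H0 A) w x y b a)"
      using ob r diag.lact_cocycle[of w x y b' a' 0]
      by (simp add: lract_cls lcomp_H0_cls ract_cocycle) }
  { assume "b \<in> carrier (lhom (H0 A) y z)" "m \<in> carrier (lval (Hbimod M n) x y)"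
      "a \<in> carrier (lhom (H0 A) w x)"
    then obtain b' a' m' where r: "b' \<in> cocycles (cx A y z) 0" "b = cls (cx A y z) 0 b'"
        "a' \<in> cocycles (cx A w x) 0" "a = cls (cx A w x) 0 a'"
        "m' \<in> cocycles (cx M x y) n" "m = cls (cx M x y) n m'"
      unfolding H0_simps lval_Hbimod by (metis cohomology_carrierE)
    have "ract M w x z n 0 (lact M x y z 0 n b' m') a' = lact M w y z 0 n b' (ract M w x y n 0 m' a')"
      by (rule lact_ract) (use ob r in \<open>simp_all add: cocycles_def\<close>)
    then show "llact (Hbimod M n) w y z b (lract (Hbimod M n) w x y m a) =
        lract (Hbimod M n) w x z (llact (Hbimod M n) x y z b m) a"
      using ob r by (simp add: llact_cls lract_cls lact_cocycle ract_cocycle) }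
qed

end

text \<open>The hom-spaces of \<open>H0 A\<close> are the values of the cohomology bimodule of the
  diagonal in degree 0, and both of its actions are the composition. So the laws of a category are
  among the laws of this bimodule.\<close>

theorem (in dg_cat) lin_category_H0: "lin_category (H0 A)"
proof -
  have H: "lin_bimodule (H0 A) (Hbimod (diagonal A) 0)"
    by (rule diag.lin_bimodule_Hbimod)
  have 1: "lhom (H0 A) = lval (Hbimod (diagonal A) 0)"
    by (simp add: fun_eq_iff)
  have 2: "llact (Hbimod (diagonal A) 0) = lcomp (H0 A)" "lract (Hbimod (diagonal A) 0) = lcomp (H0 A)"
    by (simp_all add: H0_def Hbimod_def fun_eq_iff)
  have 3: "lid (H0 A) x \<in> carrier (lhom (H0 A) x x)" if "x \<in> lobj (H0 A)" for x
    using that id_cocycle by (auto simp: cohomology_def)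
  show ?thesis
    unfolding lin_category_def
  proof (intro conjI)
    note H' = H[unfolded lin_bimodule_def 1[symmetric] 2]
    show "\<forall>x\<in>lobj (H0 A). \<forall>y\<in>lobj (H0 A). module scalars (lhom (H0 A) x y)"
      by (rule H'[THEN conjunct1])
    show "\<forall>x\<in>lobj (H0 A). \<forall>y\<in>lobj (H0 A). \<forall>z\<in>lobj (H0 A).
        bilin_map (lhom (H0 A) y z) (lhom (H0 A) x y) (lhom (H0 A) x z) (lcomp (H0 A) x y z)"
      using H'[THEN conjunct2, THEN conjunct1] by blast
    show "\<forall>w\<in>lobj (H0 A). \<forall>x\<in>lobj (H0 A). \<forall>y\<in>lobj (H0 A). \<forall>z\<in>lobj (H0 A).
        \<forall>h\<in>carrier (lhom (H0 A) y z). \<forall>g\<in>carrier (lhom (H0 A) x y). \<forall>f\<in>carrier (lhom (H0 A) w x).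
          lcomp (H0 A) w y z h (lcomp (H0 A) w x y g f) = lcomp (H0 A) w x z (lcomp (H0 A) x y z h g) f"
      using H'[THEN conjunct2, THEN conjunct2, THEN conjunct1] by blast
    show "\<forall>x\<in>lobj (H0 A). lid (H0 A) x \<in> carrier (lhom (H0 A) x x)"
      using 3 by blast
    show "\<forall>x\<in>lobj (H0 A). \<forall>y\<in>lobj (H0 A). \<forall>f\<in>carrier (lhom (H0 A) x y).
        lcomp (H0 A) x y y (lid (H0 A) y) f = f \<and> lcomp (H0 A) x x y f (lid (H0 A) x) = f"
      by (rule H'[THEN conjunct2, THEN conjunct2, THEN conjunct2])
  qed
qed

section \<open>The long exact sequence of cohomology bimodules\<close>

locale short_exact_bimod =
  fixes A :: "('k::field, 'o, 'a::ab_group_add) dgcat"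
    and M :: "('k, 'o, 'm::ab_group_add, 'a) dgbimod" and N :: "('k, 'o, 'n::ab_group_add, 'a) dgbimod"
    and P :: "('k, 'o, 'p::ab_group_add, 'a) dgbimod"
    and f :: "'o \<Rightarrow> 'o \<Rightarrow> int \<Rightarrow> 'm \<Rightarrow> 'n" and g :: "'o \<Rightarrow> 'o \<Rightarrow> int \<Rightarrow> 'n \<Rightarrow> 'p"
  assumes dg_category: "dg_category A"
    and short_exact_bimod: "short_exact_bimodules A M N P f g"
begin

sublocale M: dg_bimod A M
  using dg_category short_exact_bimod by unfold_locales (auto simp: short_exact_bimodules_def)
sublocale N: dg_bimod A N
  using dg_category short_exact_bimod by unfold_locales (auto simp: short_exact_bimodules_def)
sublocale P: dg_bimod A P
  using dg_category short_exact_bimod by unfold_locales (auto simp: short_exact_bimodules_def)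

lemma short_exact_cplx:
  "x \<in> Ob A \<Longrightarrow> y \<in> Ob A \<Longrightarrow> short_exact_cplx (cx M x y) (cx N x y) (cx P x y) (f x y) (g x y)"
  using short_exact_bimod by unfold_locales (auto simp: short_exact_bimodules_def)

lemma hom_f: "dg_bimod_hom A M N f" and hom_g: "dg_bimod_hom A N P g"
  using short_exact_bimod by (auto simp: short_exact_bimodules_def)

end

lemma dg_bimod_homD:
  assumes "dg_bimod_hom A M N \<theta>" "x \<in> Ob A" "y \<in> Ob A"
  shows "chain_map (cx M x y) (cx N x y) (\<theta> x y)"
    and "z \<in> Ob A \<Longrightarrow> a \<in> gr A y z j \<Longrightarrow> m \<in> gr M x y i \<Longrightarrow> k = j + i \<Longrightarrow>
      \<theta> x z k (lact M x y z j i a m) = lact N x y z j i a (\<theta> x y i m)"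
    and "z \<in> Ob A \<Longrightarrow> m \<in> gr M y z j \<Longrightarrow> b \<in> gr A x y i \<Longrightarrow> k = j + i \<Longrightarrow>
      \<theta> x z k (ract M x y z j i m b) = ract N x y z j i (\<theta> y z j m) b"
  using assms(1)[unfolded dg_bimod_hom_def, THEN conjunct1, rule_format, OF assms(2,3)]
    assms(1)[unfolded dg_bimod_hom_def, THEN conjunct2, rule_format, OF assms(2,3)]
  by simp_all

lemma lin_bimod_hom_coh_map:
  assumes "dg_bimod A M" "dg_bimod A N" and hom: "dg_bimod_hom A M N \<theta>"
  shows "lin_bimod_hom (H0 A) (Hbimod M n) (Hbimod N n) (\<lambda>x y. coh_map (cx N x y) (\<theta> x y) n)"
proof -
  interpret M: dg_bimod A M by fact
  interpret N: dg_bimod A N by fact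
  have map: "cochain_map (cx M x y) (cx N x y) (\<theta> x y)" if "x \<in> Ob A" "y \<in> Ob A" for x y
    using that by (intro cochain_map.intro cochain_map_axioms.intro M.complex_bimod N.complex_bimod
        dg_bimod_homD(1)[OF hom])
  show ?thesis
    unfolding lin_bimod_hom_def
  proof (intro conjI ballI)
    fix x y assume "x \<in> lobj (H0 A)" "y \<in> lobj (H0 A)"
    then show "lin_map (lval (Hbimod M n) x y) (lval (Hbimod N n) x y) (coh_map (cx N x y) (\<theta> x y) n)"
      by (simp add: cochain_map.lin_coh_map[OF map])
  next
    fix x y z a m
    assume "x \<in> lobj (H0 A)" "y \<in> lobj (H0 A)" "z \<in> lobj (H0 A)"
    then have ob: "x \<in> Ob A" "y \<in> Ob A" "z \<in> Ob A" by simp_all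
    { assume "a \<in> carrier (lhom (H0 A) y z)" "m \<in> carrier (lval (Hbimod M n) x y)"
      then obtain a' m' where r: "a' \<in> cocycles (cx A y z) 0" "a = cls (cx A y z) 0 a'"
          "m' \<in> cocycles (cx M x y) n" "m = cls (cx M x y) n m'"
        unfolding H0_simps lval_Hbimod by (metis cohomology_carrierE)
      have mem: "a' \<in> gr A y z 0" "m' \<in> gr M x y n" using r by (simp_all add: cocycles_def)
      show "coh_map (cx N x z) (\<theta> x z) n (llact (Hbimod M n) x y z a m) =
          llact (Hbimod N n) x y z a (coh_map (cx N x y) (\<theta> x y) n m)"
        using ob r mem M.lact_cocycle[OF ob r(1,3)] cochain_map.map_cocycle[OF map r(3)]
        by (simp add: M.llact_cls N.llact_cls cochain_map.coh_map_cls[OF map] cocycles_def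
            dg_bimod_homD(2)[OF hom]) }
    { assume "m \<in> carrier (lval (Hbimod M n) y z)" "a \<in> carrier (lhom (H0 A) x y)"
      then obtain a' m' where r: "a' \<in> cocycles (cx A x y) 0" "a = cls (cx A x y) 0 a'"
          "m' \<in> cocycles (cx M y z) n" "m = cls (cx M y z) n m'"
        unfolding H0_simps lval_Hbimod by (metis cohomology_carrierE)
      have mem: "a' \<in> gr A x y 0" "m' \<in> gr M y z n" using r by (simp_all add: cocycles_def)
      show "coh_map (cx N x z) (\<theta> x z) n (lract (Hbimod M n) x y z m a) =
          lract (Hbimod N n) x y z (coh_map (cx N y z) (\<theta> y z) n m) a"
        using ob r mem M.ract_cocycle[OF ob r(3,1)] cochain_map.map_cocycle[OF map r(3)]
        by (simp add: M.lract_cls N.lract_cls cochain_map.coh_map_cls[OF map] cocycles_def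
            dg_bimod_homD(3)[OF hom]) }
  qed
qed

context short_exact_bimod
begin

lemma lin_bimod_hom_connecting:
  "lin_bimod_hom (H0 A) (Hbimod P n) (Hbimod M (n + 1))
     (\<lambda>x y. connecting (cx M x y) (cx N x y) (f x y) (g x y) n)"
  unfolding lin_bimod_hom_def
proof (intro conjI ballI)
  fix x y assume "x \<in> lobj (H0 A)" "y \<in> lobj (H0 A)"
  then show "lin_map (lval (Hbimod P n) x y) (lval (Hbimod M (n + 1)) x y)
      (connecting (cx M x y) (cx N x y) (f x y) (g x y) n)"
    by (simp add: short_exact_cplx.lin_connecting[OF short_exact_cplx])
next
  fix x y z a p
  assume "x \<in> lobj (H0 A)" "y \<in> lobj (H0 A)" "z \<in> lobj (H0 A)"
  then have ob: "x \<in> Ob A" "y \<in> Ob A" "z \<in> Ob A" by simp_all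
  note E = short_exact_cplx.cocycle_liftE[OF short_exact_cplx]
    and C = short_exact_cplx.connecting_cls[OF short_exact_cplx]
  { assume "a \<in> carrier (lhom (H0 A) y z)" "p \<in> carrier (lval (Hbimod P n) x y)"
    then obtain a' p' where r: "a' \<in> cocycles (cx A y z) 0" "a = cls (cx A y z) 0 a'"
        "p' \<in> cocycles (cx P x y) n" "p = cls (cx P x y) n p'"
      unfolding H0_simps lval_Hbimod by (metis cohomology_carrierE)
    obtain v u where lift: "v \<in> gr N x y n" "g x y n v = p'" "u \<in> cocycles (cx M x y) (n + 1)"
        "f x y (n + 1) u = dif N x y n v"
      by (rule E[unfolded cx_simps, OF ob(1) ob(2) r(3)])
    interpret lM: dg_pairing "cx A y z" "cx M x y" "cx M x z" "lact M x y z"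
      by (rule M.pairing_left[OF ob])
    interpret lN: dg_pairing "cx A y z" "cx N x y" "cx N x z" "lact N x y z"
      by (rule N.pairing_left[OF ob])
    have mem: "a' \<in> gr A y z 0" "dif A y z 0 a' = 0" "p' \<in> gr P x y n" "u \<in> gr M x y (n + 1)"
      using r lift by (simp_all add: cocycles_def)
    have "connecting (cx M x y) (cx N x y) (f x y) (g x y) n p = cls (cx M x y) (n + 1) u"
      unfolding r(4) using lift mem by (intro C[OF ob(1,2), where y = v]) simp_all
    moreover have "connecting (cx M x z) (cx N x z) (f x z) (g x z) n
        (cls (cx P x z) n (lact P x y z 0 n a' p')) =
        cls (cx M x z) (n + 1) (lact M x y z 0 (n + 1) a' u)"
    \<comment> \<open>Choices made for p' are multiplied by a': a'v lifts a'p', and d(a'v) = a'(dv)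
      because a' is closed of even degree, so a'u is the element to pull back.\<close>
    proof (rule C[OF ob(1,3), where y = "lact N x y z 0 n a' v"])
      show "lact P x y z 0 n a' p' \<in> cgr (cx P x z) n"
        using P.lact_cocycle[OF ob r(1,3)] by (simp add: cocycles_def)
      show "lact N x y z 0 n a' v \<in> cgr (cx N x z) n"
        using mem lift by (intro lN.pair_in) simp_all
      show "g x z n (lact N x y z 0 n a' v) = lact P x y z 0 n a' p'"
        using dg_bimod_homD(2)[OF hom_g ob, of a' 0 v n n] mem lift by simp
      show "lact M x y z 0 (n + 1) a' u \<in> cgr (cx M x z) (n + 1)"
        using mem by (intro lM.pair_in) simp_all
      show "f x z (n + 1) (lact M x y z 0 (n + 1) a' u) = cdif (cx N x z) n (lact N x y z 0 n a' v)"
        using dg_bimod_homD(2)[OF hom_f ob, of a' 0 u "n + 1" "n + 1"] mem lift lN.pair_dif[of a' 0 v n n]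
        by (simp add: sg_def)
    qed
    ultimately show "connecting (cx M x z) (cx N x z) (f x z) (g x z) n (llact (Hbimod P n) x y z a p) =
        llact (Hbimod M (n + 1)) x y z a (connecting (cx M x y) (cx N x y) (f x y) (g x y) n p)"
      using r ob lift by (simp add: P.llact_cls M.llact_cls) }
  { assume "p \<in> carrier (lval (Hbimod P n) y z)" "a \<in> carrier (lhom (H0 A) x y)"
    then obtain a' p' where r: "a' \<in> cocycles (cx A x y) 0" "a = cls (cx A x y) 0 a'"
        "p' \<in> cocycles (cx P y z) n" "p = cls (cx P y z) n p'"
      unfolding H0_simps lval_Hbimod by (metis cohomology_carrierE)
    obtain v u where lift: "v \<in> gr N y z n" "g y z n v = p'" "u \<in> cocycles (cx M y z) (n + 1)"
        "f y z (n + 1) u = dif N y z n v"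
      by (rule E[unfolded cx_simps, OF ob(2) ob(3) r(3)])
    interpret rM: dg_pairing "cx M y z" "cx A x y" "cx M x z" "ract M x y z"
      by (rule M.pairing_right[OF ob])
    interpret rN: dg_pairing "cx N y z" "cx A x y" "cx N x z" "ract N x y z"
      by (rule N.pairing_right[OF ob])
    have mem: "a' \<in> gr A x y 0" "dif A x y 0 a' = 0" "p' \<in> gr P y z n" "u \<in> gr M y z (n + 1)"
      using r lift by (simp_all add: cocycles_def)
    have "connecting (cx M y z) (cx N y z) (f y z) (g y z) n p = cls (cx M y z) (n + 1) u"
      unfolding r(4) using lift mem by (intro C[OF ob(2,3), where y = v]) simp_all
    moreover have "connecting (cx M x z) (cx N x z) (f x z) (g x z) n
        (cls (cx P x z) n (ract P x y z n 0 p' a')) =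
        cls (cx M x z) (n + 1) (ract M x y z (n + 1) 0 u a')"
    \<comment> \<open>On the right the term with the sign (-1)^n contains da', which is 0, so d(va')
      = (dv)a'.\<close>
    proof (rule C[OF ob(1,3), where y = "ract N x y z n 0 v a'"])
      show "ract P x y z n 0 p' a' \<in> cgr (cx P x z) n"
        using P.ract_cocycle[OF ob r(3,1)] by (simp add: cocycles_def)
      show "ract N x y z n 0 v a' \<in> cgr (cx N x z) n"
        using mem lift by (intro rN.pair_in) simp_all
      show "g x z n (ract N x y z n 0 v a') = ract P x y z n 0 p' a'"
        using dg_bimod_homD(3)[OF hom_g ob, of v n a' 0 n] mem lift by simp
      show "ract M x y z (n + 1) 0 u a' \<in> cgr (cx M x z) (n + 1)"
        using mem by (intro rM.pair_in) simp_all
      show "f x z (n + 1) (ract M x y z (n + 1) 0 u a') = cdif (cx N x z) n (ract N x y z n 0 v a')"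
        using dg_bimod_homD(3)[OF hom_f ob, of u "n + 1" a' 0 "n + 1"] mem lift rN.pair_dif[of v n a' 0 n]
        by (simp add: sg_def)
    qed
    ultimately show "connecting (cx M x z) (cx N x z) (f x z) (g x z) n (lract (Hbimod P n) x y z p a) =
        lract (Hbimod M (n + 1)) x y z (connecting (cx M y z) (cx N y z) (f y z) (g y z) n p) a"
      using r ob lift by (simp add: P.lract_cls M.lract_cls) }
qed

theorem long_exact_Hbimod:
  "long_exact_bimodules (H0 A) (Hbimod M) (Hbimod N) (Hbimod P)
     (\<lambda>n x y. coh_map (cx N x y) (f x y) n) (\<lambda>n x y. coh_map (cx P x y) (g x y) n)
     (\<lambda>n x y. connecting (cx M x y) (cx N x y) (f x y) (g x y) n)"
  unfolding long_exact_bimodules_def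
  by (simp add: M.lin_bimodule_Hbimod N.lin_bimodule_Hbimod P.lin_bimodule_Hbimod
      lin_bimod_hom_coh_map hom_f hom_g M.dg_bimod_axioms N.dg_bimod_axioms P.dg_bimod_axioms
      lin_bimod_hom_connecting short_exact_cplx.long_exact_cohomology[OF short_exact_cplx])

end

section \<open>The Hochschild complex\<close>

lemma sg_simps [simp]:
  "sg e 0 = 0" "sg e (x + y) = sg e x + sg e y" "sg e (x - y) = sg e x - sg e y"
  "sg e (- x) = - sg e x" "sg e (sg e x) = x" "sg 0 x = x"
  by (simp_all add: sg_def)

lemma sg_sg: "sg e (sg f x) = sg (e + f) x"
  by (simp add: sg_def)

lemma bdeg_simps [simp]:
  "bdeg [] = 0" "bdeg ((y, i, a) # w) = i - 1 + bdeg w" "bdeg (u @ v) = bdeg u + bdeg v"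
  by (simp_all add: bdeg_def)

lemma src_simps [simp]: "src x [] = x" "src x ((y, i, a) # w) = src y w"
  by (simp_all add: src_def)

lemma src_append [simp]: "src x (u @ v) = src (src x u) v"
  by (simp add: src_def)

lemma composable_tgt: "composable A x w \<Longrightarrow> x \<in> Ob A"
  by (cases "(A, x, w)" rule: composable.cases) simp_all

lemma composable_src: "composable A x w \<Longrightarrow> src x w \<in> Ob A"
  by (induction A x w rule: composable.induct) simp_all

lemma composable_append [simp]:
  "composable A x (u @ v) \<longleftrightarrow> composable A x u \<and> composable A (src x u) v"
  by (induction A x u rule: composable.induct) (auto dest: composable_tgt)

text \<open>The head letter \<open>a\<close> is passed outside the list because \<open>bar\<close>
  has already split it off; with nothing behind it there is no product to form.\<close>

fun bar_mul ::
  "('k, 'o, 'a) dgcat \<Rightarrow> (('o \<times> int \<times> 'a) list \<Rightarrow> 'm::ab_group_add) \<Rightarrow> 'o \<Rightarrow> 'o \<Rightarrow> int \<Rightarrow> 'a \<Rightarrow>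
   ('o \<times> int \<times> 'a) list \<Rightarrow> 'm" where
  "bar_mul A F x y i a [] = 0"
| "bar_mul A F x y i a ((z, j, b) # v) = F ((z, i + j, cmp A z y x i j a b) # v)"

text \<open>\<open>bar A F x w\<close> evaluates \<open>F\<close> on the image of \<open>w\<close> under the differential of the bar
  construction.\<close>

fun bar ::
  "('k, 'o, 'a) dgcat \<Rightarrow> (('o \<times> int \<times> 'a) list \<Rightarrow> 'm::ab_group_add) \<Rightarrow> 'o \<Rightarrow>
   ('o \<times> int \<times> 'a) list \<Rightarrow> 'm" where
  "bar A F x [] = 0"
| "bar A F x ((y, i, a) # w) = F ((y, i + 1, dif A y x i a) # w) +
     sg (i - 1) (bar_mul A F x y i a w + bar A (\<lambda>u. F ((y, i, a) # u)) y w)"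

text \<open>Additive in \<open>F\<close> for arbitrary functions \<open>F\<close>, since
  \<open>bar\<close> only evaluates \<open>F\<close> at certain strings and adds the values with
  signs.\<close>

lemma bar_add: "bar A (\<lambda>u. F u + G u) x w = bar A F x w + bar A G x w"
proof (induction w arbitrary: F G x)
  case (Cons t w)
  obtain y i a where t: "t = (y, i, a)" by (cases t) auto
  have "bar_mul A (\<lambda>u. F u + G u) x y i a w = bar_mul A F x y i a w + bar_mul A G x y i a w"
    by (cases "(A, F, x, y, i, a, w)" rule: bar_mul.cases) simp_all
  then show ?case by (simp add: t Cons.IH)
qed simp

lemma bar_zero [simp]: "bar A (\<lambda>u. 0) x w = 0"
  using bar_add[of A "\<lambda>u. 0" "\<lambda>u. 0" x w] by simp

lemma bar_uminus: "bar A (\<lambda>u. - F u) x w = - bar A F x w"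
  using bar_add[of A F "\<lambda>u. - F u" x w] by (simp add: eq_neg_iff_add_eq_0 add.commute)

lemma bar_diff: "bar A (\<lambda>u. F u - G u) x w = bar A F x w - bar A G x w"
  using bar_add[of A F "\<lambda>u. - G u" x w] by (simp add: bar_uminus)

lemma bar_sg: "bar A (\<lambda>u. sg e (F u)) x w = sg e (bar A F x w)"
  by (simp add: sg_def bar_uminus)

text \<open>The recursion of \<open>bar\<close> splits off the first letter, whereas the right
  action consumes the last one. This is the recursion from the other end: the terms that touch the
  last letter carry the sign of all letters before it.\<close>

lemma bar_snoc:
  "bar A F x (u @ [(y, i, a)]) =
    bar A (\<lambda>v. F (v @ [(y, i, a)])) x u +
    sg (bdeg u) (F (u @ [(y, i + 1, dif A y (src x u) i a)]) +
      (if u = [] then 0 else F (butlast u @ [(y, fst (snd (last u)) + i,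
         cmp A y (src x u) (src x (butlast u)) (fst (snd (last u))) i (snd (snd (last u))) a)])))"
proof (induction u arbitrary: F x)
  case (Cons t u)
  obtain z j b where t: "t = (z, j, b)" by (cases t) auto
  show ?case
  proof (cases u)
    case Nil
    then show ?thesis by (simp add: t algebra_simps)
  next
    case (Cons s v)
    obtain p l c where "s = (p, l, c)" by (cases s) auto
    with Cons show ?thesis
      using Cons.IH[of "\<lambda>u. F ((z, j, b) # u)" z] by (simp add: t sg_sg algebra_simps)
  qed
qed simp

text \<open>In the induction, splitting off the first letter puts it in front of the arguments of
  \<open>F\<close> and raises \<open>n\<close> by its bar degree i - 1; the signs of all later terms
  then agree with those of \<open>bar\<close>.\<close>

lemma hoch_sums_eq_bar:
  "(\<Sum>j<length w. sg (n + bdeg (take j w))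
      (F (take j w @ ((x # map fst w) ! (j + 1), fst (snd (w ! j)) + 1,
          dif A ((x # map fst w) ! (j + 1)) ((x # map fst w) ! j) (fst (snd (w ! j))) (snd (snd (w ! j))))
         # drop (j + 1) w))) +
   (\<Sum>j<length w - 1. sg (n + bdeg (take (j + 1) w))
      (F (take j w @ ((x # map fst w) ! (j + 2), fst (snd (w ! j)) + fst (snd (w ! (j + 1))),
          cmp A ((x # map fst w) ! (j + 2)) ((x # map fst w) ! (j + 1)) ((x # map fst w) ! j)
            (fst (snd (w ! j))) (fst (snd (w ! (j + 1)))) (snd (snd (w ! j))) (snd (snd (w ! (j + 1)))))
         # drop (j + 2) w))) =
   sg n (bar A F x w)"
proof (induction w arbitrary: n F x)
  case (Cons t w)
  obtain y i a where t: "t = (y, i, a)" by (cases t) auto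
  note IH = Cons.IH[of "n + (i - 1)" "\<lambda>u. F ((y, i, a) # u)" y]
  show ?case
  proof (cases w)
    case Nil
    then show ?thesis by (simp add: t)
  next
    case (Cons s v)
    obtain z j b where s: "s = (z, j, b)" by (cases s) auto
    \<comment> \<open>As \<open>w\<close> is nonempty, the truncated subtraction is harmless and
      both sums have a term of index 0 to split off: the differential of the first letter, and its
      product with the second.\<close>
    have len: "length (t # w) = Suc (length w)" "length (t # w) - 1 = Suc (length w - 1)"
      using Cons by simp_all
    show ?thesis
      unfolding len(2) unfolding len(1) sum.lessThan_Suc_shift
      using IH by (simp add: t Cons s sg_sg algebra_simps del: sum.lessThan_Suc)
  qed
qed simp

section \<open>The bar differential squares to zero\<close>

context dg_cat
begin

lemmas gr_zero = cochain_complex.zero_in[OF complex, unfolded cx_simps]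
  and gr_add = cochain_complex.add_in[OF complex, unfolded cx_simps]
  and gr_smul = cochain_complex.smul_in[OF complex, unfolded cx_simps]
  and gr_uminus = cochain_complex.uminus_in[OF complex, unfolded cx_simps]
  and smul_one = cochain_complex.smul_one[OF complex, unfolded cx_simps]
  and dif_in = cochain_complex.dif_in[OF complex, unfolded cx_simps]
  and dif_dif = cochain_complex.dif_dif[OF complex, unfolded cx_simps]
  and dif_smul = cochain_complex.dif_smul[OF complex, unfolded cx_simps]
  and additive_dif = cochain_complex.additive_on_dif[OF complex, unfolded cx_simps]
  and cmp_in = dg_pairing.pair_in[OF pairing, unfolded cx_simps]
  and cmp_dif = dg_pairing.pair_dif[OF pairing, unfolded cx_simps]
  and cmp_add_left = dg_pairing.add_left[OF pairing, unfolded cx_simps]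
  and cmp_add_right = dg_pairing.add_right[OF pairing, unfolded cx_simps]
  and cmp_smul_left = dg_pairing.smul_left[OF pairing, unfolded cx_simps]
  and cmp_smul_right = dg_pairing.smul_right[OF pairing, unfolded cx_simps]

lemmas dif_add = additive_on.add[OF additive_dif]

text \<open>All strings at which \<open>bar\<close> evaluates \<open>F\<close> are composable, have
  the ends of \<open>w\<close> and bar degree one higher. So signs, degrees and end objects that
  depend on the string may be frozen to constants.\<close>

lemma bar_cong:
  assumes "composable A x w"
    and "\<And>u. composable A x u \<Longrightarrow> src x u = src x w \<Longrightarrow> bdeg u = bdeg w + 1 \<Longrightarrow> F u = G u"
  shows "bar A F x w = bar A G x w"
  using assms
proof (induction w arbitrary: F G x)
  case (Cons t w)
  obtain y i a where t: "t = (y, i, a)" by (cases t) auto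
  have x: "x \<in> Ob A" "y \<in> Ob A" "a \<in> gr A y x i" "composable A y w"
    using Cons.prems(1) by (auto simp: t dest: composable_tgt)
  have "bar_mul A F x y i a w = bar_mul A G x y i a w"
  proof (cases w)
    case (Cons s v)
    obtain z j b where s: "s = (z, j, b)" by (cases s) auto
    show ?thesis
      using x Cons.prems(2)[of "(z, i + j, cmp A z y x i j a b) # v"]
      by (auto simp: t Cons s intro: cmp_in composable_tgt)
  qed simp
  moreover have "bar A (\<lambda>u. F ((y, i, a) # u)) y w = bar A (\<lambda>u. G ((y, i, a) # u)) y w"
    using x Cons.prems(2) by (intro Cons.IH) (simp_all add: t)
  ultimately show ?case
    using x Cons.prems(2)[of "(y, i + 1, dif A y x i a) # w"] by (simp add: t dif_in)
qed simp

text \<open>The values of \<open>F\<close> at the strings reached lie in \<open>S\<close>, where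
  \<open>h\<close> respects sums and signs. With \<open>h\<close> a differential, the action of a
  fixed element, a scalar or a bimodule map, this exchanges that operation with b.\<close>

lemma bar_hom:
  assumes "additive_on S h" and "composable A x w"
    and "\<And>u. composable A x u \<Longrightarrow> src x u = src x w \<Longrightarrow> bdeg u = bdeg w + 1 \<Longrightarrow> F u \<in> S"
  shows "bar A F x w \<in> S \<and> bar A (\<lambda>u. h (F u)) x w = h (bar A F x w)"
  using assms(2,3)
proof (induction w arbitrary: F x)
  interpret h: additive_on S h by fact
  case Nil
  then show ?case by (simp add: h.zero h.zero_mem)
next
  interpret h: additive_on S h by fact
  case (Cons t w)
  obtain y i a where t: "t = (y, i, a)" by (cases t) auto
  have x: "x \<in> Ob A" "y \<in> Ob A" "a \<in> gr A y x i" "composable A y w"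
    using Cons.prems(1) by (auto simp: t dest: composable_tgt)
  have "bar_mul A F x y i a w \<in> S \<and>
      bar_mul A (\<lambda>u. h (F u)) x y i a w = h (bar_mul A F x y i a w)"
  proof (cases w)
    case Nil
    then show ?thesis by (simp add: h.zero h.zero_mem)
  next
    case (Cons s v)
    obtain z j b where s: "s = (z, j, b)" by (cases s) auto
    show ?thesis
      using x Cons.prems(2)[of "(z, i + j, cmp A z y x i j a b) # v"]
      by (auto simp: t Cons s intro: cmp_in composable_tgt)
  qed
  moreover have "bar A (\<lambda>u. F ((y, i, a) # u)) y w \<in> S \<and>
      bar A (\<lambda>u. h (F ((y, i, a) # u))) y w = h (bar A (\<lambda>u. F ((y, i, a) # u)) y w)"
    using x Cons.prems(2) by (intro Cons.IH) (simp_all add: t)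
  moreover have "F ((y, i + 1, dif A y x i a) # w) \<in> S"
    using x Cons.prems(2)[of "(y, i + 1, dif A y x i a) # w"] by (simp add: t dif_in)
  ultimately show ?case
    by (simp add: t h.add h.sg h.sg_mem h.add_mem del: sg_simps)
qed

text \<open>Multilinearity of \<open>f\<close> is the case \<open>F = H = f\<close>, \<open>G = c f\<close>. Admitting three functions, the relation
  passes to \<open>bar\<close> by addition alone, without knowing where \<open>F\<close> takes its values.\<close>

definition slotwise ::
  "'k \<Rightarrow> 'o \<Rightarrow> (('o \<times> int \<times> 'm) list \<Rightarrow> 'v::ab_group_add) \<Rightarrow> (('o \<times> int \<times> 'm) list \<Rightarrow> 'v) \<Rightarrow>
   (('o \<times> int \<times> 'm) list \<Rightarrow> 'v) \<Rightarrow> bool" where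
  "slotwise c x F G H \<longleftrightarrow> (\<forall>u y i a b v.
     composable A x (u @ (y, i, a) # v) \<longrightarrow> composable A x (u @ (y, i, b) # v) \<longrightarrow>
     F (u @ (y, i, smul A c a + b) # v) = G (u @ (y, i, a) # v) + H (u @ (y, i, b) # v))"

lemma slotwiseD:
  "slotwise c x F G H \<Longrightarrow> composable A x (u @ (y, i, a) # v) \<Longrightarrow> composable A x (u @ (y, i, b) # v) \<Longrightarrow>
     F (u @ (y, i, smul A c a + b) # v) = G (u @ (y, i, a) # v) + H (u @ (y, i, b) # v)"
  unfolding slotwise_def by blast

lemma slotwise_Cons:
  assumes "slotwise c x F G H" "x \<in> Ob A" "a \<in> gr A y x i"
  shows "slotwise c y (\<lambda>u. F ((y, i, a) # u)) (\<lambda>u. G ((y, i, a) # u)) (\<lambda>u. H ((y, i, a) # u))"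
  unfolding slotwise_def
proof (intro allI impI)
  fix u z j b b' v
  assume "composable A y (u @ (z, j, b) # v)" "composable A y (u @ (z, j, b') # v)"
  then show "F ((y, i, a) # u @ (z, j, smul A c b + b') # v) =
      G ((y, i, a) # u @ (z, j, b) # v) + H ((y, i, a) # u @ (z, j, b') # v)"
    using slotwiseD[OF assms(1), of "(y, i, a) # u" z j b v b'] assms(2,3) by simp
qed

text \<open>In each term of b the letter in the slot is untouched, differentiated, or multiplied
  with a neighbour on one of its sides; each of these is linear in it. The cases record whether the
  slot is the first letter, the second, or a later one.\<close>

lemma slotwise_bar:
  assumes "slotwise c x F G H"
  shows "slotwise c x (bar A F x) (bar A G x) (bar A H x)"
  unfolding slotwise_def
proof (intro allI impI)
  fix u y i a b v
  assume "composable A x (u @ (y, i, a) # v)" "composable A x (u @ (y, i, b) # v)"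
  then show "bar A F x (u @ (y, i, smul A c a + b) # v) =
      bar A G x (u @ (y, i, a) # v) + bar A H x (u @ (y, i, b) # v)"
    using assms
  proof (induction u arbitrary: F G H x)
    case Nil
    then have x: "x \<in> Ob A" "y \<in> Ob A" "a \<in> gr A y x i" "b \<in> gr A y x i" "composable A y v"
      by (auto dest: composable_tgt)
    have "F ((y, i + 1, dif A y x i (smul A c a + b)) # v) =
        G ((y, i + 1, dif A y x i a) # v) + H ((y, i + 1, dif A y x i b) # v)"
      using slotwiseD[OF Nil.prems(3), of "[]" y "i + 1" "dif A y x i a" v "dif A y x i b"] x
      by (simp add: dif_in dif_add dif_smul gr_smul)
    moreover have "bar_mul A F x y i (smul A c a + b) v = bar_mul A G x y i a v + bar_mul A H x y i b v"
    proof (cases v)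
      case (Cons s r)
      obtain z j d where s: "s = (z, j, d)" by (cases s) auto
      have z: "z \<in> Ob A" "d \<in> gr A z y j" "composable A z r"
        using x(5) by (auto simp: Cons s dest: composable_tgt)
      show ?thesis
        using slotwiseD[OF Nil.prems(3), of "[]" z "i + j" "cmp A z y x i j a d" r "cmp A z y x i j b d"] x z
        by (simp add: Cons s cmp_in cmp_add_left cmp_smul_left gr_smul)
    qed simp
    \<comment> \<open>Here the slot is the fixed head and the rest of the string varies; linearity
      in the head holds for each rest separately and passes under \<open>bar\<close>
      pointwise.\<close>
    moreover have "bar A (\<lambda>u. F ((y, i, smul A c a + b) # u)) y v =
        bar A (\<lambda>u. G ((y, i, a) # u) + H ((y, i, b) # u)) y v"
      using slotwiseD[OF Nil.prems(3), of "[]"] x by (intro bar_cong) simp_all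
    ultimately show ?case by (simp add: bar_add)
  next
    case (Cons t u)
    obtain z j d where t: "t = (z, j, d)" by (cases t) auto
    have z: "x \<in> Ob A" "z \<in> Ob A" "d \<in> gr A z x j" "composable A z (u @ (y, i, a) # v)"
        "composable A z (u @ (y, i, b) # v)"
      using Cons.prems(1,2) by (auto simp: t dest: composable_tgt)
    have "F ((z, j + 1, dif A z x j d) # u @ (y, i, smul A c a + b) # v) =
        G ((z, j + 1, dif A z x j d) # u @ (y, i, a) # v) + H ((z, j + 1, dif A z x j d) # u @ (y, i, b) # v)"
      using slotwiseD[OF Cons.prems(3), of "(z, j + 1, dif A z x j d) # u"] z
      by (simp add: dif_in)
    moreover have "bar_mul A F x z j d (u @ (y, i, smul A c a + b) # v) =
        bar_mul A G x z j d (u @ (y, i, a) # v) + bar_mul A H x z j d (u @ (y, i, b) # v)"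
    proof (cases u)
      case Nil
      then have y: "y \<in> Ob A" "a \<in> gr A y z i" "b \<in> gr A y z i" "composable A y v"
        using z by (auto dest: composable_tgt)
      show ?thesis
        using slotwiseD[OF Cons.prems(3), of "[]" y "j + i" "cmp A y z x j i d a" v "cmp A y z x j i d b"] z y
        by (simp add: Nil cmp_in cmp_add_right cmp_smul_right gr_smul)
    next
      case (Cons s r)
      obtain p l e where s: "s = (p, l, e)" by (cases s) auto
      have p: "p \<in> Ob A" "e \<in> gr A p z l" "composable A p (r @ (y, i, a) # v)"
          "composable A p (r @ (y, i, b) # v)"
        using z(4,5) by (auto simp: Cons s dest: composable_tgt)
      show ?thesis
        using slotwiseD[OF Cons.prems(3), of "(p, j + l, cmp A p z x j l d e) # r"] z p
        by (simp add: Cons s cmp_in)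
    qed
    moreover note Cons.IH[OF z(4,5) slotwise_Cons[OF Cons.prems(3) z(1,3)]]
    ultimately show ?case by (simp add: t)
  qed
qed

text \<open>Scalar 1 turns the three-function relation into additivity in the first letter. This is
  what allows the Leibniz rule and d^2 = 0 to be used inside \<open>F\<close>.\<close>

lemma slotwise_head_additive:
  assumes F: "slotwise 1 x F F F" and v: "x \<in> Ob A" "composable A y v"
  shows "additive_on (gr A y x i) (\<lambda>a. F ((y, i, a) # v))"
proof
  note [simp] = v composable_tgt[OF v(2)]
  show "0 \<in> gr A y x i" by (simp add: gr_zero)
  fix a b assume a: "a \<in> gr A y x i"
  then show "- a \<in> gr A y x i" by (simp add: gr_uminus)
  assume b: "b \<in> gr A y x i"
  show "a + b \<in> gr A y x i" using a b by (simp add: gr_add)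
  show "F ((y, i, a + b) # v) = F ((y, i, a) # v) + F ((y, i, b) # v)"
    using slotwiseD[OF F, of "[]" y i a v b] a b smul_one[OF composable_tgt[OF v(2)] v(1) a] by simp
qed

text \<open>Sorting by what happens to the head: differentiated twice it gives d^2 = 0, untouched
  twice it is the induction hypothesis, and the two orders of differentiating it while changing the
  rest have opposite signs. The terms that multiply it with the next letter remain.\<close>

theorem bar_bar:
  assumes "composable A x w" "slotwise 1 x F F F"
  shows "bar A (\<lambda>u. bar A F x u) x w = 0"
  using assms
proof (induction w arbitrary: F x)
  case (Cons t w)
  obtain y i a where t: "t = (y, i, a)" by (cases t) auto
  have x: "x \<in> Ob A" "y \<in> Ob A" "a \<in> gr A y x i" "composable A y w"
    using Cons.prems(1) by (auto simp: t dest: composable_tgt)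
  interpret hd: additive_on "gr A y x (i + 1 + 1)" "\<lambda>a. F ((y, i + 1 + 1, a) # w)"
    by (rule slotwise_head_additive[OF Cons.prems(2) x(1,4)])
  have IH: "bar A (\<lambda>u. bar A (\<lambda>u. F ((y, i, a) # u)) y u) y w = 0"
    by (rule Cons.IH[OF x(4) slotwise_Cons[OF Cons.prems(2) x(1,3)]])
  \<comment> \<open>The terms that multiply the head \<open>a\<close> with the next letter b: those
    containing d(ab), (da)b and a(db) cancel by the Leibniz rule, those with a threefold product by
    associativity, and those changing letters behind ab occur twice with opposite signs.\<close>
  have claim: "sg i (bar_mul A F x y (i + 1) (dif A y x i a) w) +
      sg (i - 1) (bar_mul A (bar A F x) x y i a w) + bar A (bar_mul A F x y i a) y w = 0"
  proof (cases w)
    case (Cons s v)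
    obtain z j b where s: "s = (z, j, b)" by (cases s) auto
    have z: "z \<in> Ob A" "b \<in> gr A z y j" "composable A z v"
      using x(4) by (auto simp: Cons s dest: composable_tgt)
    interpret mul: additive_on "gr A z x (i + j + 1)" "\<lambda>a. F ((z, i + j + 1, a) # v)"
      by (rule slotwise_head_additive[OF Cons.prems(2) x(1) z(3)])
    have 1: "F ((z, i + j + 1, dif A z x (i + j) (cmp A z y x i j a b)) # v) =
        F ((z, i + j + 1, cmp A z y x (i + 1) j (dif A y x i a) b) # v) +
        sg i (F ((z, i + j + 1, cmp A z y x i (j + 1) a (dif A z y j b)) # v))"
      using x z by (simp add: cmp_dif cmp_in dif_in mul.add mul.sg mul.sg_mem)
    \<comment> \<open>Both sides put the product of the first three letters in front; with fewer
      than three letters both are 0.\<close>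
    have 2: "bar_mul A F x z (i + j) (cmp A z y x i j a b) v = bar_mul A (bar_mul A F x y i a) y z j b v"
    proof (cases v)
      case (Cons p r)
      obtain q l d where "p = (q, l, d)" by (cases p) auto
      then show ?thesis
        using x z composable_tgt[of A q r] by (simp add: Cons assoc add.assoc)
    qed simp
    have 3: "i + 1 + j = i + j + 1" "i + (j + 1) = i + j + 1" by simp_all
    show ?thesis
      by (simp add: Cons s 1 2 3) (simp add: sg_def)
  qed simp
  have "bar A (\<lambda>u. bar A F x ((y, i, a) # u)) y w =
      bar A (\<lambda>u. F ((y, i + 1, dif A y x i a) # u)) y w + sg (i - 1) (bar A (bar_mul A F x y i a) y w)"
    by (simp add: bar_add bar_sg IH)
  moreover have "F ((y, i + 1 + 1, dif A y x (i + 1) (dif A y x i a)) # w) = 0"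
    using x hd.zero by (simp add: dif_dif)
  ultimately have "bar A (\<lambda>u. bar A F x u) x ((y, i, a) # w) =
     sg i (bar_mul A F x y (i + 1) (dif A y x i a) w) +
      sg (i - 1) (bar_mul A (bar A F x) x y i a w) + bar A (bar_mul A F x y i a) y w"
    by (simp add: sg_def)
  with claim show ?case by (simp add: t)
qed simp

end

section \<open>The four terms of the Hochschild differential\<close>

fun hleft ::
  "('k, 'o, 'm::ab_group_add, 'a) dgbimod \<Rightarrow> int \<Rightarrow> ('o \<Rightarrow> ('o \<times> int \<times> 'a) list \<Rightarrow> 'm) \<Rightarrow> 'o \<Rightarrow>
   ('o \<times> int \<times> 'a) list \<Rightarrow> 'm" where
  "hleft M n f x [] = 0"
| "hleft M n f x ((y, i, a) # v) =
     sg (n * (i - 1)) (lact M (src y v) y x i (n + bdeg v) a (f y v))"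

definition hright ::
  "('k, 'o, 'm::ab_group_add, 'a) dgbimod \<Rightarrow> int \<Rightarrow> ('o \<Rightarrow> ('o \<times> int \<times> 'a) list \<Rightarrow> 'm) \<Rightarrow> 'o \<Rightarrow>
   ('o \<times> int \<times> 'a) list \<Rightarrow> 'm" where
  "hright M n f x w = (if w = [] then 0 else
     sg (n + bdeg (butlast w)) (ract M (src x w) (src x (butlast w)) x (n + bdeg (butlast w))
       (fst (snd (last w))) (f x (butlast w)) (snd (snd (last w)))))"

definition hdif ::
  "('k, 'o, 'm::ab_group_add, 'a) dgbimod \<Rightarrow> int \<Rightarrow> ('o \<Rightarrow> ('o \<times> int \<times> 'a) list \<Rightarrow> 'm) \<Rightarrow> 'o \<Rightarrow>
   ('o \<times> int \<times> 'a) list \<Rightarrow> 'm" where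
  "hdif M n f x w = dif M (src x w) x (n + bdeg w) (f x w)"

lemma hright_simps [simp]:
  "hright M n f x [] = 0"
  "hright M n f x (u @ [(y, i, a)]) =
     sg (n + bdeg u) (ract M y (src x u) x (n + bdeg u) i (f x u) a)"
  by (simp_all add: hright_def)

lemma nth_src: "(x # map fst w) ! length w = src x w"
  by (cases w rule: rev_cases) (simp_all add: nth_append src_def)

text \<open>Trades positions in a list for operators that follow its structure: \<open>bar\<close>
  and \<open>hleft\<close> take off the first letter, \<open>hright\<close> the last one.\<close>

lemma hoch_diff_eq:
  assumes "composable A x w"
  shows "hoch_diff A M n f x w =
    hdif M n f x w + sg n (bar A (f x) x w) + (hleft M n f x w - hright M n f x w)"
proof -
  have "(if length w = 0 then 0 else
       sg (n * (fst (snd (w ! 0)) - 1))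
         (lact M ((x # map fst w) ! length w) ((x # map fst w) ! 1) x (fst (snd (w ! 0)))
           (n + bdeg (tl w)) (snd (snd (w ! 0))) (f ((x # map fst w) ! 1) (tl w)))
       - sg (n + bdeg (butlast w))
         (ract M ((x # map fst w) ! length w) ((x # map fst w) ! (length w - 1)) x
           (n + bdeg (butlast w)) (fst (snd (w ! (length w - 1)))) (f x (butlast w))
           (snd (snd (w ! (length w - 1)))))) = hleft M n f x w - hright M n f x w" (is "?T = _")
  proof (cases w)
    case (Cons t v)
    obtain y i a where t: "t = (y, i, a)" by (cases t) auto
    have "(x # map fst w) ! (length w - 1) = src x (butlast w)"
      by (cases w rule: rev_cases) (simp_all add: nth_append nth_Cons src_def last_conv_nth split: nat.split)
    then show ?thesis
      unfolding nth_src using last_conv_nth[of w]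
      by (simp add: Cons t hright_def)
  qed simp
  then show ?thesis
    using assms hoch_sums_eq_bar[where w = w and n = n and F = "f x" and x = x and A = A]
    unfolding hoch_diff_def Let_def hdif_def by (simp only: not_True_eq_False if_False add.assoc)
qed

context dg_bimod
begin

lemmas mgr_zero = cochain_complex.zero_in[OF complex_bimod, unfolded cx_simps]
  and mgr_add = cochain_complex.add_in[OF complex_bimod, unfolded cx_simps]
  and mgr_diff = cochain_complex.diff_in[OF complex_bimod, unfolded cx_simps]
  and mgr_uminus = cochain_complex.uminus_in[OF complex_bimod, unfolded cx_simps]
  and mgr_smul = cochain_complex.smul_in[OF complex_bimod, unfolded cx_simps]
  and msmul_one = cochain_complex.smul_one[OF complex_bimod, unfolded cx_simps]
  and msmul_add = cochain_complex.smul_add[OF complex_bimod, unfolded cx_simps]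
  and msmul_add_left = cochain_complex.smul_add_left[OF complex_bimod, unfolded cx_simps]
  and msmul_mult = cochain_complex.smul_mult[OF complex_bimod, unfolded cx_simps]
  and mdif_in = cochain_complex.dif_in[OF complex_bimod, unfolded cx_simps]
  and mdif_dif = cochain_complex.dif_dif[OF complex_bimod, unfolded cx_simps]
  and mdif_smul = cochain_complex.dif_smul[OF complex_bimod, unfolded cx_simps]
  and additive_mdif = cochain_complex.additive_on_dif[OF complex_bimod, unfolded cx_simps]
  and lact_in = dg_pairing.pair_in[OF pairing_left, unfolded cx_simps]
  and lact_dif = dg_pairing.pair_dif[OF pairing_left, unfolded cx_simps]
  and lact_add_left = dg_pairing.add_left[OF pairing_left, unfolded cx_simps]
  and lact_add_right = dg_pairing.add_right[OF pairing_left, unfolded cx_simps]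
  and lact_smul_left = dg_pairing.smul_left[OF pairing_left, unfolded cx_simps]
  and lact_smul_right = dg_pairing.smul_right[OF pairing_left, unfolded cx_simps]
  and lact_sg_right = dg_pairing.sg_right[OF pairing_left, unfolded cx_simps]
  and lact_zero_right = dg_pairing.zero_right[OF pairing_left, unfolded cx_simps]
  and additive_lact = dg_pairing.right[OF pairing_left, unfolded cx_simps]
  and ract_in = dg_pairing.pair_in[OF pairing_right, unfolded cx_simps]
  and ract_dif = dg_pairing.pair_dif[OF pairing_right, unfolded cx_simps]
  and ract_add_left = dg_pairing.add_left[OF pairing_right, unfolded cx_simps]
  and ract_add_right = dg_pairing.add_right[OF pairing_right, unfolded cx_simps]
  and ract_smul_left = dg_pairing.smul_left[OF pairing_right, unfolded cx_simps]
  and ract_smul_right = dg_pairing.smul_right[OF pairing_right, unfolded cx_simps]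
  and ract_sg_left = dg_pairing.sg_left[OF pairing_right, unfolded cx_simps]
  and ract_zero_left = dg_pairing.zero_left[OF pairing_right, unfolded cx_simps]
  and additive_ract = dg_pairing.left[OF pairing_right, unfolded cx_simps]

lemmas mdif_add = additive_on.add[OF additive_mdif]
  and mdif_sg = additive_on.sg[OF additive_mdif]

lemma additive_msmul:
  assumes "x \<in> Ob A" "y \<in> Ob A"
  shows "additive_on (gr M x y n) (smul M c)"
  using assms by unfold_locales (auto intro: mgr_zero mgr_uminus mgr_add msmul_add)

lemma msg_in: "x \<in> Ob A \<Longrightarrow> y \<in> Ob A \<Longrightarrow> m \<in> gr M x y n \<Longrightarrow> sg e m \<in> gr M x y n"
  by (rule additive_on.sg_mem[OF additive_mdif])

text \<open>The degree condition on cochains by itself. It makes values of \<open>f\<close>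
  admissible arguments of the differential and the actions of \<open>M\<close>; linearity in the
  letters is kept apart as \<open>slotwise\<close>.\<close>

definition graded :: "int \<Rightarrow> ('o \<Rightarrow> ('o \<times> int \<times> 'a) list \<Rightarrow> 'm) \<Rightarrow> bool" where
  "graded n f \<longleftrightarrow> (\<forall>x w. composable A x w \<longrightarrow> f x w \<in> gr M (src x w) x (n + bdeg w))"

lemma gradedD:
  "graded n f \<Longrightarrow> composable A x w \<Longrightarrow> y = src x w \<Longrightarrow> k = n + bdeg w \<Longrightarrow> f x w \<in> gr M y x k"
  unfolding graded_def by blast

lemma graded_hdif:
  assumes "graded n f"
  shows "graded (n + 1) (hdif M n f)"
  unfolding graded_def hdif_def
  by (intro allI impI mdif_in gradedD[OF assms]) (auto intro: composable_src composable_tgt)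

lemma graded_bar:
  assumes "graded n f"
  shows "graded (n + 1) (\<lambda>x. bar A (f x) x)"
  unfolding graded_def
proof (intro allI impI)
  fix x w assume w: "composable A x w"
  show "bar A (f x) x w \<in> gr M (src x w) x (n + 1 + bdeg w)"
    \<comment> \<open>Of \<open>bar_hom\<close> only the membership of the value is used; the
      differential merely stands for some additive map on the component.\<close>
    by (rule bar_hom[OF additive_mdif w, THEN conjunct1])
      (use w assms in \<open>auto intro: composable_src composable_tgt gradedD\<close>)
qed

lemma graded_hleft:
  assumes "graded n f"
  shows "graded (n + 1) (hleft M n f)"
  unfolding graded_def
proof (intro allI impI)
  fix x w assume w: "composable A x w"
  show "hleft M n f x w \<in> gr M (src x w) x (n + 1 + bdeg w)"
  proof (cases w)
    case Nil
    with w show ?thesis by (simp add: mgr_zero)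
  next
    case (Cons t v)
    obtain y i a where t: "t = (y, i, a)" by (cases t) auto
    have "x \<in> Ob A" "y \<in> Ob A" "src y v \<in> Ob A" "composable A y v" "a \<in> gr A y x i"
      using w by (auto simp: Cons t dest: composable_tgt composable_src)
    then show ?thesis
      by (auto simp: Cons t intro!: msg_in lact_in gradedD[OF assms])
  qed
qed

lemma graded_hright:
  assumes "graded n f"
  shows "graded (n + 1) (hright M n f)"
  unfolding graded_def
proof (intro allI impI)
  fix x w assume w: "composable A x w"
  show "hright M n f x w \<in> gr M (src x w) x (n + 1 + bdeg w)"
  proof (cases w rule: rev_cases)
    case Nil
    with w show ?thesis by (simp add: mgr_zero)
  next
    case (snoc u t)
    obtain y i a where t: "t = (y, i, a)" by (cases t) auto
    have "x \<in> Ob A" "y \<in> Ob A" "src x u \<in> Ob A" "composable A x u" "a \<in> gr A y (src x u) i"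
      using w by (auto simp: snoc t dest: composable_tgt)
    then show ?thesis
      by (auto simp: snoc t intro!: msg_in ract_in gradedD[OF assms])
  qed
qed

lemma hleft_add:
  assumes "graded n f" "graded n g" "composable A x w"
  shows "hleft M n (\<lambda>x w. f x w + g x w) x w = hleft M n f x w + hleft M n g x w"
proof (cases w)
  case (Cons t v)
  obtain y i a where t: "t = (y, i, a)" by (cases t) auto
  have "x \<in> Ob A" "y \<in> Ob A" "src y v \<in> Ob A" "composable A y v" "a \<in> gr A y x i"
    using assms(3) by (auto simp: Cons t dest: composable_tgt composable_src)
  with assms show ?thesis
    by (simp add: Cons t lact_add_right gradedD)
qed simp

lemma hright_add:
  assumes "graded n f" "graded n g" "composable A x w"
  shows "hright M n (\<lambda>x w. f x w + g x w) x w = hright M n f x w + hright M n g x w"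
proof (cases w rule: rev_cases)
  case (snoc u t)
  obtain y i a where t: "t = (y, i, a)" by (cases t) auto
  have "x \<in> Ob A" "y \<in> Ob A" "src x u \<in> Ob A" "composable A x u" "a \<in> gr A y (src x u) i"
    using assms(3) by (auto simp: snoc t dest: composable_tgt)
  with assms show ?thesis
    by (simp add: snoc t ract_add_left gradedD)
qed simp

text \<open>By the Leibniz rule for the left action, d(a f) yields P with da and Q with df. P
  cancels the term of b that differentiates the first letter, Q cancels \<lambda> applied to df, and
  the terms R, where b changes only later letters, occur twice with opposite signs. The product of
  the first two letters cancels \<lambda>\<lambda> by associativity of the action.\<close>

lemma hoch_left:
  assumes f: "graded n f" and w: "composable A x w"
  shows "hdif M (n + 1) (hleft M n f) x w + sg (n + 1) (bar A (hleft M n f x) x w) +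
    hleft M (n + 1) (hdif M n f) x w + sg n (hleft M (n + 1) (\<lambda>x. bar A (f x) x) x w) +
    hleft M (n + 1) (hleft M n f) x w = 0"
proof (cases w)
  case Nil
  have "x \<in> Ob A" using w by (rule composable_tgt)
  then show ?thesis by (simp add: Nil hdif_def additive_on.zero[OF additive_mdif])
next
  case (Cons t v)
  obtain y i a where t: "t = (y, i, a)" by (cases t) auto
  let ?s = "src y v" and ?m = "n + bdeg v"
  have ob: "x \<in> Ob A" "y \<in> Ob A" "?s \<in> Ob A" and v: "composable A y v" and a: "a \<in> gr A y x i"
    using w by (auto simp: Cons t dest: composable_tgt composable_src)
  have fv: "f y v \<in> gr M ?s y ?m" by (rule gradedD[OF f v refl refl])
  define P where "P = lact M ?s y x (i + 1) ?m (dif A y x i a) (f y v)"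
  define Q where "Q = lact M ?s y x i (?m + 1) a (dif M ?s y ?m (f y v))"
  define R where "R = lact M ?s y x i (?m + 1) a (bar A (f y) y v)"
  have m: "n + 1 + bdeg v = ?m + 1" by simp
  have e1: "hdif M (n + 1) (hleft M n f) x w = sg (n * (i - 1)) (P + sg i Q)"
  proof -
    have "lact M ?s y x i ?m a (f y v) \<in> gr M ?s x (n + 1 + bdeg w)"
      using ob a fv by (auto simp: Cons t intro: lact_in)
    moreover have "dif M ?s x (n + 1 + bdeg w) (lact M ?s y x i ?m a (f y v)) = P + sg i Q"
      unfolding P_def Q_def using ob a fv by (intro lact_dif) (simp_all add: Cons t)
    ultimately show ?thesis
      using ob by (simp add: hdif_def Cons t mdif_sg)
  qed
  have e2: "hleft M n f x ((y, i + 1, dif A y x i a) # v) = sg (n * i) P"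
    by (simp add: P_def)
  \<comment> \<open>The strings reached have bar degree \<open>bdeg v + 1\<close> and the same
    source, so the action of \<open>a\<close> is one fixed additive map and can be taken out of
    \<open>bar\<close>.\<close>
  have e3: "bar A (\<lambda>u. hleft M n f x ((y, i, a) # u)) y v = sg (n * (i - 1)) R"
  proof -
    have "bar A (\<lambda>u. hleft M n f x ((y, i, a) # u)) y v =
        bar A (\<lambda>u. sg (n * (i - 1)) (lact M ?s y x i (?m + 1) a (f y u))) y v"
      using v by (rule bar_cong) (simp add: add.assoc)
    also have "\<dots> = sg (n * (i - 1)) R"
      unfolding bar_sg R_def
      by (subst bar_hom[OF additive_lact v, THEN conjunct2])
        (use ob a f in \<open>auto intro: gradedD\<close>)
    finally show ?thesis .
  qed
  have e4: "hleft M (n + 1) (hdif M n f) x w = sg ((n + 1) * (i - 1)) Q"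
    by (simp add: Cons t hdif_def Q_def m del: hleft.simps(1))
  have e5: "hleft M (n + 1) (\<lambda>x. bar A (f x) x) x w = sg ((n + 1) * (i - 1)) R"
    by (simp add: Cons t R_def m)
  have e6: "sg (n + 1) (sg (i - 1) (bar_mul A (hleft M n f x) x y i a v)) +
      hleft M (n + 1) (hleft M n f) x w = 0"
  proof (cases v)
    case Nil
    then show ?thesis using ob a by (simp add: Cons t lact_zero_right)
  next
    case (Cons s r)
    obtain z j b where s: "s = (z, j, b)" by (cases s) auto
    have z: "z \<in> Ob A" "b \<in> gr A z y j" "composable A z r" "src z r \<in> Ob A"
      using v by (auto simp: Cons s dest: composable_tgt composable_src)
    have fr: "f z r \<in> gr M (src z r) z (n + bdeg r)"
      by (rule gradedD[OF f z(3) refl refl])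
    have k: "n + 1 + bdeg v = j + (n + bdeg r)" by (simp add: Cons s)
    have "lact M (src z r) y x i (n + 1 + bdeg v) a (lact M (src z r) z y j (n + bdeg r) b (f z r)) =
      lact M (src z r) z x (i + j) (n + bdeg r) (cmp A z y x i j a b) (f z r)"
      using z ob a fr k by (intro lact_lact[symmetric]) simp_all
    moreover have "lact M (src z r) z y j (n + bdeg r) b (f z r) \<in> gr M (src z r) y (n + 1 + bdeg v)"
      using z ob fr k by (intro lact_in) simp_all
    ultimately show ?thesis
      using z ob a by (simp add: \<open>w = t # v\<close> t Cons s lact_sg_right sg_sg)
        (cases "even n"; cases "even i"; cases "even j"; simp add: sg_def algebra_simps)
  qed
  have "bar A (hleft M n f x) x w = sg (n * i) P +
      sg (i - 1) (bar_mul A (hleft M n f x) x y i a v + sg (n * (i - 1)) R)"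
    unfolding Cons t bar.simps e2 e3 ..
  then show ?thesis
    using e6 unfolding e1 e4 e5
    by (simp add: add_eq_0_iff)
      (cases "even n"; cases "even i"; simp add: sg_def)
qed

text \<open>The mirror image of the cancellation on the left, along \<open>bar_snoc\<close>. Since
  the differential contains -\<rho>, the terms linear in \<rho> and \<rho>\<rho> enter its square
  with opposite signs; therefore \<rho>\<rho> stands on the other side.\<close>

lemma hoch_right:
  assumes f: "graded n f" and w: "composable A x w"
  shows "hdif M (n + 1) (hright M n f) x w + sg (n + 1) (bar A (hright M n f x) x w) +
    hright M (n + 1) (hdif M n f) x w + sg n (hright M (n + 1) (\<lambda>x. bar A (f x) x) x w) =
    hright M (n + 1) (hright M n f) x w"
proof (cases w rule: rev_cases)
  case Nil
  have "x \<in> Ob A" using w by (rule composable_tgt)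
  then show ?thesis by (simp add: Nil hdif_def additive_on.zero[OF additive_mdif])
next
  case (snoc u t)
  obtain y i a where t: "t = (y, i, a)" by (cases t) auto
  let ?s = "src x u" and ?m = "n + bdeg u"
  have ob: "x \<in> Ob A" "y \<in> Ob A" "?s \<in> Ob A" and u: "composable A x u" and a: "a \<in> gr A y ?s i"
    using w by (auto simp: snoc t dest: composable_tgt)
  have fu: "f x u \<in> gr M ?s x ?m" by (rule gradedD[OF f u refl refl])
  define P where "P = ract M y ?s x (?m + 1) i (dif M ?s x ?m (f x u)) a"
  define Q where "Q = ract M y ?s x ?m (i + 1) (f x u) (dif A y ?s i a)"
  define R where "R = ract M y ?s x (?m + 1) i (bar A (f x) x u) a"
  \<comment> \<open>The term of \<open>bar_snoc\<close> that multiplies the last two letters. It is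
    what matches \<rho>\<rho>; for a single letter both are 0.\<close>
  define X where "X = (if u = [] then 0 else hright M n f x (butlast u @ [(y, fst (snd (last u)) + i,
      cmp A y (src x u) (src x (butlast u)) (fst (snd (last u))) i (snd (snd (last u))) a)]))"
  have m: "n + 1 + bdeg u = ?m + 1" by simp
  have e1: "hdif M (n + 1) (hright M n f) x w = sg ?m (P + sg ?m Q)"
  proof -
    have "ract M y ?s x ?m i (f x u) a \<in> gr M y x (n + 1 + bdeg w)"
      using ob a fu by (auto simp: snoc t intro: ract_in)
    moreover have "dif M y x (n + 1 + bdeg w) (ract M y ?s x ?m i (f x u) a) = P + sg ?m Q"
      unfolding P_def Q_def using ob a fu by (intro ract_dif) (simp_all add: snoc t)
    ultimately show ?thesis
      using ob by (simp add: hdif_def snoc t mdif_sg del: sg_simps)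
  qed
  have e2: "hright M n f x (u @ [(y, i + 1, dif A y ?s i a)]) = sg ?m Q"
    by (simp add: Q_def)
  have e3: "bar A (\<lambda>v. hright M n f x (v @ [(y, i, a)])) x u = sg (?m + 1) R"
  proof -
    have "bar A (\<lambda>v. hright M n f x (v @ [(y, i, a)])) x u =
        bar A (\<lambda>v. sg (?m + 1) (ract M y ?s x (?m + 1) i (f x v) a)) x u"
      using u by (rule bar_cong) (simp add: add.assoc)
    also have "\<dots> = sg (?m + 1) R"
      unfolding bar_sg R_def
      by (subst bar_hom[OF additive_ract u, THEN conjunct2])
        (use ob a f in \<open>auto intro: gradedD\<close>)
    finally show ?thesis .
  qed
  have e4: "hright M (n + 1) (hdif M n f) x w = sg (?m + 1) P"
    by (simp add: snoc t hdif_def P_def m)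
  have e5: "hright M (n + 1) (\<lambda>x. bar A (f x) x) x w = sg (?m + 1) R"
    by (simp add: snoc t R_def m)
  have h: "hright M (n + 1) (hright M n f) x w =
      sg (n + 1 + bdeg u) (ract M y ?s x (n + 1 + bdeg u) i (hright M n f x u) a)"
    by (simp add: snoc t)
  have e6: "hright M (n + 1) (hright M n f) x w = sg (n + 1) (sg (bdeg u) X)"
  proof (cases u rule: rev_cases)
    case Nil
    then show ?thesis using ob a by (simp add: h X_def ract_zero_left)
  next
    case (snoc u' s)
    obtain z j b where s: "s = (z, j, b)" by (cases s) auto
    have z: "z \<in> Ob A" "b \<in> gr A z (src x u') j" "composable A x u'" "src x u' \<in> Ob A"
      using u by (auto simp: snoc s dest: composable_tgt)
    have fr: "f x u' \<in> gr M (src x u') x (n + bdeg u')"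
      by (rule gradedD[OF f z(3) refl refl])
    have src_u: "src x u = z" by (simp add: snoc s)
    have k: "n + 1 + bdeg u = n + bdeg u' + j" by (simp add: snoc s)
    have "ract M y z x (n + 1 + bdeg u) i (ract M z (src x u') x (n + bdeg u') j (f x u') b) a =
      ract M y (src x u') x (n + bdeg u') (j + i) (f x u') (cmp A y z (src x u') j i b a)"
      using z ob a fr k src_u by (intro ract_ract) simp_all
    moreover have "ract M z (src x u') x (n + bdeg u') j (f x u') b \<in> gr M z x (n + 1 + bdeg u)"
      using z ob fr k by (intro ract_in) simp_all
    moreover have "hright M n f x u = sg (n + bdeg u') (ract M z (src x u') x (n + bdeg u') j (f x u') b)"
      by (simp add: snoc s)
    moreover have "X = sg (n + bdeg u')
        (ract M y (src x u') x (n + bdeg u') (j + i) (f x u') (cmp A y z (src x u') j i b a))"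
      by (simp add: X_def snoc s)
    ultimately show ?thesis
      using z ob a src_u
      unfolding h by (simp add: ract_sg_left sg_sg)
  qed
  have "bar A (hright M n f x) x w = sg (?m + 1) R + sg (bdeg u) (sg ?m Q + X)"
    unfolding snoc t bar_snoc e2 e3 X_def ..
  then show ?thesis
    unfolding e1 e4 e5 e6
    by simp (cases "even n"; cases "even (bdeg u)"; simp add: sg_def)
qed

text \<open>The two actions commute, and the signs differ by -1: applied last, \<rho> also counts
  the bar degree i - 1 of the first letter and the degree n + 1 of the cochain \<lambda>f, while
  \<lambda> applied last sees degree n + 1 in place of n.\<close>

lemma hoch_left_right:
  assumes f: "graded n f" and w: "composable A x w"
  shows "hleft M (n + 1) (hright M n f) x w + hright M (n + 1) (hleft M n f) x w = 0"
proof (cases w)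
  case (Cons t v)
  obtain y i a where t: "t = (y, i, a)" by (cases t) auto
  have ob: "x \<in> Ob A" "y \<in> Ob A" and v: "composable A y v" and a: "a \<in> gr A y x i"
    using w by (auto simp: Cons t dest: composable_tgt)
  show ?thesis
  proof (cases v rule: rev_cases)
    \<comment> \<open>A single letter cannot be consumed on both sides: the inner operator is
      evaluated at the empty string and gives 0.\<close>
    case Nil
    then show ?thesis
      using ob a hright_simps(2)[of M "n + 1" "hleft M n f" x "[]"]
      by (simp add: Cons t lact_zero_right ract_zero_left)
  next
    case (snoc u s)
    obtain z j b where s: "s = (z, j, b)" by (cases s) auto
    have z: "z \<in> Ob A" "b \<in> gr A z (src y u) j" "composable A y u" "src y u \<in> Ob A"
      using v by (auto simp: snoc s dest: composable_tgt)
    have fu: "f y u \<in> gr M (src y u) y (n + bdeg u)"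
      by (rule gradedD[OF f z(3) refl refl])
    have k: "n + 1 + bdeg v = n + bdeg u + j" "n + 1 + bdeg (t # u) = i + (n + bdeg u)"
      by (simp_all add: snoc s t)
    have 1: "ract M z (src y u) y (n + bdeg u) j (f y u) b \<in> gr M z y (n + 1 + bdeg v)"
      using z ob fu k by (intro ract_in) simp_all
    have 2: "lact M (src y u) y x i (n + bdeg u) a (f y u) \<in> gr M (src y u) x (n + 1 + bdeg (t # u))"
      using z ob a fu k by (intro lact_in) simp_all
    have 3: "ract M z (src y u) x (n + 1 + bdeg (t # u)) j (lact M (src y u) y x i (n + bdeg u) a (f y u)) b =
      lact M z y x i (n + 1 + bdeg v) a (ract M z (src y u) y (n + bdeg u) j (f y u) b)"
      using z ob a fu k by (intro lact_ract) simp_all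
    have "hright M (n + 1) (hleft M n f) x w = sg (n + 1 + bdeg (t # u)) (sg (n * (i - 1))
      (lact M z y x i (n + 1 + bdeg v) a (ract M z (src y u) y (n + bdeg u) j (f y u) b)))"
      using hright_simps(2)[of M "n + 1" "hleft M n f" x "t # u" z j b] 2 z ob
      by (simp add: Cons snoc s t ract_sg_left 3[unfolded t snoc s, simplified])
    moreover have "hleft M (n + 1) (hright M n f) x w = sg ((n + 1) * (i - 1)) (sg (n + bdeg u)
      (lact M z y x i (n + 1 + bdeg v) a (ract M z (src y u) y (n + bdeg u) j (f y u) b)))"
      using 1 ob a z by (simp add: Cons snoc s t lact_sg_right)
    ultimately show ?thesis
      by (simp add: t) (cases "even n"; cases "even i"; cases "even (bdeg u)"; simp add: sg_def)
  qed
qed simp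

end

lemma dg_bimod_hom_lin:
  assumes "dg_bimod_hom A M N \<theta>" "x \<in> Ob A" "y \<in> Ob A"
  shows "a \<in> gr M x y i \<Longrightarrow> \<theta> x y i a \<in> gr N x y i"
    and "a \<in> gr M x y i \<Longrightarrow> b \<in> gr M x y i \<Longrightarrow> \<theta> x y i (a + b) = \<theta> x y i a + \<theta> x y i b"
    and "a \<in> gr M x y i \<Longrightarrow> \<theta> x y i (smul M c a) = smul N c (\<theta> x y i a)"
    and "a \<in> gr M x y i \<Longrightarrow> k = i + 1 \<Longrightarrow> \<theta> x y k (dif M x y i a) = dif N x y i (\<theta> x y i a)"
  using dg_bimod_homD(1)[OF assms] by (simp_all add: chain_map_def lin_map_def)

section \<open>Multilinearity and the square of the differential\<close>

context dg_cat
begin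

lemma composable_slot:
  assumes "composable A x (u @ (y, i, a) # v)" "composable A x (u @ (y, i, b) # v)"
  shows "composable A x (u @ (y, i, smul A c a + b) # v)"
    and "composable A x (u @ (y, i, 0) # v)"
  using assms by (auto intro!: gr_add gr_smul gr_zero dest: composable_tgt)

text \<open>The decomposition of the differential is available on composable strings only. The
  relation looks at no others, as the linear combination in the slot is composable again.\<close>

lemma slotwise_cong:
  assumes "slotwise c x F G H"
    and "\<And>w. composable A x w \<Longrightarrow> F w = F' w" "\<And>w. composable A x w \<Longrightarrow> G w = G' w"
      "\<And>w. composable A x w \<Longrightarrow> H w = H' w"
  shows "slotwise c x F' G' H'"
  unfolding slotwise_def
proof (intro allI impI)
  fix u y i a b v
  assume w: "composable A x (u @ (y, i, a) # v)" "composable A x (u @ (y, i, b) # v)"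
  show "F' (u @ (y, i, smul A c a + b) # v) = G' (u @ (y, i, a) # v) + H' (u @ (y, i, b) # v)"
    using slotwiseD[OF assms(1) w] assms(2-4) w composable_slot(1)[OF w] by metis
qed

lemma slotwise_add:
  assumes "slotwise c x F G H" "slotwise c x F' G' H'"
  shows "slotwise c x (\<lambda>w. F w + F' w) (\<lambda>w. G w + G' w) (\<lambda>w. H w + H' w)"
  unfolding slotwise_def
  by (intro allI impI, simp only: slotwiseD[OF assms(1)] slotwiseD[OF assms(2)]) (simp add: algebra_simps)

lemma slotwise_sg:
  assumes "slotwise c x F G H"
  shows "slotwise c x (\<lambda>w. sg e (F w)) (\<lambda>w. sg e (G w)) (\<lambda>w. sg e (H w))"
  unfolding slotwise_def
  by (simp add: slotwiseD[OF assms] del: composable_append)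

lemma slotwise_diff:
  assumes "slotwise c x F G H" "slotwise c x F' G' H'"
  shows "slotwise c x (\<lambda>w. F w - F' w) (\<lambda>w. G w - G' w) (\<lambda>w. H w - H' w)"
  unfolding slotwise_def
  by (intro allI impI, simp only: slotwiseD[OF assms(1)] slotwiseD[OF assms(2)]) (simp add: algebra_simps)

end

context dg_bimod
begin

lemma graded_cochain: "f \<in> hoch_cochains A M n \<Longrightarrow> graded n f"
  by (simp add: hoch_cochains_def graded_def)

lemma cochain_in:
  "f \<in> hoch_cochains A M n \<Longrightarrow> composable A x w \<Longrightarrow> y = src x w \<Longrightarrow> k = n + bdeg w \<Longrightarrow> f x w \<in> gr M y x k"
  using gradedD graded_cochain by blast

lemma slotwise_cochain:
  assumes "f \<in> hoch_cochains A M n"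
  shows "slotwise c x (f x) (\<lambda>w. smul M c (f x w)) (f x)"
  unfolding slotwise_def
proof (intro allI impI)
  fix u y i a b v
  assume w: "composable A x (u @ (y, i, a) # v)" "composable A x (u @ (y, i, b) # v)"
  then have "composable A x (u @ (y, i, smul A c a) # v)"
    by (auto intro!: gr_smul dest: composable_tgt)
  then show "f x (u @ (y, i, smul A c a + b) # v) = smul M c (f x (u @ (y, i, a) # v)) + f x (u @ (y, i, b) # v)"
    using assms w unfolding hoch_cochains_def mem_Collect_eq by metis
qed

lemma slotwise_one_cochain:
  assumes "f \<in> hoch_cochains A M n"
  shows "slotwise 1 x (f x) (f x) (f x)"
proof (rule slotwise_cong[OF slotwise_cochain[OF assms, of 1]])
  show "smul M 1 (f x w) = f x w" if "composable A x w" for w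
    using msmul_one[OF composable_src composable_tgt cochain_in[OF assms]] that by blast
qed simp_all

text \<open>The single relation yields both linearity conditions: scalar 1 gives additivity, and the
  second letter 0 gives homogeneity once strings with a zero letter are known to be sent to
  0.\<close>

lemma hoch_cochainsI:
  assumes "\<And>x w. \<not> composable A x w \<Longrightarrow> f x w = 0" and "graded n f"
    and lin: "\<And>c x. slotwise c x (f x) (\<lambda>w. smul M c (f x w)) (f x)"
  shows "f \<in> hoch_cochains A M n"
  unfolding hoch_cochains_def mem_Collect_eq
proof (intro conjI allI impI)
  fix x u y i a b v
  assume "composable A x (u @ (y, i, a) # v) \<and> composable A x (u @ (y, i, b) # v)"
  then have w: "composable A x (u @ (y, i, a) # v)" "composable A x (u @ (y, i, b) # v)" by simp_all
  have "a \<in> gr A y (src x u) i" "y \<in> Ob A" "src x u \<in> Ob A"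
    using w(1) by (auto dest: composable_tgt)
  then have "smul A 1 a = a" using smul_one by blast
  moreover have "smul M 1 (f x (u @ (y, i, a) # v)) = f x (u @ (y, i, a) # v)"
    using msmul_one[OF composable_src composable_tgt gradedD[OF assms(2) w(1) refl refl]] w(1) by blast
  ultimately show "f x (u @ (y, i, a + b) # v) = f x (u @ (y, i, a) # v) + f x (u @ (y, i, b) # v)"
    using slotwiseD[OF lin[of 1 x] w] by simp
next
  fix x u y i a v c
  assume w: "composable A x (u @ (y, i, a) # v)"
  have a: "a \<in> gr A y (src x u) i" "y \<in> Ob A" "src x u \<in> Ob A"
    using w by (auto dest: composable_tgt)
  note w0 = composable_slot(2)[OF w w]
  have 0: "smul A 1 0 = 0" using smul_one[OF a(2,3) gr_zero[OF a(2,3)]] .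
  have "smul M 1 (f x (u @ (y, i, 0) # v)) = f x (u @ (y, i, 0) # v)"
    using msmul_one[OF composable_src composable_tgt gradedD[OF assms(2) w0 refl refl]] w0 by blast
  \<comment> \<open>With scalar 1 and both letters 0 the relation says that this value equals twice
    itself.\<close>
  then have "f x (u @ (y, i, 0) # v) = 0"
    using slotwiseD[OF lin[of 1 x] w0 w0] by (simp add: 0)
  then show "f x (u @ (y, i, smul A c a) # v) = smul M c (f x (u @ (y, i, a) # v))"
    using slotwiseD[OF lin[of c x] w w0] by simp
qed (use assms in \<open>simp_all add: graded_def\<close>)

lemma slotwise_hdif:
  assumes f: "f \<in> hoch_cochains A M n"
  shows "slotwise c x (hdif M n f x) (\<lambda>w. smul M c (hdif M n f x w)) (hdif M n f x)"
  unfolding slotwise_def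
proof (intro allI impI)
  fix u y i a b v
  assume w: "composable A x (u @ (y, i, a) # v)" "composable A x (u @ (y, i, b) # v)"
  have ob: "src y v \<in> Ob A" "x \<in> Ob A"
    using composable_src[OF w(1)] composable_tgt[OF w(1)] by simp_all
  show "hdif M n f x (u @ (y, i, smul A c a + b) # v) =
      smul M c (hdif M n f x (u @ (y, i, a) # v)) + hdif M n f x (u @ (y, i, b) # v)"
    using cochain_in[OF f w(1) refl refl] cochain_in[OF f w(2) refl refl] ob
    by (simp add: hdif_def slotwiseD[OF slotwise_cochain[OF f] w] mdif_add mdif_smul mgr_smul)
qed

text \<open>Either the slot is the letter that acts, and linearity is that of the action in the
  category element, or it lies in the argument of \<open>f\<close>, and linearity is that of the
  action in the module element.\<close>

lemma slotwise_hleft: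
  assumes f: "f \<in> hoch_cochains A M n"
  shows "slotwise c x (hleft M n f x) (\<lambda>w. smul M c (hleft M n f x w)) (hleft M n f x)"
  unfolding slotwise_def
proof (intro allI impI)
  fix u y i a b v
  assume w: "composable A x (u @ (y, i, a) # v)" "composable A x (u @ (y, i, b) # v)"
  have ob: "src y v \<in> Ob A" "y \<in> Ob A" "x \<in> Ob A" "composable A y v"
    using composable_src[OF w(1)] composable_tgt[OF w(1)] w(1) by (auto dest: composable_tgt)
  show "hleft M n f x (u @ (y, i, smul A c a + b) # v) =
      smul M c (hleft M n f x (u @ (y, i, a) # v)) + hleft M n f x (u @ (y, i, b) # v)"
  proof (cases u)
    case Nil
    then have a: "a \<in> gr A y x i" "b \<in> gr A y x i" using w by auto
    have "f y v \<in> gr M (src y v) y (n + bdeg v)" by (rule cochain_in[OF f ob(4) refl refl])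
    then show ?thesis
      using ob a additive_on.sg[OF additive_msmul[OF ob(1,3)] lact_in[OF ob(1,2,3) _ _ refl]]
      by (simp add: Nil lact_add_left lact_smul_left gr_smul)
  next
    case (Cons t u')
    obtain z j d where t: "t = (z, j, d)" by (cases t) auto
    have z: "d \<in> gr A z x j" "z \<in> Ob A" "composable A z (u' @ (y, i, a) # v)"
        "composable A z (u' @ (y, i, b) # v)"
      using w by (auto simp: Cons t dest: composable_tgt)
    show ?thesis
      using ob z cochain_in[OF f z(3) refl refl] cochain_in[OF f z(4) refl refl]
        additive_on.sg[OF additive_msmul[OF ob(1,3)] lact_in[OF ob(1) z(2) ob(3) _ _ refl]]
      by (simp add: Cons t slotwiseD[OF slotwise_cochain[OF f] z(3,4)] lact_add_right lact_smul_right mgr_smul)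
  qed
qed

lemma slotwise_hright:
  assumes f: "f \<in> hoch_cochains A M n"
  shows "slotwise c x (hright M n f x) (\<lambda>w. smul M c (hright M n f x w)) (hright M n f x)"
  unfolding slotwise_def
proof (intro allI impI)
  fix u y i a b v
  assume w: "composable A x (u @ (y, i, a) # v)" "composable A x (u @ (y, i, b) # v)"
  have ob: "y \<in> Ob A" "x \<in> Ob A" "src x u \<in> Ob A" "composable A x u" "composable A y v"
    using composable_tgt[OF w(1)] w(1) by (auto dest: composable_tgt)
  show "hright M n f x (u @ (y, i, smul A c a + b) # v) =
      smul M c (hright M n f x (u @ (y, i, a) # v)) + hright M n f x (u @ (y, i, b) # v)"
  proof (cases v rule: rev_cases)
    case Nil
    then have a: "a \<in> gr A y (src x u) i" "b \<in> gr A y (src x u) i" using w by auto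
    have "f x u \<in> gr M (src x u) x (n + bdeg u)" by (rule cochain_in[OF f ob(4) refl refl])
    then show ?thesis
      using ob a additive_on.sg[OF additive_msmul[OF ob(1,2)] ract_in[OF ob(1,3,2) _ _ refl]]
      by (simp add: Nil ract_add_right ract_smul_right gr_smul)
  next
    case (snoc v' t)
    obtain z j d where t: "t = (z, j, d)" by (cases t) auto
    have z: "d \<in> gr A z (src y v') j" "z \<in> Ob A" "src y v' \<in> Ob A" "composable A x (u @ (y, i, a) # v')"
        "composable A x (u @ (y, i, b) # v')"
      using w by (auto simp: snoc t dest: composable_tgt)
    have R: "hright M n f x (u @ (y, i, e) # v) =
        sg (n + bdeg (u @ (y, i, e) # v')) (ract M z (src y v') x (n + bdeg (u @ (y, i, e) # v')) j
          (f x (u @ (y, i, e) # v')) d)" for e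
      using hright_simps(2)[of M n f x "u @ (y, i, e) # v'" z j d] by (simp add: snoc t)
    show ?thesis
      using ob z cochain_in[OF f z(4) refl refl] cochain_in[OF f z(5) refl refl]
        additive_on.sg[OF additive_msmul[OF z(2) ob(2)] ract_in[OF z(2,3) ob(2) _ _ refl]]
      by (simp add: R slotwiseD[OF slotwise_cochain[OF f] z(4,5)] ract_add_left ract_smul_left mgr_smul)
  qed
qed

lemma hoch_diff_parts_in:
  assumes "graded n f" "composable A x w"
  shows "hdif M n f x w \<in> gr M (src x w) x (n + 1 + bdeg w)"
    "bar A (f x) x w \<in> gr M (src x w) x (n + 1 + bdeg w)"
    "hleft M n f x w \<in> gr M (src x w) x (n + 1 + bdeg w)"
    "hright M n f x w \<in> gr M (src x w) x (n + 1 + bdeg w)"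
  using graded_hdif graded_bar graded_hleft graded_hright assms unfolding graded_def by blast+

lemma graded_add: "graded n f \<Longrightarrow> graded n g \<Longrightarrow> graded n (\<lambda>x w. f x w + g x w)"
  unfolding graded_def by (auto intro: mgr_add composable_src composable_tgt)

lemma graded_sg: "graded n f \<Longrightarrow> graded n (\<lambda>x w. sg e (f x w))"
  unfolding graded_def by (auto intro: msg_in composable_src composable_tgt)

lemma hleft_cong:
  assumes "\<And>x w. composable A x w \<Longrightarrow> f x w = g x w" "composable A x w"
  shows "hleft M n f x w = hleft M n g x w"
  using assms by (cases w) auto

lemma hright_cong:
  assumes "\<And>x w. composable A x w \<Longrightarrow> f x w = g x w" "composable A x w"
  shows "hright M n f x w = hright M n g x w"
  using assms by (cases w rule: rev_cases) auto

lemma hleft_sg: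
  assumes "graded n f" "composable A x w"
  shows "hleft M n (\<lambda>x w. sg e (f x w)) x w = sg e (hleft M n f x w)"
proof (cases w)
  case (Cons t v)
  obtain y i a where t: "t = (y, i, a)" by (cases t) auto
  have "x \<in> Ob A" "y \<in> Ob A" "src y v \<in> Ob A" "composable A y v" "a \<in> gr A y x i"
    using assms(2) by (auto simp: Cons t dest: composable_tgt composable_src)
  with assms show ?thesis
    by (simp add: Cons t lact_sg_right gradedD sg_sg add.commute)
qed simp

lemma hright_sg:
  assumes "graded n f" "composable A x w"
  shows "hright M n (\<lambda>x w. sg e (f x w)) x w = sg e (hright M n f x w)"
proof (cases w rule: rev_cases)
  case (snoc u t)
  obtain y i a where t: "t = (y, i, a)" by (cases t) auto
  have "x \<in> Ob A" "y \<in> Ob A" "src x u \<in> Ob A" "composable A x u" "a \<in> gr A y (src x u) i"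
    using assms(2) by (auto simp: snoc t dest: composable_tgt)
  with assms show ?thesis
    by (simp add: snoc t ract_sg_left gradedD sg_sg add.commute)
qed simp

lemma graded_hoch_diff:
  assumes "graded n f"
  shows "graded (n + 1) (hoch_diff A M n f)"
  unfolding graded_def
proof (intro allI impI)
  fix x w assume w: "composable A x w"
  show "hoch_diff A M n f x w \<in> gr M (src x w) x (n + 1 + bdeg w)"
    unfolding hoch_diff_eq[OF w]
    using hoch_diff_parts_in[OF assms w] composable_src[OF w] composable_tgt[OF w]
    by (simp add: mgr_add mgr_diff msg_in)
qed

lemma hoch_diff_in:
  assumes f: "f \<in> hoch_cochains A M n"
  shows "hoch_diff A M n f \<in> hoch_cochains A M (n + 1)"
proof (rule hoch_cochainsI)
  show "hoch_diff A M n f x w = 0" if "\<not> composable A x w" for x w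
    using that by (simp add: hoch_diff_def)
  note gf = graded_cochain[OF f]
  show "graded (n + 1) (hoch_diff A M n f)"
    by (rule graded_hoch_diff[OF gf])
  fix c x
  \<comment> \<open>The middle function contains \<open>bar\<close> applied to c f, since
    \<open>slotwise_bar\<close> works termwise; multiplication by c is pulled out afterwards, being
    additive on the component.\<close>
  have "slotwise c x
     (\<lambda>w. hdif M n f x w + sg n (bar A (f x) x w) + (hleft M n f x w - hright M n f x w))
     (\<lambda>w. smul M c (hdif M n f x w) + sg n (bar A (\<lambda>w. smul M c (f x w)) x w) +
        (smul M c (hleft M n f x w) - smul M c (hright M n f x w)))
     (\<lambda>w. hdif M n f x w + sg n (bar A (f x) x w) + (hleft M n f x w - hright M n f x w))"
    by (intro slotwise_add slotwise_diff slotwise_sg slotwise_hdif[OF f] slotwise_hleft[OF f]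
        slotwise_hright[OF f] slotwise_bar slotwise_cochain[OF f])
  then show "slotwise c x (hoch_diff A M n f x) (\<lambda>w. smul M c (hoch_diff A M n f x w)) (hoch_diff A M n f x)"
  proof (rule slotwise_cong)
    fix w assume w: "composable A x w"
    note ob = composable_src[OF w] composable_tgt[OF w]
    interpret S: additive_on "gr M (src x w) x (n + 1 + bdeg w)" "smul M c"
      by (rule additive_msmul[OF ob])
    have "bar A (\<lambda>w. smul M c (f x w)) x w = smul M c (bar A (f x) x w)"
      by (rule bar_hom[OF S.additive_on_axioms w, THEN conjunct2]) (auto intro: gradedD[OF gf])
    then show "smul M c (hdif M n f x w) + sg n (bar A (\<lambda>w. smul M c (f x w)) x w) +
        (smul M c (hleft M n f x w) - smul M c (hright M n f x w)) = smul M c (hoch_diff A M n f x w)"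
      unfolding hoch_diff_eq[OF w]
      using hoch_diff_parts_in[OF gf w] ob
      by (simp add: S.add S.diff S.sg mgr_add mgr_diff msg_in del: sg_simps)
  qed (simp_all add: hoch_diff_eq)
qed

theorem hoch_diff_hoch_diff:
  assumes f: "f \<in> hoch_cochains A M n"
  shows "hoch_diff A M (n + 1) (hoch_diff A M n f) = 0"
proof (intro ext)
  fix x w
  show "hoch_diff A M (n + 1) (hoch_diff A M n f) x w = 0 x w"
  proof (cases "composable A x w")
    case False
    then show ?thesis by (simp add: hoch_diff_def)
  next
    case w: True
    note gf = graded_cochain[OF f]
    note ob = composable_src[OF w] composable_tgt[OF w]
    let ?B = "\<lambda>x. bar A (f x) x"
    \<comment> \<open>The summand -\<rho>f is written with \<open>sg 1\<close>, so that additivity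
      and compatibility with signs of \<open>hleft\<close> and \<open>hright\<close> cover
      differences too.\<close>
    let ?g = "\<lambda>x w. hdif M n f x w + sg n (?B x w) + (hleft M n f x w + sg 1 (hright M n f x w))"
    note parts = hoch_diff_parts_in[OF gf]
    interpret d: additive_on "gr M (src x w) x (n + 1 + bdeg w)" "dif M (src x w) x (n + 1 + bdeg w)"
      by (rule additive_mdif[OF ob])
    have k: "n + 1 + bdeg w = n + bdeg w + 1" by simp
    have "f x w \<in> gr M (src x w) x (n + bdeg w)" by (rule gradedD[OF gf w refl refl])
    then have dd: "dif M (src x w) x (n + 1 + bdeg w) (hdif M n f x w) = 0"
      unfolding hdif_def using ob by (intro mdif_dif) simp_all
    have D: "hdif M (n + 1) (hoch_diff A M n f) x w = sg n (hdif M (n + 1) ?B x w) +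
        (hdif M (n + 1) (hleft M n f) x w - hdif M (n + 1) (hright M n f) x w)"
      unfolding hdif_def[of M "n + 1"] hoch_diff_eq[OF w]
      using parts[OF w] dd by (simp add: d.add d.diff d.sg d.sg_mem d.add_mem mgr_diff ob del: sg_simps)
    \<comment> \<open>On the strings reached by \<open>bar\<close>, df is a fixed differential
      applied to the values of \<open>f\<close>, hence exchanges with b; the term with b twice
      vanishes.\<close>
    have "bar A (hoch_diff A M n f x) x w = bar A (\<lambda>u. dif M (src x w) x (n + 1 + bdeg w) (f x u) +
        sg n (?B x u) + (hleft M n f x u - hright M n f x u)) x w"
      using w by (rule bar_cong) (simp add: hoch_diff_eq hdif_def algebra_simps)
    also have "bar A (\<lambda>u. dif M (src x w) x (n + 1 + bdeg w) (f x u)) x w = hdif M (n + 1) ?B x w"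
      unfolding hdif_def
      by (rule bar_hom[OF additive_mdif[OF ob] w, THEN conjunct2]) (auto intro: gradedD[OF gf])
    then have "bar A (\<lambda>u. dif M (src x w) x (n + 1 + bdeg w) (f x u) +
        sg n (?B x u) + (hleft M n f x u - hright M n f x u)) x w =
        hdif M (n + 1) ?B x w + (bar A (hleft M n f x) x w - bar A (hright M n f x) x w)"
      by (simp add: bar_add bar_diff bar_sg bar_bar[OF w slotwise_one_cochain[OF f]])
    finally have B: "bar A (hoch_diff A M n f x) x w =
        hdif M (n + 1) ?B x w + (bar A (hleft M n f x) x w - bar A (hright M n f x) x w)" .
    have g: "hoch_diff A M n f y v = ?g y v" if "composable A y v" for y v
      unfolding hoch_diff_eq[OF that] by (simp add: sg_def)
    have gr: "graded (n + 1) (\<lambda>x w. hdif M n f x w + sg n (?B x w))"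
      "graded (n + 1) (\<lambda>x w. hleft M n f x w + sg 1 (hright M n f x w))"
      "graded (n + 1) (\<lambda>x w. sg n (?B x w))" "graded (n + 1) (\<lambda>x w. sg 1 (hright M n f x w))"
      using graded_hdif[OF gf] graded_bar[OF gf] graded_hleft[OF gf] graded_hright[OF gf]
      by (auto intro!: graded_add graded_sg)
    have L0: "hleft M (n + 1) (hoch_diff A M n f) x w = hleft M (n + 1) ?g x w"
      by (rule hleft_cong[OF g w])
    have L: "hleft M (n + 1) (hoch_diff A M n f) x w =
        hleft M (n + 1) (hdif M n f) x w + sg n (hleft M (n + 1) ?B x w) +
        (hleft M (n + 1) (hleft M n f) x w - hleft M (n + 1) (hright M n f) x w)"
      unfolding L0 hleft_add[OF gr(1,2) w] hleft_add[OF graded_hdif[OF gf] gr(3) w]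
        hleft_add[OF graded_hleft[OF gf] gr(4) w] hleft_sg[OF graded_bar[OF gf] w]
        hleft_sg[OF graded_hright[OF gf] w]
      by (simp add: sg_def)
    have R0: "hright M (n + 1) (hoch_diff A M n f) x w = hright M (n + 1) ?g x w"
      by (rule hright_cong[OF g w])
    have R: "hright M (n + 1) (hoch_diff A M n f) x w =
        hright M (n + 1) (hdif M n f) x w + sg n (hright M (n + 1) ?B x w) +
        (hright M (n + 1) (hleft M n f) x w - hright M (n + 1) (hright M n f) x w)"
      unfolding R0 hright_add[OF gr(1,2) w] hright_add[OF graded_hdif[OF gf] gr(3) w]
        hright_add[OF graded_hleft[OF gf] gr(4) w] hright_sg[OF graded_bar[OF gf] w]
        hright_sg[OF graded_hright[OF gf] w]
      by (simp add: sg_def)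
    have minus: "sg (n + 1) z = - sg n z" for z :: 'm by (simp add: sg_def)
    \<comment> \<open>The two occurrences of d(f b) carry the signs of n and n + 1 and cancel. What
      is left falls into the three groups of the left terms, the right terms and the mixed
      terms.\<close>
    have "hoch_diff A M (n + 1) (hoch_diff A M n f) x w =
      (hdif M (n + 1) (hleft M n f) x w + sg (n + 1) (bar A (hleft M n f x) x w) +
        hleft M (n + 1) (hdif M n f) x w + sg n (hleft M (n + 1) ?B x w) +
        hleft M (n + 1) (hleft M n f) x w) -
      (hdif M (n + 1) (hright M n f) x w + sg (n + 1) (bar A (hright M n f x) x w) +
        hright M (n + 1) (hdif M n f) x w + sg n (hright M (n + 1) ?B x w) -
        hright M (n + 1) (hright M n f) x w) -
      (hleft M (n + 1) (hright M n f) x w + hright M (n + 1) (hleft M n f) x w)"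
      unfolding hoch_diff_eq[OF w] D B L R minus by (simp add: algebra_simps)
    then show ?thesis
      unfolding hoch_left[OF gf w] hoch_right[OF gf w] hoch_left_right[OF gf w] by simp
  qed
qed

end

section \<open>Functoriality in the coefficients\<close>

lemma hoch_simps [simp]:
  "cgr (hoch A M) = hoch_cochains A M" "cdif (hoch A M) = hoch_diff A M"
  by (simp_all add: hoch_def)

text \<open>Scalars act by postcomposition with a bimodule endomorphism, so their compatibility with
  the Hochschild differential becomes an instance of functoriality.\<close>

lemma csmul_hoch: "csmul (hoch A M) c f = hoch_map A (\<lambda>x y i. smul M c) n f"
  by (simp add: hoch_def hoch_map_def fun_eq_iff)

text \<open>Degreewise linearity suffices to produce cochains; this covers bimodule maps and also
  the linear section used for lifting.\<close>

lemma hoch_map_in_lin: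
  assumes "dg_bimod A M" "dg_bimod A N"
    and lin: "\<And>x y i. x \<in> Ob A \<Longrightarrow> y \<in> Ob A \<Longrightarrow> lin_map (grm M x y i) (grm N x y i) (\<theta> x y i)"
    and f: "f \<in> hoch_cochains A M n"
  shows "hoch_map A \<theta> n f \<in> hoch_cochains A N n"
proof -
  interpret M: dg_bimod A M by fact
  interpret N: dg_bimod A N by fact
  have hom_in: "\<theta> x y i a \<in> gr N x y i"
    and hom_smul: "\<theta> x y i (smul M c a) = smul N c (\<theta> x y i a)"
    if "x \<in> Ob A" "y \<in> Ob A" "a \<in> gr M x y i" for x y i a c
    using lin[OF that(1,2)] that(3) by (simp_all add: lin_map_def)
  have hom_add: "\<theta> x y i (a + b) = \<theta> x y i a + \<theta> x y i b"
    if "x \<in> Ob A" "y \<in> Ob A" "a \<in> gr M x y i" "b \<in> gr M x y i" for x y i a b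
    using lin[OF that(1,2)] that(3,4) by (simp add: lin_map_def)
  show ?thesis
  proof (rule N.hoch_cochainsI)
    show "N.graded n (hoch_map A \<theta> n f)"
      unfolding N.graded_def
      using M.cochain_in[OF f] composable_src composable_tgt by (auto simp: hoch_map_def intro!: hom_in)
    fix c x
    show "M.slotwise c x (hoch_map A \<theta> n f x) (\<lambda>w. smul N c (hoch_map A \<theta> n f x w)) (hoch_map A \<theta> n f x)"
      unfolding M.slotwise_def
    proof (intro allI impI)
      fix u y i a b v
      assume w: "composable A x (u @ (y, i, a) # v)" "composable A x (u @ (y, i, b) # v)"
      have ob: "src y v \<in> Ob A" "x \<in> Ob A"
        using composable_src[OF w(1)] composable_tgt[OF w(1)] by simp_all
      show "hoch_map A \<theta> n f x (u @ (y, i, smul A c a + b) # v) =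
          smul N c (hoch_map A \<theta> n f x (u @ (y, i, a) # v)) + hoch_map A \<theta> n f x (u @ (y, i, b) # v)"
        using M.cochain_in[OF f w(1) refl refl] M.cochain_in[OF f w(2) refl refl] ob w M.composable_slot(1)[OF w]
        by (simp add: hoch_map_def M.slotwiseD[OF M.slotwise_cochain[OF f] w] hom_add hom_smul M.mgr_smul
            del: composable_append)
    qed
  qed (simp add: hoch_map_def)
qed

locale bimod_hom = M: dg_bimod A M + N: dg_bimod A N
  for A :: "('k::field, 'o, 'a::ab_group_add) dgcat" and M :: "('k, 'o, 'm::ab_group_add, 'a) dgbimod"
    and N :: "('k, 'o, 'n::ab_group_add, 'a) dgbimod" +
  fixes \<theta> :: "'o \<Rightarrow> 'o \<Rightarrow> int \<Rightarrow> 'm \<Rightarrow> 'n"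
  assumes hom: "dg_bimod_hom A M N \<theta>"
begin

lemmas hom_in = dg_bimod_hom_lin(1)[OF hom]
  and hom_add = dg_bimod_hom_lin(2)[OF hom]
  and hom_smul = dg_bimod_hom_lin(3)[OF hom]
  and hom_dif = dg_bimod_hom_lin(4)[OF hom]
  and hom_lact = dg_bimod_homD(2)[OF hom]
  and hom_ract = dg_bimod_homD(3)[OF hom]

lemma additive_hom: "x \<in> Ob A \<Longrightarrow> y \<in> Ob A \<Longrightarrow> additive_on (gr M x y i) (\<theta> x y i)"
  by unfold_locales (auto intro: M.mgr_zero M.mgr_add M.mgr_uminus hom_add)

lemma lin_hom: "x \<in> Ob A \<Longrightarrow> y \<in> Ob A \<Longrightarrow> lin_map (grm M x y i) (grm N x y i) (\<theta> x y i)"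
  using dg_bimod_homD(1)[OF hom] by (simp add: chain_map_def)

lemma hoch_map_in: "f \<in> hoch_cochains A M n \<Longrightarrow> hoch_map A \<theta> n f \<in> hoch_cochains A N n"
  by (rule hoch_map_in_lin[OF M.dg_bimod_axioms N.dg_bimod_axioms lin_hom])

text \<open>Each of the four terms is respected separately: \<open>bar\<close> because the bimodule
  map in the fixed degree n + 1 + bdeg w is additive, the others because it commutes with the
  differentials and both actions.\<close>

lemma hoch_map_diff:
  assumes f: "f \<in> hoch_cochains A M n"
  shows "hoch_map A \<theta> (n + 1) (hoch_diff A M n f) = hoch_diff A N n (hoch_map A \<theta> n f)"
proof (intro ext)
  fix x w
  show "hoch_map A \<theta> (n + 1) (hoch_diff A M n f) x w = hoch_diff A N n (hoch_map A \<theta> n f) x w"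
  proof (cases "composable A x w")
    case False
    then show ?thesis by (simp add: hoch_diff_def hoch_map_def)
  next
    case w: True
    note gf = M.graded_cochain[OF f]
    note ob = composable_src[OF w] composable_tgt[OF w]
    interpret h: additive_on "gr M (src x w) x (n + 1 + bdeg w)" "\<theta> (src x w) x (n + 1 + bdeg w)"
      by (rule additive_hom[OF ob])
    have fw: "f x w \<in> gr M (src x w) x (n + bdeg w)" by (rule M.gradedD[OF gf w refl refl])
    have D: "\<theta> (src x w) x (n + 1 + bdeg w) (hdif M n f x w) = hdif N n (hoch_map A \<theta> n f) x w"
      using w ob fw by (simp add: hdif_def hoch_map_def hom_dif)
    have "bar A (hoch_map A \<theta> n f x) x w = bar A (\<lambda>u. \<theta> (src x w) x (n + 1 + bdeg w) (f x u)) x w"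
      using w by (rule M.bar_cong) (simp add: hoch_map_def algebra_simps)
    also have "\<dots> = \<theta> (src x w) x (n + 1 + bdeg w) (bar A (f x) x w)"
      by (rule M.bar_hom[OF h.additive_on_axioms w, THEN conjunct2]) (auto intro: M.gradedD[OF gf])
    finally have B: "bar A (hoch_map A \<theta> n f x) x w = \<theta> (src x w) x (n + 1 + bdeg w) (bar A (f x) x w)" .
    have L: "\<theta> (src x w) x (n + 1 + bdeg w) (hleft M n f x w) = hleft N n (hoch_map A \<theta> n f) x w"
    proof (cases w)
      case Nil
      then show ?thesis using h.zero by simp
    next
      case (Cons t v)
      obtain y i a where t: "t = (y, i, a)" by (cases t) auto
      have y: "y \<in> Ob A" "src y v \<in> Ob A" "composable A y v" "a \<in> gr A y x i"
        using w by (auto simp: Cons t dest: composable_tgt composable_src)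
      have fv: "f y v \<in> gr M (src y v) y (n + bdeg v)" by (rule M.gradedD[OF gf y(3) refl refl])
      have k: "n + 1 + bdeg w = i + (n + bdeg v)" "src x w = src y v" by (simp_all add: Cons t)
      have "\<theta> (src y v) x (n + 1 + bdeg w) (lact M (src y v) y x i (n + bdeg v) a (f y v)) =
          lact N (src y v) y x i (n + bdeg v) a (\<theta> (src y v) y (n + bdeg v) (f y v))"
        using y ob fv k by (intro hom_lact) simp_all
      moreover have "lact M (src y v) y x i (n + bdeg v) a (f y v) \<in> gr M (src x w) x (n + 1 + bdeg w)"
        unfolding k using y ob fv by (intro M.lact_in) simp_all
      ultimately show ?thesis
        using h.sg y(3) k(2) by (simp add: Cons t hoch_map_def)
    qed
    have R: "\<theta> (src x w) x (n + 1 + bdeg w) (hright M n f x w) = hright N n (hoch_map A \<theta> n f) x w"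
    proof (cases w rule: rev_cases)
      case Nil
      then show ?thesis using h.zero by simp
    next
      case (snoc u t)
      obtain y i a where t: "t = (y, i, a)" by (cases t) auto
      have y: "y \<in> Ob A" "src x u \<in> Ob A" "composable A x u" "a \<in> gr A y (src x u) i"
        using w by (auto simp: snoc t dest: composable_tgt)
      have fu: "f x u \<in> gr M (src x u) x (n + bdeg u)" by (rule M.gradedD[OF gf y(3) refl refl])
      have k: "n + 1 + bdeg w = n + bdeg u + i" "src x w = y" by (simp_all add: snoc t)
      have "\<theta> y x (n + 1 + bdeg w) (ract M y (src x u) x (n + bdeg u) i (f x u) a) =
          ract N y (src x u) x (n + bdeg u) i (\<theta> (src x u) x (n + bdeg u) (f x u)) a"
        using y ob fu k by (intro hom_ract) simp_all
      moreover have "ract M y (src x u) x (n + bdeg u) i (f x u) a \<in> gr M (src x w) x (n + 1 + bdeg w)"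
        unfolding k using y ob fu by (intro M.ract_in) simp_all
      ultimately show ?thesis
        using h.sg y(3) k(2) by (simp add: snoc t hoch_map_def)
    qed
    have "hoch_map A \<theta> (n + 1) (hoch_diff A M n f) x w =
        \<theta> (src x w) x (n + 1 + bdeg w) (hdif M n f x w) +
        sg n (\<theta> (src x w) x (n + 1 + bdeg w) (bar A (f x) x w)) +
        (\<theta> (src x w) x (n + 1 + bdeg w) (hleft M n f x w) -
         \<theta> (src x w) x (n + 1 + bdeg w) (hright M n f x w))"
      using w M.hoch_diff_parts_in[OF gf w] ob
      by (simp add: hoch_map_def hoch_diff_eq[OF w] h.add h.diff h.sg M.mgr_add M.mgr_diff M.msg_in
          del: sg_simps)
    then show ?thesis
      unfolding hoch_diff_eq[OF w] D B L R .
  qed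
qed

end

context dg_bimod
begin

text \<open>Commutativity of the field makes multiplication by a fixed scalar linear; it commutes
  with the actions because these are bilinear.\<close>

lemma bimod_hom_smul: "bimod_hom A M M (\<lambda>x y i. smul M c)"
proof (intro bimod_hom.intro bimod_hom_axioms.intro dg_bimod_axioms)
  have "smul M c (smul M d m) = smul M d (smul M c m)" if "x \<in> Ob A" "y \<in> Ob A" "m \<in> gr M x y i" for x y i d m
    using msmul_mult[OF that, of c d] msmul_mult[OF that, of d c] by (simp add: mult.commute)
  then show "dg_bimod_hom A M M (\<lambda>x y i. smul M c)"
    unfolding dg_bimod_hom_def chain_map_def lin_map_def
    by (simp add: mgr_smul msmul_add mdif_smul lact_smul_right ract_smul_left)
qed

lemma hoch_cochains_additive:
  assumes f: "f \<in> hoch_cochains A M n" and g: "g \<in> hoch_cochains A M n"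
  shows "f + g \<in> hoch_cochains A M n"
    and "hoch_diff A M n (f + g) = hoch_diff A M n f + hoch_diff A M n g"
proof -
  show "f + g \<in> hoch_cochains A M n"
  proof (rule hoch_cochainsI)
    show "(f + g) x w = 0" if "\<not> composable A x w" for x w
      using f g that by (simp add: hoch_cochains_def)
    show "graded n (f + g)"
      using graded_add[OF graded_cochain[OF f] graded_cochain[OF g]] by (simp add: plus_fun_def)
    show "slotwise c x ((f + g) x) (\<lambda>w. smul M c ((f + g) x w)) ((f + g) x)" for c x
      by (rule slotwise_cong[OF slotwise_add[OF slotwise_cochain[OF f] slotwise_cochain[OF g]]])
        (simp_all add: msmul_add[OF composable_src composable_tgt cochain_in[OF f] cochain_in[OF g]])
  qed
  show "hoch_diff A M n (f + g) = hoch_diff A M n f + hoch_diff A M n g"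
  proof (intro ext)
    fix x w
    show "hoch_diff A M n (f + g) x w = (hoch_diff A M n f + hoch_diff A M n g) x w"
    proof (cases "composable A x w")
      case False
      then show ?thesis by (simp add: hoch_diff_def)
    next
      case w: True
      have "hdif M n (f + g) x w = hdif M n f x w + hdif M n g x w"
        using composable_src[OF w] composable_tgt[OF w] cochain_in[OF f w] cochain_in[OF g w]
        by (simp add: hdif_def mdif_add)
      moreover have "bar A ((f + g) x) x w = bar A (f x) x w + bar A (g x) x w"
        using bar_add[of A "f x" "g x" x w] by (simp add: plus_fun_def)
      ultimately show ?thesis
        using hleft_add[OF graded_cochain[OF f] graded_cochain[OF g] w]
          hright_add[OF graded_cochain[OF f] graded_cochain[OF g] w]
        by (simp add: hoch_diff_eq[OF w] plus_fun_def algebra_simps)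
    qed
  qed
qed

theorem is_complex_hoch: "is_complex (hoch A M)"
  unfolding is_complex_def
proof (intro allI conjI ballI)
  fix n
  interpret sm: bimod_hom A M M "\<lambda>x y i. smul M c" for c
    by (rule bimod_hom_smul)
  have sm: "csmul (hoch A M) c f x w = (if composable A x w then smul M c (f x w) else 0)" for c f x w
    by (simp add: hoch_def)
  have out: "f x w = 0" if "f \<in> hoch_cochains A M n" "\<not> composable A x w" for f x w
    using that by (simp add: hoch_cochains_def)
  show "module scalars (component (hoch A M) n)"
    unfolding module_component_iff vspace_on_def hoch_simps(1)
  proof (intro conjI allI ballI)
    show "0 \<in> hoch_cochains A M n"
    proof (rule hoch_cochainsI)
      show "graded n 0"
        by (auto simp: graded_def intro: mgr_zero composable_src composable_tgt)
      have "smul M c 0 = 0" if "x \<in> Ob A" for c x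
        using additive_on.zero[OF additive_msmul[OF that that]] .
      then show "slotwise c x (0 x) (\<lambda>w. smul M c (0 x w)) (0 x)" for c x
        by (auto simp: slotwise_def dest: composable_tgt)
    qed simp
    fix f assume f: "f \<in> hoch_cochains A M n"
    show "csmul (hoch A M) c f \<in> hoch_cochains A M n" for c
      using sm.hoch_map_in[OF f] by (simp add: csmul_hoch[of A M c f n])
    show "csmul (hoch A M) (c + d) f = csmul (hoch A M) c f + csmul (hoch A M) d f" for c d
      by (auto simp: fun_eq_iff sm
          intro!: msmul_add_left[OF composable_src composable_tgt cochain_in[OF f]])
    show "csmul (hoch A M) (c * d) f = csmul (hoch A M) c (csmul (hoch A M) d f)" for c d
      by (auto simp: fun_eq_iff sm
          intro!: msmul_mult[OF composable_src composable_tgt cochain_in[OF f]])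
    show "csmul (hoch A M) 1 f = f"
      using out[OF f] by (auto simp: fun_eq_iff sm
          intro!: msmul_one[OF composable_src composable_tgt cochain_in[OF f]])
    fix g assume g: "g \<in> hoch_cochains A M n"
    show "f + g \<in> hoch_cochains A M n" by (rule hoch_cochains_additive(1)[OF f g])
    show "csmul (hoch A M) c (f + g) = csmul (hoch A M) c f + csmul (hoch A M) c g" for c
      by (auto simp: fun_eq_iff sm
          intro!: msmul_add[OF composable_src composable_tgt cochain_in[OF f] cochain_in[OF g]])
  qed
  show "lin_map (component (hoch A M) n) (component (hoch A M) (n + 1)) (cdif (hoch A M) n)"
    unfolding lin_map_def component_simps hoch_simps
  proof (intro conjI allI ballI)
    fix f assume f: "f \<in> hoch_cochains A M n"
    show "hoch_diff A M n f \<in> hoch_cochains A M (n + 1)" by (rule hoch_diff_in[OF f])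
    show "hoch_diff A M n (csmul (hoch A M) c f) = csmul (hoch A M) c (hoch_diff A M n f)" for c
      unfolding csmul_hoch[of A M c f n] csmul_hoch[of A M c "hoch_diff A M n f" "n + 1"]
      by (rule sm.hoch_map_diff[OF f, symmetric])
    fix g assume g: "g \<in> hoch_cochains A M n"
    show "hoch_diff A M n (f + g) = hoch_diff A M n f + hoch_diff A M n g"
      by (rule hoch_cochains_additive(2)[OF f g])
  qed
  show "cdif (hoch A M) (n + 1) (cdif (hoch A M) n f) = 0" if "f \<in> cgr (hoch A M) n" for f
    using that hoch_diff_hoch_diff by simp
qed

end

context bimod_hom
begin

theorem chain_map_hoch: "chain_map (hoch A M) (hoch A N) (hoch_map A \<theta>)"
  unfolding chain_map_def lin_map_def component_simps hoch_simps
proof (intro allI conjI ballI)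
  fix n f assume f: "f \<in> hoch_cochains A M n"
  have val: "composable A x w \<Longrightarrow> f x w \<in> gr M (src x w) x (n + bdeg w)" for x w
    by (rule M.cochain_in[OF f _ refl refl])
  show "hoch_map A \<theta> n f \<in> hoch_cochains A N n" by (rule hoch_map_in[OF f])
  show "hoch_map A \<theta> (n + 1) (hoch_diff A M n f) = hoch_diff A N n (hoch_map A \<theta> n f)"
    by (rule hoch_map_diff[OF f])
  show "hoch_map A \<theta> n (csmul (hoch A M) c f) = csmul (hoch A N) c (hoch_map A \<theta> n f)" for c
    by (auto simp: fun_eq_iff hoch_def hoch_map_def hom_smul[OF composable_src composable_tgt val])
  fix g assume g: "g \<in> hoch_cochains A M n"
  show "hoch_map A \<theta> n (f + g) = hoch_map A \<theta> n f + hoch_map A \<theta> n g"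
    by (auto simp: fun_eq_iff hoch_map_def
        intro!: hom_add[OF composable_src composable_tgt val M.cochain_in[OF g]])
qed

end

text \<open>Over a field every short exact sequence of bimodules has a linear section \<open>s\<close>, not
  compatible with differentials or actions; this is what makes cochains lift along \<open>g\<close>.\<close>

theorem (in short_exact_bimod) short_exact_hoch:
  assumes s_lin: "\<And>x y i. x \<in> Ob A \<Longrightarrow> y \<in> Ob A \<Longrightarrow> lin_map (grm P x y i) (grm N x y i) (s x y i)"
    and g_s: "\<And>x y i p. x \<in> Ob A \<Longrightarrow> y \<in> Ob A \<Longrightarrow> p \<in> gr P x y i \<Longrightarrow> g x y i (s x y i p) = p"
  shows "short_exact (hoch A M) (hoch A N) (hoch A P) (hoch_map A f) (hoch_map A g)"
proof -
  interpret f: bimod_hom A M N f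
    by (intro bimod_hom.intro bimod_hom_axioms.intro M.dg_bimod_axioms N.dg_bimod_axioms hom_f)
  interpret g: bimod_hom A N P g
    by (intro bimod_hom.intro bimod_hom_axioms.intro N.dg_bimod_axioms P.dg_bimod_axioms hom_g)
  have f_inj: "m = m'" if "x \<in> Ob A" "y \<in> Ob A" "m \<in> gr M x y i" "m' \<in> gr M x y i"
      "f x y i m = f x y i m'" for x y i m m'
    using short_exact_cplx.inj[OF short_exact_cplx[OF that(1,2)]] that(3-5) by simp
  have gf: "g x y i (f x y i m) = 0" if "x \<in> Ob A" "y \<in> Ob A" "m \<in> gr M x y i" for x y i m
    using short_exact_cplx.g_f[OF short_exact_cplx[OF that(1,2)]] that(3) by simp
  show ?thesis
    unfolding short_exact_def hoch_simps
  proof (intro conjI allI M.is_complex_hoch N.is_complex_hoch P.is_complex_hoch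
      f.chain_map_hoch g.chain_map_hoch)
    fix n
    show inj: "inj_on (hoch_map A f n) (hoch_cochains A M n)"
    proof (intro inj_onI ext)
      fix h h' x w
      assume h: "h \<in> hoch_cochains A M n" "h' \<in> hoch_cochains A M n" and "hoch_map A f n h = hoch_map A f n h'"
      then have eq: "hoch_map A f n h x w = hoch_map A f n h' x w" by simp
      show "h x w = h' x w"
      proof (cases "composable A x w")
        case True
        with eq show ?thesis
          using f_inj[OF composable_src composable_tgt M.cochain_in[OF h(1)] M.cochain_in[OF h(2)]]
          by (simp add: hoch_map_def)
      qed (use h in \<open>simp add: hoch_cochains_def\<close>)
    qed
    show "hoch_map A f n ` hoch_cochains A M n = {h \<in> hoch_cochains A N n. hoch_map A g n h = 0}"
    proof (intro equalityI subsetI)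
      fix h assume "h \<in> hoch_map A f n ` hoch_cochains A M n"
      then obtain h' where h': "h' \<in> hoch_cochains A M n" "h = hoch_map A f n h'" by blast
      have "hoch_map A g n h x w = 0" for x w
        using gf[OF composable_src composable_tgt M.cochain_in[OF h'(1)]] by (simp add: h' hoch_map_def)
      then show "h \<in> {h \<in> hoch_cochains A N n. hoch_map A g n h = 0}"
        using f.hoch_map_in[OF h'(1)] by (simp add: h'(2) fun_eq_iff)
    next
      fix h assume "h \<in> {h \<in> hoch_cochains A N n. hoch_map A g n h = 0}"
      then have h: "h \<in> hoch_cochains A N n" and gh: "hoch_map A g n h x w = 0" for x w
        by (simp_all add: fun_eq_iff)
      have "\<exists>m \<in> gr M (src x w) x (n + bdeg w). f (src x w) x (n + bdeg w) m = h x w"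
        if w: "composable A x w" for x w
      proof -
        have "h x w \<in> gr N (src x w) x (n + bdeg w)" by (rule N.cochain_in[OF h w refl refl])
        moreover have "g (src x w) x (n + bdeg w) (h x w) = 0"
          using gh[of x w] w by (simp add: hoch_map_def)
        ultimately show ?thesis
          using short_exact_cplx.kernelE[OF short_exact_cplx[OF composable_src[OF w] composable_tgt[OF w]]]
          unfolding cx_simps by metis
      qed
      \<comment> \<open>Preimages are chosen string by string, with no regard to linearity.
        Injectivity of \<open>f\<close> makes them unique, so the linear relation between values of
        \<open>h\<close> is reflected to the chosen preimages.\<close>
      then obtain k where k: "\<And>x w. composable A x w \<Longrightarrow> k x w \<in> gr M (src x w) x (n + bdeg w)"
          "\<And>x w. composable A x w \<Longrightarrow> f (src x w) x (n + bdeg w) (k x w) = h x w"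
        by metis
      \<comment> \<open>Cochains have to be 0 outside of composable strings, where \<open>k\<close>
        is arbitrary.\<close>
      define h' where "h' x w = (if composable A x w then k x w else 0)" for x w
      have h': "h' x w \<in> gr M (src x w) x (n + bdeg w)" "f (src x w) x (n + bdeg w) (h' x w) = h x w"
        if "composable A x w" for x w
        using that k by (simp_all add: h'_def)
      have "h' \<in> hoch_cochains A M n"
      proof (rule M.hoch_cochainsI)
        show "M.graded n h'" using h'(1) by (simp add: M.graded_def)
        fix c x
        show "M.slotwise c x (h' x) (\<lambda>w. smul M c (h' x w)) (h' x)"
          unfolding M.slotwise_def
        proof (intro allI impI)
          fix u y i a b v
          assume w: "composable A x (u @ (y, i, a) # v)" "composable A x (u @ (y, i, b) # v)"
          note wc = M.composable_slot(1)[OF w, of c]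
          have ob: "src y v \<in> Ob A" "x \<in> Ob A"
            using composable_src[OF w(1)] composable_tgt[OF w(1)] by simp_all
          let ?k = "n + (bdeg u + (i - 1 + bdeg v))"
          note in_a = h'[OF w(1), simplified] and in_b = h'[OF w(2), simplified]
            and in_c = h'[OF wc, simplified]
          have "f (src y v) x ?k (h' x (u @ (y, i, smul A c a + b) # v)) =
              f (src y v) x ?k (smul M c (h' x (u @ (y, i, a) # v)) + h' x (u @ (y, i, b) # v))"
            using ob in_a in_b in_c
            by (simp add: f.hom_add f.hom_smul M.mgr_smul M.slotwiseD[OF N.slotwise_cochain[OF h] w])
          then show "h' x (u @ (y, i, smul A c a + b) # v) =
              smul M c (h' x (u @ (y, i, a) # v)) + h' x (u @ (y, i, b) # v)"
            using in_a in_b in_c ob by (intro f_inj[of "src y v" x _ ?k] M.mgr_add M.mgr_smul) simp_all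
        qed
      qed (simp add: h'_def)
      moreover have "hoch_map A f n h' = h"
        using h'(2) h by (auto simp: fun_eq_iff hoch_map_def hoch_cochains_def)
      ultimately show "h \<in> hoch_map A f n ` hoch_cochains A M n" by blast
    qed
    show "hoch_map A g n ` hoch_cochains A N n = hoch_cochains A P n"
    proof (intro equalityI subsetI)
      fix h assume h: "h \<in> hoch_cochains A P n"
      have "hoch_map A g n (hoch_map A s n h) = h"
        using h g_s[OF composable_src composable_tgt P.cochain_in[OF h]]
        by (auto simp: fun_eq_iff hoch_map_def hoch_cochains_def)
      then show "h \<in> hoch_map A g n ` hoch_cochains A N n"
        using hoch_map_in_lin[OF P.dg_bimod_axioms N.dg_bimod_axioms s_lin h] by (metis imageI)
    qed (auto intro: g.hoch_map_in)
  qed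
qed

section \<open>The homotopy fiber product\<close>

context dg_cat
begin

lemmas gr_diff = cochain_complex.diff_in[OF complex, unfolded cx_simps]
  and smul_add = cochain_complex.smul_add[OF complex, unfolded cx_simps]
  and vspace_gr = cochain_complex.vsp[OF complex, unfolded cx_simps]
  and dif_sg = additive_on.sg[OF additive_dif]
  and dif_diff = additive_on.diff[OF additive_dif]
  and dif_zero = additive_on.zero[OF additive_dif]
  and cmp_zero_left = dg_pairing.zero_left[OF pairing, unfolded cx_simps]
  and cmp_zero_right = dg_pairing.zero_right[OF pairing, unfolded cx_simps]
  and cmp_sg_left = dg_pairing.sg_left[OF pairing, unfolded cx_simps]
  and cmp_sg_right = dg_pairing.sg_right[OF pairing, unfolded cx_simps]
  and cmp_diff_left = additive_on.diff[OF dg_pairing.left[OF pairing, unfolded cx_simps]]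
  and cmp_diff_right = additive_on.diff[OF dg_pairing.right[OF pairing, unfolded cx_simps]]

lemma additive_smul: "x \<in> Ob A \<Longrightarrow> y \<in> Ob A \<Longrightarrow> additive_on (gr A x y n) (smul A c)"
  by unfold_locales (auto intro: gr_zero gr_uminus gr_add smul_add)

lemmas smul_zero = additive_on.zero[OF additive_smul]

lemma sg_in: "x \<in> Ob A \<Longrightarrow> y \<in> Ob A \<Longrightarrow> a \<in> gr A x y n \<Longrightarrow> sg e a \<in> gr A x y n"
  by (rule additive_on.sg_mem[OF additive_dif])

lemmas gr_closed = gr_zero gr_add gr_diff gr_smul sg_in dif_in cmp_in

lemma assoc_right:
  assumes "w \<in> Ob A" "x \<in> Ob A" "y \<in> Ob A" "z \<in> Ob A"
    and "h \<in> gr A y z l" "g \<in> gr A x y j" "f \<in> gr A w x i" and "n = l + j"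
  shows "cmp A w x z n i (cmp A x y z l j h g) f = cmp A w y z l (j + i) h (cmp A w x y j i g f)"
  by (rule assoc[OF assms(1-7) refl assms(8)])

text \<open>The Leibniz rule for the component \<open>\<gamma>\<close> of the composition in the homotopy fiber product,
  with \<open>m = G \<mu>\<close>, \<open>n = L \<nu>\<close> and \<open>p\<^sub>k = \<phi>\<^sub>k\<close>.\<close>

lemma leibniz_square:
  assumes ob: "a\<^sub>1 \<in> Ob A" "a\<^sub>2 \<in> Ob A" "a\<^sub>3 \<in> Ob A" "b\<^sub>1 \<in> Ob A" "b\<^sub>2 \<in> Ob A" "b\<^sub>3 \<in> Ob A"
    and m: "m \<in> gr A a\<^sub>1 a\<^sub>2 i" "m' \<in> gr A a\<^sub>2 a\<^sub>3 j" and n: "n \<in> gr A b\<^sub>1 b\<^sub>2 i" "n' \<in> gr A b\<^sub>2 b\<^sub>3 j"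
    and p: "p\<^sub>1 \<in> gr A a\<^sub>1 b\<^sub>1 0" "p\<^sub>2 \<in> gr A a\<^sub>2 b\<^sub>2 0" "p\<^sub>3 \<in> gr A a\<^sub>3 b\<^sub>3 0"
    and g: "g \<in> gr A a\<^sub>1 b\<^sub>2 (i - 1)" "g' \<in> gr A a\<^sub>2 b\<^sub>3 (j - 1)"
  shows "dif A a\<^sub>1 b\<^sub>3 (j + i - 1) (sg i (cmp A a\<^sub>1 a\<^sub>2 b\<^sub>3 (j - 1) i g' m) + cmp A a\<^sub>1 b\<^sub>2 b\<^sub>3 j (i - 1) n' g) +
      sg (j + i) (cmp A a\<^sub>1 a\<^sub>3 b\<^sub>3 0 (j + i) p\<^sub>3 (cmp A a\<^sub>1 a\<^sub>2 a\<^sub>3 j i m' m) -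
        cmp A a\<^sub>1 b\<^sub>1 b\<^sub>3 (j + i) 0 (cmp A b\<^sub>1 b\<^sub>2 b\<^sub>3 j i n' n) p\<^sub>1) =
    sg i (cmp A a\<^sub>1 a\<^sub>2 b\<^sub>3 j i (dif A a\<^sub>2 b\<^sub>3 (j - 1) g' +
        sg j (cmp A a\<^sub>2 a\<^sub>3 b\<^sub>3 0 j p\<^sub>3 m' - cmp A a\<^sub>2 b\<^sub>2 b\<^sub>3 j 0 n' p\<^sub>2)) m) +
      cmp A a\<^sub>1 b\<^sub>2 b\<^sub>3 (j + 1) (i - 1) (dif A b\<^sub>2 b\<^sub>3 j n') g +
      sg j (sg (i + 1) (cmp A a\<^sub>1 a\<^sub>2 b\<^sub>3 (j - 1) (i + 1) g' (dif A a\<^sub>1 a\<^sub>2 i m)) +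
        cmp A a\<^sub>1 b\<^sub>2 b\<^sub>3 j i n' (dif A a\<^sub>1 b\<^sub>2 (i - 1) g +
          sg i (cmp A a\<^sub>1 a\<^sub>2 b\<^sub>2 0 i p\<^sub>2 m - cmp A a\<^sub>1 b\<^sub>1 b\<^sub>2 i 0 n p\<^sub>1)))"
proof -
  define X where "X = cmp A a\<^sub>1 a\<^sub>2 b\<^sub>3 j i (dif A a\<^sub>2 b\<^sub>3 (j - 1) g') m"
  define Y where "Y = cmp A a\<^sub>1 a\<^sub>2 b\<^sub>3 (j - 1) (i + 1) g' (dif A a\<^sub>1 a\<^sub>2 i m)"
  define Z where "Z = cmp A a\<^sub>1 b\<^sub>2 b\<^sub>3 (j + 1) (i - 1) (dif A b\<^sub>2 b\<^sub>3 j n') g"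
  define W where "W = cmp A a\<^sub>1 b\<^sub>2 b\<^sub>3 j i n' (dif A a\<^sub>1 b\<^sub>2 (i - 1) g)"
  define R where "R = cmp A a\<^sub>1 a\<^sub>3 b\<^sub>3 0 (j + i) p\<^sub>3 (cmp A a\<^sub>1 a\<^sub>2 a\<^sub>3 j i m' m)"
  define S where "S = cmp A a\<^sub>1 b\<^sub>2 b\<^sub>3 j i n' (cmp A a\<^sub>1 a\<^sub>2 b\<^sub>2 0 i p\<^sub>2 m)"
  define T where "T = cmp A a\<^sub>1 b\<^sub>2 b\<^sub>3 j i n' (cmp A a\<^sub>1 b\<^sub>1 b\<^sub>2 i 0 n p\<^sub>1)"
  note mem = ob m n p g
  have 1: "dif A a\<^sub>1 b\<^sub>3 (j + i - 1) (cmp A a\<^sub>1 a\<^sub>2 b\<^sub>3 (j - 1) i g' m) = X + sg (j - 1) Y"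
    unfolding X_def Y_def using cmp_dif[OF ob(1,2,6) g(2) m(1), of "j + i - 1"] by simp
  have 2: "dif A a\<^sub>1 b\<^sub>3 (j + i - 1) (cmp A a\<^sub>1 b\<^sub>2 b\<^sub>3 j (i - 1) n' g) = Z + sg j W"
    unfolding Z_def W_def using cmp_dif[OF ob(1,5,6) n(2) g(1), of "j + i - 1"] by simp
  have 3: "cmp A a\<^sub>1 b\<^sub>1 b\<^sub>3 (j + i) 0 (cmp A b\<^sub>1 b\<^sub>2 b\<^sub>3 j i n' n) p\<^sub>1 = T"
    unfolding T_def using assoc_right[OF ob(1,4,5,6) n(2,1) p(1) refl] by simp
  have 4: "cmp A a\<^sub>1 a\<^sub>2 b\<^sub>3 j i (cmp A a\<^sub>2 a\<^sub>3 b\<^sub>3 0 j p\<^sub>3 m') m = R"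
    unfolding R_def by (rule assoc_right[OF ob(1,2,3,6) p(3) m(2,1)]) simp
  have 5: "cmp A a\<^sub>1 a\<^sub>2 b\<^sub>3 j i (cmp A a\<^sub>2 b\<^sub>2 b\<^sub>3 j 0 n' p\<^sub>2) m = S"
    unfolding S_def using assoc_right[OF ob(1,2,5,6) n(2) p(2) m(1), of j] by simp
  have 6: "cmp A a\<^sub>1 a\<^sub>2 b\<^sub>3 j i (dif A a\<^sub>2 b\<^sub>3 (j - 1) g' +
      sg j (cmp A a\<^sub>2 a\<^sub>3 b\<^sub>3 0 j p\<^sub>3 m' - cmp A a\<^sub>2 b\<^sub>2 b\<^sub>3 j 0 n' p\<^sub>2)) m = X + sg j (R - S)"
    unfolding X_def 4[symmetric] 5[symmetric]
    using mem by (simp add: gr_closed cmp_add_left cmp_sg_left cmp_diff_left del: sg_simps)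
  have 7: "cmp A a\<^sub>1 b\<^sub>2 b\<^sub>3 j i n' (dif A a\<^sub>1 b\<^sub>2 (i - 1) g +
      sg i (cmp A a\<^sub>1 a\<^sub>2 b\<^sub>2 0 i p\<^sub>2 m - cmp A a\<^sub>1 b\<^sub>1 b\<^sub>2 i 0 n p\<^sub>1)) = W + sg i (S - T)"
    unfolding W_def S_def T_def
    using mem by (simp add: gr_closed cmp_add_right cmp_sg_right cmp_diff_right del: sg_simps)
  have 8: "dif A a\<^sub>1 b\<^sub>3 (j + i - 1) (sg i (cmp A a\<^sub>1 a\<^sub>2 b\<^sub>3 (j - 1) i g' m) + cmp A a\<^sub>1 b\<^sub>2 b\<^sub>3 j (i - 1) n' g) =
      sg i (X + sg (j - 1) Y) + (Z + sg j W)"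
    unfolding 1[symmetric] 2[symmetric] using mem by (simp add: gr_closed dif_add dif_sg del: sg_simps)
  \<comment> \<open>Both sides are now signed sums of the defined terms. The composite S of n', p2
    and m arises from both correction terms on the right with opposite signs and drops out: two
    squares are glued along p2.\<close>
  show ?thesis
    unfolding 6 7 8 3 R_def[symmetric] Y_def[symmetric] Z_def[symmetric]
    by (cases "even i"; cases "even j"; simp add: sg_def)
qed

end

locale dg_fun = A: dg_cat A + B: dg_cat B
  for A :: "('k::field, 'o, 'm::ab_group_add) dgcat" and B :: "('k, 'p, 'n::ab_group_add) dgcat" +
  fixes F :: "('o, 'm, 'p, 'n) dgfun"
  assumes dg_functor: "dg_functor A B F"
begin

lemma fob_in: "x \<in> Ob A \<Longrightarrow> fob F x \<in> Ob B"
  using dg_functor by (simp add: dg_functor_def)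

lemma fmor_chain_map:
  "x \<in> Ob A \<Longrightarrow> y \<in> Ob A \<Longrightarrow> chain_map (cx A x y) (cx B (fob F x) (fob F y)) (fmor F x y)"
  using dg_functor by (simp add: dg_functor_def)

lemma fmor_in: "x \<in> Ob A \<Longrightarrow> y \<in> Ob A \<Longrightarrow> a \<in> gr A x y i \<Longrightarrow> fmor F x y i a \<in> gr B (fob F x) (fob F y) i"
  and fmor_add: "x \<in> Ob A \<Longrightarrow> y \<in> Ob A \<Longrightarrow> a \<in> gr A x y i \<Longrightarrow> b \<in> gr A x y i \<Longrightarrow>
      fmor F x y i (a + b) = fmor F x y i a + fmor F x y i b"
  and fmor_smul: "x \<in> Ob A \<Longrightarrow> y \<in> Ob A \<Longrightarrow> a \<in> gr A x y i \<Longrightarrow>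
      fmor F x y i (smul A c a) = smul B c (fmor F x y i a)"
  and fmor_dif: "x \<in> Ob A \<Longrightarrow> y \<in> Ob A \<Longrightarrow> a \<in> gr A x y i \<Longrightarrow>
      fmor F x y (i + 1) (dif A x y i a) = dif B (fob F x) (fob F y) i (fmor F x y i a)"
  using fmor_chain_map[of x y] by (simp_all add: chain_map_def lin_map_def)

lemma fmor_zero: "x \<in> Ob A \<Longrightarrow> y \<in> Ob A \<Longrightarrow> fmor F x y i 0 = 0"
  using fmor_add[of x y 0 i 0] by (simp add: A.gr_zero)

lemma fmor_cmp: "x \<in> Ob A \<Longrightarrow> y \<in> Ob A \<Longrightarrow> z \<in> Ob A \<Longrightarrow> g \<in> gr A y z j \<Longrightarrow> f \<in> gr A x y i \<Longrightarrow>
   fmor F x z (j + i) (cmp A x y z j i g f) =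
   cmp B (fob F x) (fob F y) (fob F z) j i (fmor F y z j g) (fmor F x y i f)"
  using dg_functor unfolding dg_functor_def by (elim conjE) simp

lemma fmor_id: "x \<in> Ob A \<Longrightarrow> fmor F x x 0 (idm A x) = idm B (fob F x)"
  using dg_functor unfolding dg_functor_def by (elim conjE) simp

end

lemma vspace_on_prod:
  assumes "vspace_on s S" "vspace_on t T"
  shows "vspace_on (\<lambda>c (x, y). (s c x, t c y)) (S \<times> T)"
  using assms by (simp add: vspace_on_def zero_prod_def)

lemma vspace_on_fp_smul:
  assumes "vspace_on s S" "vspace_on t T" "vspace_on u U"
  shows "vspace_on (fp_smul s t u) (S \<times> T \<times> U)"
  using assms by (simp add: vspace_on_def zero_prod_def)

section \<open>The homotopy fiber product as a dg-category\<close>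

locale homotopy_fiber_product = G: dg_fun B D G + L: dg_fun C D L
  for B :: "('k::field, 'ob, 'b::ab_group_add) dgcat"
    and C :: "('k, 'oc, 'c::ab_group_add) dgcat"
    and D :: "('k, 'od, 'd::ab_group_add) dgcat"
    and G :: "('ob, 'b, 'od, 'd) dgfun"
    and L :: "('oc, 'c, 'od, 'd) dgfun"
begin

abbreviation "E \<equiv> fiber_product B C D G L"

lemma E_simps [simp]:
  "smul E = fp_smul (smul B) (smul C) (smul D)"
  "gr E (M\<^sub>1, N\<^sub>1, \<phi>\<^sub>1) (M\<^sub>2, N\<^sub>2, \<phi>\<^sub>2) i =
     gr B M\<^sub>1 M\<^sub>2 i \<times> gr C N\<^sub>1 N\<^sub>2 i \<times> gr D (fob G M\<^sub>1) (fob L N\<^sub>2) (i - 1)"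
  "dif E (M\<^sub>1, N\<^sub>1, \<phi>\<^sub>1) (M\<^sub>2, N\<^sub>2, \<phi>\<^sub>2) i (\<mu>, \<nu>, \<gamma>) =
     (dif B M\<^sub>1 M\<^sub>2 i \<mu>, dif C N\<^sub>1 N\<^sub>2 i \<nu>,
      dif D (fob G M\<^sub>1) (fob L N\<^sub>2) (i - 1) \<gamma> +
      sg i (cmp D (fob G M\<^sub>1) (fob G M\<^sub>2) (fob L N\<^sub>2) 0 i \<phi>\<^sub>2 (fmor G M\<^sub>1 M\<^sub>2 i \<mu>) -
            cmp D (fob G M\<^sub>1) (fob L N\<^sub>1) (fob L N\<^sub>2) i 0 (fmor L N\<^sub>1 N\<^sub>2 i \<nu>) \<phi>\<^sub>1))"
  "cmp E (M\<^sub>1, N\<^sub>1, \<phi>\<^sub>1) (M\<^sub>2, N\<^sub>2, \<phi>\<^sub>2) (M\<^sub>3, N\<^sub>3, \<phi>\<^sub>3) j i (\<mu>', \<nu>', \<gamma>') (\<mu>, \<nu>, \<gamma>) =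
     (cmp B M\<^sub>1 M\<^sub>2 M\<^sub>3 j i \<mu>' \<mu>, cmp C N\<^sub>1 N\<^sub>2 N\<^sub>3 j i \<nu>' \<nu>,
      sg i (cmp D (fob G M\<^sub>1) (fob G M\<^sub>2) (fob L N\<^sub>3) (j - 1) i \<gamma>' (fmor G M\<^sub>1 M\<^sub>2 i \<mu>)) +
      cmp D (fob G M\<^sub>1) (fob L N\<^sub>2) (fob L N\<^sub>3) j (i - 1) (fmor L N\<^sub>2 N\<^sub>3 j \<nu>') \<gamma>)"
  "idm E (M, N, \<phi>) = (idm B M, idm C N, 0)"
  by (simp_all add: fiber_product_def)

lemma Ob_E:
  assumes "x \<in> Ob E"
  obtains M N \<phi> where "x = (M, N, \<phi>)" "M \<in> Ob B" "N \<in> Ob C" "fob G M \<in> Ob D" "fob L N \<in> Ob D"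
    "\<phi> \<in> gr D (fob G M) (fob L N) 0" "dif D (fob G M) (fob L N) 0 \<phi> = 0"
  using assms by (auto simp: fiber_product_def cocycles_def G.fob_in L.fob_in)

lemmas closed = G.A.gr_closed L.A.gr_closed G.B.gr_closed G.fmor_in L.fmor_in

text \<open>For d^2 = 0 in the third component: as the \<phi>'s are closed of degree 0, d(\<phi>_2
  G(\<mu>)) = \<phi>_2 G(d\<mu>) and d(L(\<nu>) \<phi>_1) = L(d\<nu>) \<phi>_1. The correction thus
  appears twice, with the signs of n and n + 1.\<close>

lemma complex_E:
  assumes "x \<in> Ob E" "y \<in> Ob E"
  shows "is_complex (cx E x y)"
proof -
  obtain M1 N1 p1 where x: "x = (M1, N1, p1)" "M1 \<in> Ob B" "N1 \<in> Ob C" "fob G M1 \<in> Ob D" "fob L N1 \<in> Ob D"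
      "p1 \<in> gr D (fob G M1) (fob L N1) 0" "dif D (fob G M1) (fob L N1) 0 p1 = 0"
    using assms(1) by (rule Ob_E)
  obtain M2 N2 p2 where y: "y = (M2, N2, p2)" "M2 \<in> Ob B" "N2 \<in> Ob C" "fob G M2 \<in> Ob D" "fob L N2 \<in> Ob D"
      "p2 \<in> gr D (fob G M2) (fob L N2) 0" "dif D (fob G M2) (fob L N2) 0 p2 = 0"
    using assms(2) by (rule Ob_E)
  have vsp: "vspace_on (smul E) (gr E x y n)" for n
    unfolding x y E_simps
    by (intro vspace_on_fp_smul G.A.vspace_gr L.A.vspace_gr G.B.vspace_gr x y)
  have "lin_map (grm E x y n) (grm E x y (n + 1)) (dif E x y n)" for n
  proof -
    have smul: "smul D c (a + sg n (b - b')) = smul D c a + sg n (smul D c b - smul D c b')"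
      if "a \<in> gr D (fob G M1) (fob L N2) n" "b \<in> gr D (fob G M1) (fob L N2) n"
        "b' \<in> gr D (fob G M1) (fob L N2) n" for c a b b'
    proof -
      interpret s: additive_on "gr D (fob G M1) (fob L N2) n" "smul D c"
        using x y by (intro G.B.additive_smul)
      have "b - b' \<in> gr D (fob G M1) (fob L N2) n" "sg n (b - b') \<in> gr D (fob G M1) (fob L N2) n"
        using that x y by (simp_all add: closed)
      then show ?thesis using that by (simp add: s.add s.sg s.diff del: sg_simps)
    qed
    show ?thesis
      using x(2-) y(2-) unfolding lin_map_def x(1) y(1)
      by (auto simp: closed G.A.dif_add G.A.dif_smul L.A.dif_add L.A.dif_smul G.B.dif_add G.B.dif_smul
          G.fmor_add G.fmor_smul L.fmor_add L.fmor_smul G.B.cmp_add_left G.B.cmp_add_right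
          G.B.cmp_smul_left G.B.cmp_smul_right smul simp del: sg_simps)
        (simp_all add: algebra_simps)
  qed
  moreover have "dif E x y (n + 1) (dif E x y n m) = 0" if m: "m \<in> gr E x y n" for n m
  proof -
    obtain \<mu> \<nu> \<gamma> where m': "m = (\<mu>, \<nu>, \<gamma>)" "\<mu> \<in> gr B M1 M2 n" "\<nu> \<in> gr C N1 N2 n"
        "\<gamma> \<in> gr D (fob G M1) (fob L N2) (n - 1)"
      using m x(1) y(1) by auto
    have 1: "dif D (fob G M1) (fob L N2) n (cmp D (fob G M1) (fob G M2) (fob L N2) 0 n p2 (fmor G M1 M2 n \<mu>)) =
        cmp D (fob G M1) (fob G M2) (fob L N2) 0 (n + 1) p2 (dif D (fob G M1) (fob G M2) n (fmor G M1 M2 n \<mu>))"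
      using x y m' by (simp add: G.B.cmp_dif closed G.B.cmp_zero_left)
    have 2: "dif D (fob G M1) (fob L N2) n (cmp D (fob G M1) (fob L N1) (fob L N2) n 0 (fmor L N1 N2 n \<nu>) p1) =
        cmp D (fob G M1) (fob L N1) (fob L N2) (n + 1) 0 (dif D (fob L N1) (fob L N2) n (fmor L N1 N2 n \<nu>)) p1"
      using x y m' by (simp add: G.B.cmp_dif closed G.B.cmp_zero_right)
    show ?thesis
      using x y m' unfolding m'(1) x(1) y(1)
      by (simp add: closed G.A.dif_dif L.A.dif_dif G.B.dif_dif G.B.dif_add G.B.dif_sg G.B.dif_diff 1 2
          G.fmor_dif L.fmor_dif zero_prod_def del: sg_simps) (simp add: sg_def)
  qed
  ultimately show ?thesis
    using vsp by (simp add: is_complex_def module_component_iff)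
qed

end

text \<open>All identities are inherited from \<open>N\<close>; what remains to be checked is that
  the subspaces are closed under the operations.\<close>

lemma dg_bimodule_sub:
  assumes "dg_bimod A N"
    and eq: "smul M = smul N" "dif M = dif N" "lact M = lact N" "ract M = ract N"
    and sub: "\<And>x y n m. x \<in> Ob A \<Longrightarrow> y \<in> Ob A \<Longrightarrow> m \<in> gr M x y n \<Longrightarrow> m \<in> gr N x y n"
    and zero: "\<And>x y n. x \<in> Ob A \<Longrightarrow> y \<in> Ob A \<Longrightarrow> 0 \<in> gr M x y n"
    and add: "\<And>x y n m m'. x \<in> Ob A \<Longrightarrow> y \<in> Ob A \<Longrightarrow> m \<in> gr M x y n \<Longrightarrow> m' \<in> gr M x y n \<Longrightarrow>
      m + m' \<in> gr M x y n"
    and smul: "\<And>x y n m c. x \<in> Ob A \<Longrightarrow> y \<in> Ob A \<Longrightarrow> m \<in> gr M x y n \<Longrightarrow> smul N c m \<in> gr M x y n"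
    and dif: "\<And>x y n m. x \<in> Ob A \<Longrightarrow> y \<in> Ob A \<Longrightarrow> m \<in> gr M x y n \<Longrightarrow> dif N x y n m \<in> gr M x y (n + 1)"
    and lact: "\<And>x y z j i a m. x \<in> Ob A \<Longrightarrow> y \<in> Ob A \<Longrightarrow> z \<in> Ob A \<Longrightarrow> a \<in> gr A y z j \<Longrightarrow> m \<in> gr M x y i \<Longrightarrow>
      lact N x y z j i a m \<in> gr M x z (j + i)"
    and ract: "\<And>x y z j i m a. x \<in> Ob A \<Longrightarrow> y \<in> Ob A \<Longrightarrow> z \<in> Ob A \<Longrightarrow> m \<in> gr M y z j \<Longrightarrow> a \<in> gr A x y i \<Longrightarrow>
      ract N x y z j i m a \<in> gr M x z (j + i)"
  shows "dg_bimodule A M"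
proof -
  interpret N: dg_bimod A N by fact
  have vsp: "vspace_on (smul N) (gr M x y n)" if "x \<in> Ob A" "y \<in> Ob A" for x y n
    using cochain_complex.vsp[OF N.complex_bimod[OF that], of n] sub[OF that, of _ n] zero[OF that, of n]
      add[OF that, of _ n] smul[OF that, of _ n]
    unfolding vspace_on_def cx_simps by blast
  show ?thesis
    unfolding dg_bimodule_def
  proof (intro conjI ballI allI)
    fix x y assume "x \<in> Ob A" "y \<in> Ob A"
    then show "is_complex (cx M x y)"
      unfolding is_complex_def module_component_iff lin_map_def
      by (simp add: eq vsp dif sub N.mdif_dif N.mdif_add N.mdif_smul)
  qed (simp_all add: eq sub bilin_map_def lin_map_def lact ract N.lact_add_left N.lact_add_right
      N.lact_smul_left N.lact_smul_right N.ract_add_left N.ract_add_right N.ract_smul_left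
      N.ract_smul_right N.lact_dif N.ract_dif N.lact_lact N.ract_ract N.lact_ract N.lact_id N.ract_id)
qed

context homotopy_fiber_product
begin

lemma bilin_E:
  assumes "x \<in> Ob E" "y \<in> Ob E" "z \<in> Ob E"
  shows "bilin_map (grm E y z j) (grm E x y i) (grm E x z (j + i)) (cmp E x y z j i)"
proof -
  obtain M1 N1 p1 where x: "x = (M1, N1, p1)" "M1 \<in> Ob B" "N1 \<in> Ob C" "fob G M1 \<in> Ob D" "fob L N1 \<in> Ob D"
    using assms(1) by (rule Ob_E)
  obtain M2 N2 p2 where y: "y = (M2, N2, p2)" "M2 \<in> Ob B" "N2 \<in> Ob C" "fob G M2 \<in> Ob D" "fob L N2 \<in> Ob D"
    using assms(2) by (rule Ob_E)
  obtain M3 N3 p3 where z: "z = (M3, N3, p3)" "M3 \<in> Ob B" "N3 \<in> Ob C" "fob G M3 \<in> Ob D" "fob L N3 \<in> Ob D"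
    using assms(3) by (rule Ob_E)
  have smul: "smul D c (sg i a + b) = sg i (smul D c a) + smul D c b"
    if "a \<in> gr D (fob G M1) (fob L N3) (j + i - 1)" "b \<in> gr D (fob G M1) (fob L N3) (j + i - 1)" for c a b
  proof -
    interpret s: additive_on "gr D (fob G M1) (fob L N3) (j + i - 1)" "smul D c"
      using x z by (intro G.B.additive_smul)
    show ?thesis using that by (simp add: s.add s.sg s.sg_mem del: sg_simps)
  qed
  show ?thesis
    using x(2-) y(2-) z(2-) unfolding bilin_map_def lin_map_def x(1) y(1) z(1)
    by (auto simp: closed smul G.A.cmp_add_left G.A.cmp_add_right G.A.cmp_smul_left G.A.cmp_smul_right
        L.A.cmp_add_left L.A.cmp_add_right L.A.cmp_smul_left L.A.cmp_smul_right
        G.fmor_add G.fmor_smul L.fmor_add L.fmor_smul G.B.cmp_add_left G.B.cmp_add_right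
        G.B.cmp_smul_left G.B.cmp_smul_right)
qed

lemma leibniz_E:
  assumes "x \<in> Ob E" "y \<in> Ob E" "z \<in> Ob E" "g \<in> gr E y z j" "f \<in> gr E x y i"
  shows "dif E x z (j + i) (cmp E x y z j i g f) =
    cmp E x y z (j + 1) i (dif E y z j g) f + sg j (cmp E x y z j (i + 1) g (dif E x y i f))"
proof -
  obtain M1 N1 p1 where x: "x = (M1, N1, p1)" "M1 \<in> Ob B" "N1 \<in> Ob C" "fob G M1 \<in> Ob D" "fob L N1 \<in> Ob D"
      "p1 \<in> gr D (fob G M1) (fob L N1) 0"
    using assms(1) by (rule Ob_E)
  obtain M2 N2 p2 where y: "y = (M2, N2, p2)" "M2 \<in> Ob B" "N2 \<in> Ob C" "fob G M2 \<in> Ob D" "fob L N2 \<in> Ob D"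
      "p2 \<in> gr D (fob G M2) (fob L N2) 0"
    using assms(2) by (rule Ob_E)
  obtain M3 N3 p3 where z: "z = (M3, N3, p3)" "M3 \<in> Ob B" "N3 \<in> Ob C" "fob G M3 \<in> Ob D" "fob L N3 \<in> Ob D"
      "p3 \<in> gr D (fob G M3) (fob L N3) 0"
    using assms(3) by (rule Ob_E)
  obtain \<mu>' \<nu>' \<gamma>' where g: "g = (\<mu>', \<nu>', \<gamma>')" "\<mu>' \<in> gr B M2 M3 j" "\<nu>' \<in> gr C N2 N3 j"
      "\<gamma>' \<in> gr D (fob G M2) (fob L N3) (j - 1)"
    using assms(4) unfolding y(1) z(1) by auto
  obtain \<mu> \<nu> \<gamma> where f: "f = (\<mu>, \<nu>, \<gamma>)" "\<mu> \<in> gr B M1 M2 i" "\<nu> \<in> gr C N1 N2 i"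
      "\<gamma> \<in> gr D (fob G M1) (fob L N2) (i - 1)"
    using assms(5) unfolding x(1) y(1) by auto
  have sg3: "sg j (a, b, c) = (sg j a, sg j b, sg j c)" for a :: 'b and b :: 'c and c :: 'd
    by (simp add: sg_def)
  note ls = G.B.leibniz_square[OF x(4) y(4) z(4) x(5) y(5) z(5)
      G.fmor_in[OF x(2) y(2) f(2)] G.fmor_in[OF y(2) z(2) g(2)]
      L.fmor_in[OF x(3) y(3) f(3)] L.fmor_in[OF y(3) z(3) g(3)] x(6) y(6) z(6) f(4) g(4)]
  show ?thesis
    unfolding x(1) y(1) z(1) g(1) f(1) E_simps sg3
    using ls x y z f g
    by (simp add: G.A.cmp_dif L.A.cmp_dif G.fmor_cmp L.fmor_cmp G.fmor_dif L.fmor_dif del: sg_simps)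
qed

lemma assoc_E:
  assumes "w \<in> Ob E" "x \<in> Ob E" "y \<in> Ob E" "z \<in> Ob E" "h \<in> gr E y z l" "g \<in> gr E x y j" "f \<in> gr E w x i"
  shows "cmp E w y z l (j + i) h (cmp E w x y j i g f) = cmp E w x z (l + j) i (cmp E x y z l j h g) f"
proof -
  obtain M0 N0 p0 where w: "w = (M0, N0, p0)" "M0 \<in> Ob B" "N0 \<in> Ob C" "fob G M0 \<in> Ob D" "fob L N0 \<in> Ob D"
    using assms(1) by (rule Ob_E)
  obtain M1 N1 p1 where x: "x = (M1, N1, p1)" "M1 \<in> Ob B" "N1 \<in> Ob C" "fob G M1 \<in> Ob D" "fob L N1 \<in> Ob D"
    using assms(2) by (rule Ob_E)
  obtain M2 N2 p2 where y: "y = (M2, N2, p2)" "M2 \<in> Ob B" "N2 \<in> Ob C" "fob G M2 \<in> Ob D" "fob L N2 \<in> Ob D"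
    using assms(3) by (rule Ob_E)
  obtain M3 N3 p3 where z: "z = (M3, N3, p3)" "M3 \<in> Ob B" "N3 \<in> Ob C" "fob G M3 \<in> Ob D" "fob L N3 \<in> Ob D"
    using assms(4) by (rule Ob_E)
  obtain a b c where h: "h = (a, b, c)" "a \<in> gr B M2 M3 l" "b \<in> gr C N2 N3 l" "c \<in> gr D (fob G M2) (fob L N3) (l - 1)"
    using assms(5) unfolding y(1) z(1) by auto
  obtain a' b' c' where g: "g = (a', b', c')" "a' \<in> gr B M1 M2 j" "b' \<in> gr C N1 N2 j"
      "c' \<in> gr D (fob G M1) (fob L N2) (j - 1)"
    using assms(6) unfolding x(1) y(1) by auto
  obtain a'' b'' c'' where f: "f = (a'', b'', c'')" "a'' \<in> gr B M0 M1 i" "b'' \<in> gr C N0 N1 i"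
      "c'' \<in> gr D (fob G M0) (fob L N1) (i - 1)"
    using assms(7) unfolding w(1) x(1) by auto
  \<comment> \<open>The shift by one in the third component makes the same degree appear in
    different forms; they are unified before associativity in \<open>D\<close> is compared.\<close>
  have deg: "l - 1 + j = l + j - 1" "j - 1 + i = j + i - 1" "j + (i - 1) = j + i - 1" "l + (j - 1) = l + j - 1"
    by simp_all
  show ?thesis
    unfolding w(1) x(1) y(1) z(1) h(1) g(1) f(1) E_simps
    using w(2-) x(2-) y(2-) z(2-) h(2-) g(2-) f(2-)
    by (simp add: closed G.A.assoc_right L.A.assoc_right G.B.assoc_right G.fmor_cmp L.fmor_cmp
        G.B.cmp_add_left G.B.cmp_add_right G.B.cmp_sg_left G.B.cmp_sg_right deg del: sg_simps)
      (simp add: sg_def)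
qed

text \<open>The third component of the differential of the identity is \<phi> - \<phi>, because
  \<open>G\<close> and \<open>L\<close> preserve identities.\<close>

lemma id_E:
  assumes "x \<in> Ob E"
  shows "idm E x \<in> gr E x x 0" "dif E x x 0 (idm E x) = 0"
proof -
  obtain M1 N1 p1 where x: "x = (M1, N1, p1)" "M1 \<in> Ob B" "N1 \<in> Ob C" "fob G M1 \<in> Ob D" "fob L N1 \<in> Ob D"
      "p1 \<in> gr D (fob G M1) (fob L N1) 0"
    using assms by (rule Ob_E)
  show "idm E x \<in> gr E x x 0" "dif E x x 0 (idm E x) = 0"
    using x by (simp_all add: G.A.id_in L.A.id_in G.B.gr_zero G.A.dif_id L.A.dif_id G.fmor_id L.fmor_id
        G.B.id_left G.B.id_right G.B.dif_zero zero_prod_def)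
qed

lemma id_comp_E:
  assumes "x \<in> Ob E" "y \<in> Ob E" "f \<in> gr E x y i"
  shows "cmp E x y y 0 i (idm E y) f = f" "cmp E x x y i 0 f (idm E x) = f"
proof -
  obtain M1 N1 p1 where x: "x = (M1, N1, p1)" "M1 \<in> Ob B" "N1 \<in> Ob C" "fob G M1 \<in> Ob D" "fob L N1 \<in> Ob D"
    using assms(1) by (rule Ob_E)
  obtain M2 N2 p2 where y: "y = (M2, N2, p2)" "M2 \<in> Ob B" "N2 \<in> Ob C" "fob G M2 \<in> Ob D" "fob L N2 \<in> Ob D"
    using assms(2) by (rule Ob_E)
  show "cmp E x y y 0 i (idm E y) f = f" "cmp E x x y i 0 f (idm E x) = f"
    using assms(3) x(2-) y(2-) unfolding x(1) y(1)
    by (auto simp: G.A.id_left G.A.id_right L.A.id_left L.A.id_right G.fmor_id L.fmor_id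
        G.B.id_left G.B.id_right G.B.cmp_zero_left G.B.cmp_zero_right G.fmor_in L.fmor_in)
qed

theorem dg_category_E: "dg_category E"
  unfolding dg_category_def
  by (intro conjI ballI allI complex_E bilin_E leibniz_E assoc_E id_E id_comp_E)

end

section \<open>The two bimodules and their exact sequence\<close>

context homotopy_fiber_product
begin

sublocale E: dg_cat E
  by unfold_locales (rule dg_category_E)

abbreviation "T \<equiv> Dtilde B C D G L"

abbreviation "Q \<equiv> Qbimod B C"

lemma T_simps [simp]:
  "smul T = smul E" "dif T = dif E" "lact T = cmp E" "ract T = cmp E"
  "gr T (M\<^sub>1, N\<^sub>1, \<phi>\<^sub>1) (M\<^sub>2, N\<^sub>2, \<phi>\<^sub>2) i =
     {(0, 0, \<gamma>) | \<gamma>. \<gamma> \<in> gr D (fob G M\<^sub>1) (fob L N\<^sub>2) (i - 1)}"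
  by (simp_all add: Dtilde_def)

lemma Q_simps [simp]:
  "smul Q = (\<lambda>c (\<mu>, \<nu>). (smul B c \<mu>, smul C c \<nu>))"
  "gr Q (M\<^sub>1, N\<^sub>1, \<phi>\<^sub>1) (M\<^sub>2, N\<^sub>2, \<phi>\<^sub>2) i = gr B M\<^sub>1 M\<^sub>2 i \<times> gr C N\<^sub>1 N\<^sub>2 i"
  "dif Q (M\<^sub>1, N\<^sub>1, \<phi>\<^sub>1) (M\<^sub>2, N\<^sub>2, \<phi>\<^sub>2) i (\<mu>, \<nu>) = (dif B M\<^sub>1 M\<^sub>2 i \<mu>, dif C N\<^sub>1 N\<^sub>2 i \<nu>)"
  "lact Q (M\<^sub>1, N\<^sub>1, \<phi>\<^sub>1) (M\<^sub>2, N\<^sub>2, \<phi>\<^sub>2) (M\<^sub>3, N\<^sub>3, \<phi>\<^sub>3) j i (\<mu>', \<nu>', \<gamma>') (\<mu>, \<nu>) =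
     (cmp B M\<^sub>1 M\<^sub>2 M\<^sub>3 j i \<mu>' \<mu>, cmp C N\<^sub>1 N\<^sub>2 N\<^sub>3 j i \<nu>' \<nu>)"
  "ract Q (M\<^sub>1, N\<^sub>1, \<phi>\<^sub>1) (M\<^sub>2, N\<^sub>2, \<phi>\<^sub>2) (M\<^sub>3, N\<^sub>3, \<phi>\<^sub>3) j i (\<mu>', \<nu>') (\<mu>, \<nu>, \<gamma>) =
     (cmp B M\<^sub>1 M\<^sub>2 M\<^sub>3 j i \<mu>' \<mu>, cmp C N\<^sub>1 N\<^sub>2 N\<^sub>3 j i \<nu>' \<nu>)"
  by (simp_all add: Qbimod_def)

lemma zero_triple: "(0, 0, 0) = (0 :: 'b \<times> 'c \<times> 'd)"
  by (simp add: zero_prod_def)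

text \<open>Functors send 0 to 0, so the correction in the differential of (0, 0, \<gamma>)
  vanishes; products with the zero components stay 0, so both actions preserve elements of this
  form.\<close>

lemma dg_bimodule_T: "dg_bimodule E T"
proof (rule dg_bimodule_sub[OF E.diag.dg_bimod_axioms])
  fix x y assume "x \<in> Ob E" "y \<in> Ob E"
  obtain M1 N1 p1 where x: "x = (M1, N1, p1)" "M1 \<in> Ob B" "N1 \<in> Ob C" "fob G M1 \<in> Ob D" "fob L N1 \<in> Ob D"
      "p1 \<in> gr D (fob G M1) (fob L N1) 0"
    using \<open>x \<in> Ob E\<close> by (rule Ob_E)
  obtain M2 N2 p2 where y: "y = (M2, N2, p2)" "M2 \<in> Ob B" "N2 \<in> Ob C" "fob G M2 \<in> Ob D" "fob L N2 \<in> Ob D"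
      "p2 \<in> gr D (fob G M2) (fob L N2) 0"
    using \<open>y \<in> Ob E\<close> by (rule Ob_E)
  fix n
  show "0 \<in> gr T x y n"
    using x y by (auto simp: zero_triple[symmetric] closed)
  fix m assume m: "m \<in> gr T x y n"
  then obtain \<gamma> where \<gamma>: "m = (0, 0, \<gamma>)" "\<gamma> \<in> gr D (fob G M1) (fob L N2) (n - 1)"
    unfolding x(1) y(1) by auto
  show "m \<in> gr (diagonal E) x y n" "smul (diagonal E) c m \<in> gr T x y n" for c
    using x y \<gamma> by (simp_all add: closed G.A.smul_zero L.A.smul_zero)
  show "dif (diagonal E) x y n m \<in> gr T x y (n + 1)"
    using x y \<gamma> by (simp add: closed G.A.dif_zero L.A.dif_zero G.fmor_zero L.fmor_zero
        G.B.cmp_zero_left G.B.cmp_zero_right)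
  show "m + m' \<in> gr T x y n" if "m' \<in> gr T x y n" for m'
    using x y m that by (auto simp: closed)
next
  fix x y z j i assume "x \<in> Ob E" "y \<in> Ob E" "z \<in> Ob E"
  obtain M1 N1 p1 where x: "x = (M1, N1, p1)" "M1 \<in> Ob B" "N1 \<in> Ob C" "fob G M1 \<in> Ob D" "fob L N1 \<in> Ob D"
    using \<open>x \<in> Ob E\<close> by (rule Ob_E)
  obtain M2 N2 p2 where y: "y = (M2, N2, p2)" "M2 \<in> Ob B" "N2 \<in> Ob C" "fob G M2 \<in> Ob D" "fob L N2 \<in> Ob D"
    using \<open>y \<in> Ob E\<close> by (rule Ob_E)
  obtain M3 N3 p3 where z: "z = (M3, N3, p3)" "M3 \<in> Ob B" "N3 \<in> Ob C" "fob G M3 \<in> Ob D" "fob L N3 \<in> Ob D"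
    using \<open>z \<in> Ob E\<close> by (rule Ob_E)
  show "lact (diagonal E) x y z j i a m \<in> gr T x z (j + i)" if "a \<in> gr E y z j" "m \<in> gr T x y i" for a m
    using that x(2-) y(2-) z(2-) unfolding x(1) y(1) z(1)
    by (auto simp: closed G.A.cmp_zero_right L.A.cmp_zero_right G.fmor_zero G.B.cmp_zero_right)
  show "ract (diagonal E) x y z j i m a \<in> gr T x z (j + i)" if "m \<in> gr T y z j" "a \<in> gr E x y i" for a m
    using that x(2-) y(2-) z(2-) unfolding x(1) y(1) z(1)
    by (auto simp: closed G.A.cmp_zero_left L.A.cmp_zero_left L.fmor_zero G.B.cmp_zero_left)
qed simp_all

text \<open>The third component of the fiber product never contributes to the first two, so every
  law reduces to the same law in \<open>B\<close> and in \<open>C\<close>.\<close>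

lemma dg_bimodule_Q: "dg_bimodule E Q"
  unfolding dg_bimodule_def
proof (intro conjI ballI allI)
  fix x y assume "x \<in> Ob E" "y \<in> Ob E"
  obtain M1 N1 p1 where x: "x = (M1, N1, p1)" "M1 \<in> Ob B" "N1 \<in> Ob C"
    using \<open>x \<in> Ob E\<close> by (rule Ob_E)
  obtain M2 N2 p2 where y: "y = (M2, N2, p2)" "M2 \<in> Ob B" "N2 \<in> Ob C"
    using \<open>y \<in> Ob E\<close> by (rule Ob_E)
  have "vspace_on (smul Q) (gr Q x y n)" for n
    unfolding x(1) y(1) Q_simps
    by (intro vspace_on_prod G.A.vspace_gr L.A.vspace_gr x y)
  then show "is_complex (cx Q x y)"
    unfolding is_complex_def module_component_iff lin_map_def using x y
    by (auto simp: closed G.A.dif_add L.A.dif_add G.A.dif_smul L.A.dif_smul G.A.dif_dif L.A.dif_dif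
        zero_prod_def)
  fix i m assume "m \<in> gr Q x y i"
  then show "lact Q x y y 0 i (idm E y) m = m" "ract Q x x y i 0 m (idm E x) = m"
    using x y by (auto simp: G.A.id_left L.A.id_left G.A.id_right L.A.id_right)
next
  fix x y z j i assume "x \<in> Ob E" "y \<in> Ob E" "z \<in> Ob E"
  obtain M1 N1 p1 where x: "x = (M1, N1, p1)" "M1 \<in> Ob B" "N1 \<in> Ob C"
    using \<open>x \<in> Ob E\<close> by (rule Ob_E)
  obtain M2 N2 p2 where y: "y = (M2, N2, p2)" "M2 \<in> Ob B" "N2 \<in> Ob C"
    using \<open>y \<in> Ob E\<close> by (rule Ob_E)
  obtain M3 N3 p3 where z: "z = (M3, N3, p3)" "M3 \<in> Ob B" "N3 \<in> Ob C"
    using \<open>z \<in> Ob E\<close> by (rule Ob_E)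
  note xyz = x(1) y(1) z(1) and ob = x(2-) y(2-) z(2-)
  show "bilin_map (grm E y z j) (grm Q x y i) (grm Q x z (j + i))
      (lact Q x y z j i)"
    "bilin_map (grm Q y z j) (grm E x y i) (grm Q x z (j + i))
      (ract Q x y z j i)"
    using ob unfolding bilin_map_def lin_map_def xyz
    by (auto simp: closed G.A.cmp_add_left L.A.cmp_add_left G.A.cmp_add_right L.A.cmp_add_right
        G.A.cmp_smul_left L.A.cmp_smul_left G.A.cmp_smul_right L.A.cmp_smul_right)
  have sg2: "sg e (a, b) = (sg e a, sg e b)" for e and a :: 'b and b :: 'c
    by (simp add: sg_def)
  show "dif Q x z (j + i) (lact Q x y z j i a m) =
      lact Q x y z (j + 1) i (dif E y z j a) m +
      sg j (lact Q x y z j (i + 1) a (dif Q x y i m))"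
    if "a \<in> gr E y z j" "m \<in> gr Q x y i" for a m
    using that ob unfolding xyz by (auto simp: sg2 G.A.cmp_dif L.A.cmp_dif)
  show "dif Q x z (j + i) (ract Q x y z j i m a) =
      ract Q x y z (j + 1) i (dif Q y z j m) a +
      sg j (ract Q x y z j (i + 1) m (dif E x y i a))"
    if "m \<in> gr Q y z j" "a \<in> gr E x y i" for a m
    using that ob unfolding xyz by (auto simp: sg2 G.A.cmp_dif L.A.cmp_dif)
next
  fix w x y z l j i assume "w \<in> Ob E" "x \<in> Ob E" "y \<in> Ob E" "z \<in> Ob E"
  obtain M0 N0 p0 where w: "w = (M0, N0, p0)" "M0 \<in> Ob B" "N0 \<in> Ob C"
    using \<open>w \<in> Ob E\<close> by (rule Ob_E)
  obtain M1 N1 p1 where x: "x = (M1, N1, p1)" "M1 \<in> Ob B" "N1 \<in> Ob C"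
    using \<open>x \<in> Ob E\<close> by (rule Ob_E)
  obtain M2 N2 p2 where y: "y = (M2, N2, p2)" "M2 \<in> Ob B" "N2 \<in> Ob C"
    using \<open>y \<in> Ob E\<close> by (rule Ob_E)
  obtain M3 N3 p3 where z: "z = (M3, N3, p3)" "M3 \<in> Ob B" "N3 \<in> Ob C"
    using \<open>z \<in> Ob E\<close> by (rule Ob_E)
  note xyz = w(1) x(1) y(1) z(1) and ob = w(2-) x(2-) y(2-) z(2-)
  show "lact Q w y z l (j + i) b (lact Q w x y j i a m) =
      lact Q w x z (l + j) i (cmp E x y z l j b a) m"
    if "b \<in> gr E y z l" "a \<in> gr E x y j" "m \<in> gr Q w x i" for a b m
    using that ob unfolding xyz by (auto simp: G.A.assoc_right L.A.assoc_right)
  show "ract Q w x z (l + j) i (ract Q x y z l j m b) a =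
      ract Q w y z l (j + i) m (cmp E w x y j i b a)"
    if "m \<in> gr Q y z l" "b \<in> gr E x y j" "a \<in> gr E w x i" for a b m
    using that ob unfolding xyz by (auto simp: G.A.assoc_right L.A.assoc_right)
  show "lact Q w y z l (j + i) b (ract Q w x y j i m a) =
      ract Q w x z (l + j) i (lact Q x y z l j b m) a"
    if "b \<in> gr E y z l" "m \<in> gr Q x y j" "a \<in> gr E w x i" for a b m
    using that ob unfolding xyz by (auto simp: G.A.assoc_right L.A.assoc_right)
qed

lemma short_exact_E: "short_exact_bimodules E T (diagonal E) Q incl proj"
proof -
  interpret T: dg_bimod E T by unfold_locales (rule dg_bimodule_T)
  interpret Q: dg_bimod E Q by unfold_locales (rule dg_bimodule_Q)
  have sub: "m \<in> gr E x y n" if "x \<in> Ob E" "y \<in> Ob E" "m \<in> gr T x y n" for x y n m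
    using that by (auto elim!: Ob_E simp: closed)
  have incl: "dg_bimod_hom E T (diagonal E) incl"
    unfolding dg_bimod_hom_def chain_map_def lin_map_def by (simp add: incl_def sub)
  have proj: "dg_bimod_hom E (diagonal E) Q proj"
    unfolding dg_bimod_hom_def chain_map_def lin_map_def
    by (auto elim!: Ob_E simp: proj_def)
  have "short_exact (cx T x y) (cx E x y) (cx Q x y) (incl x y) (proj x y)"
    if xy: "x \<in> Ob E" "y \<in> Ob E" for x y
    unfolding short_exact_def
  proof (intro conjI allI)
    show "is_complex (cx T x y)" "is_complex (cx E x y)" "is_complex (cx Q x y)"
      using xy T.complex_bimod E.complex Q.complex_bimod by (simp_all add: cochain_complex_def)
    show "chain_map (cx T x y) (cx E x y) (incl x y)" "chain_map (cx E x y) (cx Q x y) (proj x y)"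
      using dg_bimod_homD(1)[OF incl xy] dg_bimod_homD(1)[OF proj xy] by simp_all
    fix n
    obtain M1 N1 p1 where x: "x = (M1, N1, p1)" "M1 \<in> Ob B" "N1 \<in> Ob C" "fob G M1 \<in> Ob D"
      using xy(1) by (rule Ob_E)
    obtain M2 N2 p2 where y: "y = (M2, N2, p2)" "M2 \<in> Ob B" "N2 \<in> Ob C" "fob L N2 \<in> Ob D"
      using xy(2) by (rule Ob_E)
    show "inj_on (incl x y n) (cgr (cx T x y) n)" by (simp add: inj_on_def incl_def)
    show "incl x y n ` cgr (cx T x y) n = {m \<in> cgr (cx E x y) n. proj x y n m = 0}"
      using x y by (auto simp: incl_def proj_def zero_prod_def closed)
    \<comment> \<open>The lift with third component 0 shows that the projection is onto.\<close>
    have "(\<mu>, \<nu>) = proj x y n (\<mu>, \<nu>, 0) \<and> (\<mu>, \<nu>, 0) \<in> gr E x y n"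
      if "\<mu> \<in> gr B M1 M2 n" "\<nu> \<in> gr C N1 N2 n" for \<mu> \<nu>
      using x y that by (simp add: proj_def closed)
    then show "proj x y n ` cgr (cx E x y) n = cgr (cx Q x y) n"
      using x(1) y(1) by (force simp: proj_def)
  qed
  then show ?thesis
    unfolding short_exact_bimodules_def
    using dg_bimodule_T E.dg_bimodule_diagonal dg_bimodule_Q incl proj by simp
qed

sublocale ses: short_exact_bimod E T "diagonal E" Q incl proj
  by unfold_locales (rule dg_category_E short_exact_E)+

text \<open>The section inserts 0 as third component. Its failure to be a chain map is \<phi>_2
  G(\<mu>) - L(\<nu>) \<phi>_1 up to sign, which on cohomology is what the connecting map from
  \<open>Q\<close> to \<open>T\<close> computes.\<close>

lemma short_exact_hoch_E:
  "short_exact (hoch E T) (hoch E (diagonal E)) (hoch E Q) (hoch_map E incl) (hoch_map E proj)"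
proof (rule ses.short_exact_hoch)
  fix x y i assume xy: "x \<in> Ob E" "y \<in> Ob E"
  show "lin_map (grm Q x y i) (grm (diagonal E) x y i) (\<lambda>(\<mu>, \<nu>). (\<mu>, \<nu>, 0))"
    using xy unfolding lin_map_def by (auto elim!: Ob_E simp: closed G.B.smul_zero)
  show "proj x y i (case p of (\<mu>, \<nu>) \<Rightarrow> (\<mu>, \<nu>, 0)) = p" if "p \<in> gr Q x y i" for p
    by (simp add: proj_def split: prod.split)
qed

end

theorem lemma4p1:
  fixes B :: "('k::field, 'ob, 'b::ab_group_add) dgcat"
    and C :: "('k, 'oc, 'c::ab_group_add) dgcat"
    and D :: "('k, 'od, 'd::ab_group_add) dgcat"
    and G :: "('ob, 'b, 'od, 'd) dgfun"
    and L :: "('oc, 'c, 'od, 'd) dgfun"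
    and A :: "('k, 'ob \<times> 'oc \<times> 'd, 'b \<times> 'c \<times> 'd) dgcat"
    and T :: "('k, 'ob \<times> 'oc \<times> 'd, 'b \<times> 'c \<times> 'd, 'b \<times> 'c \<times> 'd) dgbimod"
    and Q :: "('k, 'ob \<times> 'oc \<times> 'd, 'b \<times> 'c, 'b \<times> 'c \<times> 'd) dgbimod"
  assumes "dg_category B" "dg_category C" "dg_category D"
    and "dg_functor B D G" "dg_functor C D L"
    and A: "A = fiber_product B C D G L"
    and T: "T = Dtilde B C D G L"
    and Q: "Q = Qbimod B C"
  shows
    \<comment> \<open>the short exact sequence of bimodules\<close>
    "dg_category A \<and>
     short_exact_bimodules A T (diagonal A) Q incl proj \<and>
    \<comment> \<open>the long exact sequence of bimodules over the homotopy category\<close>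
     lin_category (H0 A) \<and>
     long_exact_bimodules (H0 A) (Hbimod T) (Hbimod (diagonal A)) (Hbimod Q)
       (\<lambda>n X Y. coh_map (cx (diagonal A) X Y) (incl X Y) n)
       (\<lambda>n X Y. coh_map (cx Q X Y) (proj X Y) n)
       (\<lambda>n X Y. connecting (cx T X Y) (cx (diagonal A) X Y) (incl X Y) (proj X Y) n) \<and>
    \<comment> \<open>the short exact sequence of Hochschild complexes and its long exact sequence\<close>
     short_exact (hoch A T) (hoch A (diagonal A)) (hoch A Q) (hoch_map A incl) (hoch_map A proj) \<and>
     long_exact (HH A T) (HH A (diagonal A)) (HH A Q)
       (coh_map (hoch A (diagonal A)) (hoch_map A incl))
       (coh_map (hoch A Q) (hoch_map A proj))
       (connecting (hoch A T) (hoch A (diagonal A)) (hoch_map A incl) (hoch_map A proj)) \<and>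
    \<comment> \<open>the zero on the left, if nothing comes in from degree \<open>-1\<close>\<close>
     (carrier (HH A Q (-1)) = {\<zero>\<^bsub>HH A Q (-1)\<^esub>} \<longrightarrow>
       inj_on (coh_map (hoch A (diagonal A)) (hoch_map A incl) 0) (carrier (HH A T 0))) \<and>
    \<comment> \<open>the zero on the left without condition, for the Hochschild complexes starting in degree 0\<close>
     long_exact (cohomology (nonneg_part (hoch A T)))
       (cohomology (nonneg_part (hoch A (diagonal A))))
       (cohomology (nonneg_part (hoch A Q)))
       (coh_map (nonneg_part (hoch A (diagonal A))) (hoch_map A incl))
       (coh_map (nonneg_part (hoch A Q)) (hoch_map A proj))
       (connecting (nonneg_part (hoch A T)) (nonneg_part (hoch A (diagonal A)))
          (hoch_map A incl) (hoch_map A proj)) \<and>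
     inj_on (coh_map (nonneg_part (hoch A (diagonal A))) (hoch_map A incl) 0)
       (carrier (cohomology (nonneg_part (hoch A T)) 0))"
proof -
  interpret homotopy_fiber_product B C D G L
    using assms(1-5) by unfold_locales
  interpret h: short_exact_cplx "hoch A T" "hoch A (diagonal A)" "hoch A Q" "hoch_map A incl" "hoch_map A proj"
    unfolding A T Q by unfold_locales (rule short_exact_hoch_E)
  interpret h0: short_exact_cplx "nonneg_part (hoch A T)" "nonneg_part (hoch A (diagonal A))"
    "nonneg_part (hoch A Q)" "hoch_map A incl" "hoch_map A proj"
    by unfold_locales (rule short_exact_nonneg_part[OF h.short_exact])
  have "dg_category A" "short_exact_bimodules A T (diagonal A) Q incl proj" "lin_category (H0 A)"
    unfolding A T Q by (rule dg_category_E short_exact_E E.lin_category_H0)+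
  moreover have "long_exact_bimodules (H0 A) (Hbimod T) (Hbimod (diagonal A)) (Hbimod Q)
       (\<lambda>n X Y. coh_map (cx (diagonal A) X Y) (incl X Y) n)
       (\<lambda>n X Y. coh_map (cx Q X Y) (proj X Y) n)
       (\<lambda>n X Y. connecting (cx T X Y) (cx (diagonal A) X Y) (incl X Y) (proj X Y) n)"
    unfolding A T Q by (rule ses.long_exact_Hbimod)
  moreover have "carrier (HH A Q (-1)) = {\<zero>\<^bsub>HH A Q (-1)\<^esub>} \<longrightarrow>
       inj_on (coh_map (hoch A (diagonal A)) (hoch_map A incl) 0) (carrier (HH A T 0))"
    using h.inj_on_coh_map[of 0] by simp
  \<comment> \<open>The truncated complex of \<open>Q\<close> has no cohomology in degree -1, so the
    condition for injectivity in degree 0 holds.\<close>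
  moreover have "inj_on (coh_map (nonneg_part (hoch A (diagonal A))) (hoch_map A incl) 0)
       (carrier (cohomology (nonneg_part (hoch A T)) 0))"
    using h0.inj_on_coh_map[of 0] h.g.L.cohomology_nonneg_part_neg[of "-1"] by simp
  ultimately show ?thesis
    using h.short_exact h.long_exact_cohomology h0.long_exact_cohomology by blast
qed

end
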